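(* Let $X$ be a preordered Banach space and let $Q$ be a compact Hausdorff space. Let $C$ be the set of norm-continuous functions $Q\to X$, let $B=B(Q,X^{**})$ be the set of bounded functions $Q\to X^{**}$, and let $S$ be the set of functions in $B$ with values in $X^{\mathsf{S}}$ that are continuous with respect to the topology $X^\bullet$ on $X^{\mathsf{S}}$. Then $S^1\subseteq C^{1\mathsf{C}}$, $S^1$ is $\mathbf{d}$-complete and $\mathbf{d}$-algebraic, and $C^1\subseteq S^{1\mathsf{F}}$, where $\mathbf{d}$ is the supremum distance on $B$. Moreover: (1) $C^{\mathsf{C}}=C^{\mathsf{D}}$. (2) If $Q$ and the norm topology of $X$ are second countable, then $C^{\mathsf{C}}=C^\sigma$. (3) If $X^1$ is $\leq$-bounded, then $C^{\mathsf{C}}=C^{\mathsf{m}}$. (4) If $X^*=X^*_+-X^*_+$, then $C^{\mathsf{C}}=S$ and $S^{\mathsf{F}}=C$; if in addition $X^{1>}$ is $\leq$-directed, then $C^{\mathsf{C}}=\overline{C^{\mathsf{m}}}$.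
   Context: Preordered Banach space: a real Banach space $X$ with a preorder $\leq$ given by $x\leq y\Leftrightarrow y-x\in X_+$, where $X_+=\{x\in X:x\geq0\}$ satisfies $X_+=\overline{X_+}=\mathbb{R}_+X_+=X_++X_+$ (a norm-closed convex cone, not necessarily proper or generating). $X^1=\{x\in X:\|x\|\leq1\}$, $X^{1>}=\{x\in X:\|x\|<1\}$. The dual $X^*$ has positive cone $X^*_+=\{\phi\in X^*:\phi[X_+]\subseteq\mathbb{R}_+\}$, and $X^{*1}_+=\{\phi\in X^*_+:\|\phi\|\leq1\}$ carries the weak* topology. $X$ is identified with its canonical image in $X^{**}$. For $x\in X^{**}$ put $\|x\|_\leq=\sup_{\phi\in X^{*1}_+}x(\phi)$ (on $X$ this equals $\inf_{x\leq b}\|b\|$), and $\mathbf{d}(a,b)=\|a-b\|_\leq$ for $a,b\in X^{**}$. This is a distance (a $[0,\infty]$-valued function satisfying the triangle inequality, not symmetric), and $\leq$ on $X^{**}$ is defined by $a\leq b\Leftrightarrow\mathbf{d}(a,b)=0$, extending $\leq$ on $X$. $X^{\mathsf{S}}=\{x\in X^{**}:x\text{ is lower semicontinuous on }X^{*1}_+\}$. The topology $X^\bullet$ on $X^{\mathsf{S}}$ is generated by the balls $\{x\in X^{\mathsf{S}}:\mathbf{d}(c,x)<\epsilon\}$ with $c\in X$ and $\epsilon>0$. On $B$ use the norm $\|f\|=\sup_{p\in Q}\|f(p)\|$ and the supremum distance, also denoted $\mathbf{d}$: $\mathbf{d}(f,g)=\sup_{p\in Q}\mathbf{d}(f(p),g(p))$;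 $f\leq g$ means $\mathbf{d}(f,g)=0$, i.e. $f(p)\leq g(p)$ for all $p\in Q$. $C$ is regarded as a subset of $B$. $C^1$ and $S^1$ are the sets of elements of $C$, respectively $S$, of norm at most $1$. Nets: a net is a family indexed by a (nonempty) set with a transitive, possibly non-reflexive, relation $\prec$ such that any two indices $\gamma,\delta$ have some $\lambda$ with $\gamma,\delta\prec\lambda$; $\liminf_\lambda r_\lambda=\lim_\gamma\inf_{\gamma\prec\lambda}r_\lambda$ and $\limsup_\lambda r_\lambda=\lim_\gamma\sup_{\gamma\prec\lambda}r_\lambda$. A net $(x_\lambda)$ is $\mathbf{d}$-Cauchy if $\lim_\gamma\sup_{\gamma\prec\delta}\mathbf{d}(x_\gamma,x_\delta)=0$; $\mathbf{d}$-dominating if $\sup_\gamma\lim_{\delta}\mathbf{d}(x_\gamma,x_\delta)=0$, i.e. $\lim_\delta\mathbf{d}(x_\gamma,x_\delta)=0$ for every index $\gamma$; $\leq$-increasing if $x_\gamma\leq x_\delta$ whenever $\gamma\prec\delta$. For a set $Z$ with a distance $\mathbf{d}$: $z\in Z$ is a $Z^\circ_\circ$-limit of a net $(z_\lambda)\subseteq Z$ if $\liminf_\lambda\mathbf{d}(z_\lambda,c)\geq\mathbf{d}(z,c)$ and $\liminf_\lambda\mathbf{d}(c,z_\lambda)\geq\mathbf{d}(c,z)$ for all $c\in Z$. $Z$ is $\mathbf{d}$-complete if every $\mathbf{d}$-Cauchy net in $Z$ has a $Z^\circ_\circ$-limit in $Z$. The set $Z^{\mathsf{F}}$ of $\mathbf{d}$-finite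 elements consists of those $y\in Z$ such that $\mathbf{d}(y,z_\lambda)\to\mathbf{d}(y,z)$ whenever $(z_\lambda)\subseteq Z$ is $\mathbf{d}$-Cauchy and $z\in Z$ is a $Z^\circ_\circ$-limit of it. $Z$ is $\mathbf{d}$-algebraic if every element of $Z$ is a $Z^\circ_\circ$-limit of a $\mathbf{d}$-Cauchy net in $Z^{\mathsf{F}}$. These notions are applied to $Z=S^1$ and $Z=S$ with the restriction of the supremum distance; $S^{1\mathsf{F}}=(S^1)^{\mathsf{F}}$. For $Y\subseteq B$, with limits meaning $B^\circ_\circ$-limits in $B$: $Y^{\mathsf{C}}$ is the set of limits of $\mathbf{d}$-Cauchy nets in $Y$; $Y^{\mathsf{D}}$ the set of limits of $\mathbf{d}$-dominating nets in $Y$; $Y^{\mathsf{m}}$ the set of limits of $\leq$-increasing nets in $Y$; $Y^\sigma$ the set of limits of $\leq$-increasing sequences in $Y$. $C^{1\mathsf{C}}=(C^1)^{\mathsf{C}}$. $\overline{C^{\mathsf{m}}}$ is the norm closure of $C^{\mathsf{m}}$ in $B$. $X^1$ is $\leq$-bounded if there is $x\in X$ with $x\leq y$ for all $y\in X^1$ (equivalently, as $X^1=-X^1$, $X^1$ has an upper bound in $X$). $X^{1>}$ is $\leq$-directed if any $a,b\in X^{1>}$ have some $c\in X^{1>}$ with $a,b\leq c$. *)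

theory Defs
  imports "HOL-Analysis.Analysis"
begin

section \<open>Nets and distances\<close>

definition directed_index :: "'i set \<Rightarrow> ('i \<Rightarrow> 'i \<Rightarrow> bool) \<Rightarrow> bool" where
  "directed_index I R \<longleftrightarrow>
     I \<noteq> {} \<and> transp_on I R \<and> (\<forall>\<gamma>\<in>I. \<forall>\<delta>\<in>I. \<exists>\<kappa>\<in>I. R \<gamma> \<kappa> \<and> R \<delta> \<kappa>)"

definition net_filter :: "'i set \<Rightarrow> ('i \<Rightarrow> 'i \<Rightarrow> bool) \<Rightarrow> 'i filter" where
  "net_filter I R = (INF \<gamma>\<in>I. principal {\<delta>\<in>I. R \<gamma> \<delta>})"

lemma eventually_net_filter:
  assumes "directed_index I R"
  shows "eventually P (net_filter I R) \<longleftrightarrow> (\<exists>\<gamma>\<in>I. \<forall>\<delta>\<in>I. R \<gamma> \<delta> \<longrightarrow> P \<delta>)"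
proof -
  have "eventually P (net_filter I R) \<longleftrightarrow>
      (\<exists>\<gamma>\<in>I. eventually P (principal {\<delta>\<in>I. R \<gamma> \<delta>}))"
    unfolding net_filter_def
  proof (rule eventually_INF_base)
    show "I \<noteq> {}" using assms by (auto simp: directed_index_def)
  next
    fix a b assume ab: "a \<in> I" "b \<in> I"
    then obtain c where c: "c \<in> I" "R a c" "R b c"
      using assms unfolding directed_index_def by blast
    moreover have "transp_on I R" using assms by (auto simp: directed_index_def)
    ultimately have "{\<delta>\<in>I. R c \<delta>} \<subseteq> {\<delta>\<in>I. R a \<delta>} \<inter> {\<delta>\<in>I. R b \<delta>}"
      using ab by (auto dest: transp_onD)
    then show "\<exists>x\<in>I. principal {\<delta>\<in>I. R x \<delta>} \<le>
        inf (principal {\<delta>\<in>I. R a \<delta>}) (principal {\<delta>\<in>I. R b \<delta>})"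
      using c(1) by auto
  qed
  then show ?thesis by (auto simp: eventually_principal)
qed

lemma Liminf_net_filter:
  fixes r :: "'i \<Rightarrow> ennreal"
  assumes "directed_index I R"
  shows "Liminf (net_filter I R) r = (SUP \<gamma>\<in>I. INF \<delta>\<in>{\<delta>\<in>I. R \<gamma> \<delta>}. r \<delta>)"
proof (rule antisym)
  show "Liminf (net_filter I R) r \<le> (SUP \<gamma>\<in>I. INF \<delta>\<in>{\<delta>\<in>I. R \<gamma> \<delta>}. r \<delta>)"
    unfolding Liminf_def
  proof (rule SUP_least)
    fix P assume "P \<in> {P. eventually P (net_filter I R)}"
    then obtain g where g: "g \<in> I" "\<forall>\<delta>\<in>I. R g \<delta> \<longrightarrow> P \<delta>"
      using eventually_net_filter[OF assms] by auto
    have "Inf (r ` Collect P) \<le> (INF \<delta>\<in>{\<delta>\<in>I. R g \<delta>}. r \<delta>)"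
      using g(2) by (intro INF_superset_mono) auto
    also have "\<dots> \<le> (SUP \<gamma>\<in>I. INF \<delta>\<in>{\<delta>\<in>I. R \<gamma> \<delta>}. r \<delta>)"
      using g(1) by (rule SUP_upper)
    finally show "Inf (r ` Collect P) \<le> (SUP \<gamma>\<in>I. INF \<delta>\<in>{\<delta>\<in>I. R \<gamma> \<delta>}. r \<delta>)" .
  qed
  show "(SUP \<gamma>\<in>I. INF \<delta>\<in>{\<delta>\<in>I. R \<gamma> \<delta>}. r \<delta>) \<le> Liminf (net_filter I R) r"
  proof (rule SUP_least)
    fix g assume "g \<in> I"
    then have "eventually (\<lambda>\<delta>. \<delta> \<in> I \<and> R g \<delta>) (net_filter I R)"
      using eventually_net_filter[OF assms] by blast
    then show "(INF \<delta>\<in>{\<delta>\<in>I. R g \<delta>}. r \<delta>) \<le> Liminf (net_filter I R) r"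
      unfolding Liminf_def by (intro SUP_upper2) auto
  qed
qed

definition cauchy_net ::
  "('z \<Rightarrow> 'z \<Rightarrow> ennreal) \<Rightarrow> 'i set \<Rightarrow> ('i \<Rightarrow> 'i \<Rightarrow> bool) \<Rightarrow> ('i \<Rightarrow> 'z) \<Rightarrow> bool" where
  "cauchy_net d I R x \<longleftrightarrow>
     ((\<lambda>\<gamma>. SUP \<delta>\<in>{\<delta>\<in>I. R \<gamma> \<delta>}. d (x \<gamma>) (x \<delta>)) \<longlongrightarrow> 0) (net_filter I R)"

definition dominating_net ::
  "('z \<Rightarrow> 'z \<Rightarrow> ennreal) \<Rightarrow> 'i set \<Rightarrow> ('i \<Rightarrow> 'i \<Rightarrow> bool) \<Rightarrow> ('i \<Rightarrow> 'z) \<Rightarrow> bool" where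
  "dominating_net d I R x \<longleftrightarrow>
     (\<forall>\<gamma>\<in>I. ((\<lambda>\<delta>. d (x \<gamma>) (x \<delta>)) \<longlongrightarrow> 0) (net_filter I R))"

definition increasing_net ::
  "('z \<Rightarrow> 'z \<Rightarrow> ennreal) \<Rightarrow> 'i set \<Rightarrow> ('i \<Rightarrow> 'i \<Rightarrow> bool) \<Rightarrow> ('i \<Rightarrow> 'z) \<Rightarrow> bool" where
  "increasing_net d I R x \<longleftrightarrow> (\<forall>\<gamma>\<in>I. \<forall>\<delta>\<in>I. R \<gamma> \<delta> \<longrightarrow> d (x \<gamma>) (x \<delta>) = 0)"

definition circ_limit ::
  "('z \<Rightarrow> 'z \<Rightarrow> ennreal) \<Rightarrow> 'z set \<Rightarrow> 'i set \<Rightarrow> ('i \<Rightarrow> 'i \<Rightarrow> bool) \<Rightarrow> ('i \<Rightarrow> 'z) \<Rightarrow> 'z \<Rightarrow> bool" where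
  "circ_limit d Z I R x z \<longleftrightarrow>
     (\<forall>c\<in>Z. d z c \<le> Liminf (net_filter I R) (\<lambda>\<delta>. d (x \<delta>) c) \<and>
            d c z \<le> Liminf (net_filter I R) (\<lambda>\<delta>. d c (x \<delta>)))"

text \<open>
  One cannot quantify over index types inside a definition. The definitions below therefore
  range over nets whose index set is an arbitrary subset of one sufficiently large type, which
  depends only on the type of the values. Nothing is lost: by \<open>net_reindex\<close> below, every net
  over any index type can be replaced by one over this type with the same values, the same
  limits and the same Cauchy, dominating and increasing properties. The consequences for each
  notion are spelled out in the \<open>_any\<close> lemmas.
\<close>

type_synonym 'z net_index = "'z \<times> ('z \<times> 'z set) set"

definition cauchy_limits ::
  "('z \<Rightarrow> 'z \<Rightarrow> ennreal) \<Rightarrow> 'z set \<Rightarrow> 'z set \<Rightarrow> 'z set" where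
  "cauchy_limits d Z Y = {z\<in>Z. \<exists>(I :: 'z net_index set) R x.
     directed_index I R \<and> x ` I \<subseteq> Y \<and> cauchy_net d I R x \<and> circ_limit d Z I R x z}"

definition dominating_limits ::
  "('z \<Rightarrow> 'z \<Rightarrow> ennreal) \<Rightarrow> 'z set \<Rightarrow> 'z set \<Rightarrow> 'z set" where
  "dominating_limits d Z Y = {z\<in>Z. \<exists>(I :: 'z net_index set) R x.
     directed_index I R \<and> x ` I \<subseteq> Y \<and> dominating_net d I R x \<and> circ_limit d Z I R x z}"

definition increasing_limits ::
  "('z \<Rightarrow> 'z \<Rightarrow> ennreal) \<Rightarrow> 'z set \<Rightarrow> 'z set \<Rightarrow> 'z set" where
  "increasing_limits d Z Y = {z\<in>Z. \<exists>(I :: 'z net_index set) R x.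
     directed_index I R \<and> x ` I \<subseteq> Y \<and> increasing_net d I R x \<and> circ_limit d Z I R x z}"

definition increasing_seq_limits ::
  "('z \<Rightarrow> 'z \<Rightarrow> ennreal) \<Rightarrow> 'z set \<Rightarrow> 'z set \<Rightarrow> 'z set" where
  "increasing_seq_limits d Z Y = {z\<in>Z. \<exists>x :: nat \<Rightarrow> 'z.
     range x \<subseteq> Y \<and> increasing_net d UNIV (<) x \<and> circ_limit d Z UNIV (<) x z}"

definition d_complete :: "('z \<Rightarrow> 'z \<Rightarrow> ennreal) \<Rightarrow> 'z set \<Rightarrow> bool" where
  "d_complete d Z \<longleftrightarrow> (\<forall>(I :: 'z net_index set) R x.
     directed_index I R \<and> x ` I \<subseteq> Z \<and> cauchy_net d I R x \<longrightarrow> (\<exists>z\<in>Z. circ_limit d Z I R x z))"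

definition finite_elements :: "('z \<Rightarrow> 'z \<Rightarrow> ennreal) \<Rightarrow> 'z set \<Rightarrow> 'z set" where
  "finite_elements d Z = {y\<in>Z. \<forall>(I :: 'z net_index set) R x. \<forall>z\<in>Z.
     directed_index I R \<and> x ` I \<subseteq> Z \<and> cauchy_net d I R x \<and> circ_limit d Z I R x z \<longrightarrow>
       ((\<lambda>\<delta>. d y (x \<delta>)) \<longlongrightarrow> d y z) (net_filter I R)}"

definition d_algebraic :: "('z \<Rightarrow> 'z \<Rightarrow> ennreal) \<Rightarrow> 'z set \<Rightarrow> bool" where
  "d_algebraic d Z \<longleftrightarrow> (\<forall>z\<in>Z. \<exists>(I :: 'z net_index set) R x.
     directed_index I R \<and> x ` I \<subseteq> finite_elements d Z \<and> cauchy_net d I R x \<and>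
       circ_limit d Z I R x z)"

lemma net_reindex:
  fixes I :: "'i set" and R :: "'i \<Rightarrow> 'i \<Rightarrow> bool" and x :: "'i \<Rightarrow> 'z"
  assumes dir: "directed_index I R"
  obtains J :: "'z net_index set" and S :: "'z net_index \<Rightarrow> 'z net_index \<Rightarrow> bool"
    and y :: "'z net_index \<Rightarrow> 'z"
  where "directed_index J S" "y ` J = x ` I"
    "filtermap y (net_filter J S) = filtermap x (net_filter I R)"
    "\<And>d. cauchy_net d I R x \<Longrightarrow> cauchy_net d J S y"
    "\<And>d. dominating_net d I R x \<Longrightarrow> dominating_net d J S y"
    "\<And>d. increasing_net d I R x \<Longrightarrow> increasing_net d J S y"
    "\<And>d Z z. circ_limit d Z J S y z \<longleftrightarrow> circ_limit d Z I R x z"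
proof -
  define up where "up \<gamma> = {\<delta>\<in>I. R \<gamma> \<delta>}" for \<gamma>
  define ix where "ix \<gamma> = (x \<gamma>, (\<lambda>\<delta>. (x \<delta>, x ` up \<delta>)) ` up \<gamma>)" for \<gamma>
  define S :: "'z net_index \<Rightarrow> 'z net_index \<Rightarrow> bool"
    where "S = (\<lambda>a b. (fst b, fst ` snd b) \<in> snd a \<and> snd b \<subseteq> snd a)"
  define J where "J = ix ` I"
  have tr: "transp_on I R" using dir by (auto simp: directed_index_def)
  have fs: "fst (ix \<gamma>) = x \<gamma>" "fst ` snd (ix \<gamma>) = x ` up \<gamma>" for \<gamma>
    by (auto simp: ix_def image_image)
  have RS: "S (ix \<gamma>) (ix \<delta>)" if "\<gamma> \<in> I" "\<delta> \<in> I" "R \<gamma> \<delta>" for \<gamma> \<delta>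
  proof -
    have "up \<delta> \<subseteq> up \<gamma>" using that tr by (auto simp: up_def dest: transp_onD)
    moreover have "\<delta> \<in> up \<gamma>" using that by (simp add: up_def)
    ultimately show ?thesis unfolding S_def fs by (auto simp: ix_def)
  qed
  have SR: "\<exists>\<delta>\<in>up \<gamma>. fst k = x \<delta> \<and> fst ` snd k = x ` up \<delta>" if "S (ix \<gamma>) k" for \<gamma> k
    using that by (auto simp: S_def ix_def)
  have succ: "fst ` {k\<in>J. S j k} = fst ` snd j" if "j \<in> J" for j
  proof -
    from that obtain \<gamma> where \<gamma>: "\<gamma> \<in> I" "j = ix \<gamma>" by (auto simp: J_def)
    have "fst ` {k\<in>J. S j k} = x ` up \<gamma>"
    proof
      show "fst ` {k\<in>J. S j k} \<subseteq> x ` up \<gamma>" using SR \<gamma> by fastforce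
      show "x ` up \<gamma> \<subseteq> fst ` {k\<in>J. S j k}"
      proof
        fix v assume "v \<in> x ` up \<gamma>"
        then obtain \<delta> where d: "\<delta> \<in> I" "R \<gamma> \<delta>" "v = x \<delta>" by (auto simp: up_def)
        then have "ix \<delta> \<in> {k\<in>J. S j k}" using RS \<gamma> by (auto simp: J_def)
        then show "v \<in> fst ` {k\<in>J. S j k}" using d(3) fs(1) by (metis image_eqI)
      qed
    qed
    then show ?thesis using \<gamma> fs by simp
  qed
  have dirJ: "directed_index J S"
    unfolding directed_index_def
  proof (intro conjI ballI)
    show "J \<noteq> {}" using dir by (auto simp: J_def directed_index_def)
    show "transp_on J S" by (rule transp_onI) (auto simp: S_def)
    fix a b assume "a \<in> J" "b \<in> J"
    then obtain \<gamma> \<delta> where g: "\<gamma> \<in> I" "\<delta> \<in> I" "a = ix \<gamma>" "b = ix \<delta>" by (auto simp: J_def)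
    then obtain e where "e \<in> I" "R \<gamma> e" "R \<delta> e" using dir unfolding directed_index_def by blast
    then show "\<exists>k\<in>J. S a k \<and> S b k" using RS g by (auto simp: J_def)
  qed
  have img: "fst ` J = x ` I" by (auto simp: J_def image_image fs)
  have filt: "filtermap fst (net_filter J S) = filtermap x (net_filter I R)"
  proof (rule filter_eq_iff[THEN iffD2], intro allI)
    fix P
    have "(\<exists>j\<in>J. \<forall>k\<in>J. S j k \<longrightarrow> P (fst k)) \<longleftrightarrow> (\<exists>j\<in>J. \<forall>v\<in>fst ` {k\<in>J. S j k}. P v)"
      by blast
    also have "\<dots> \<longleftrightarrow> (\<exists>j\<in>J. \<forall>v\<in>fst ` snd j. P v)" using succ by auto
    also have "\<dots> \<longleftrightarrow> (\<exists>\<gamma>\<in>I. \<forall>v\<in>x ` up \<gamma>. P v)"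
      by (simp only: J_def bex_simps fs)
    also have "\<dots> \<longleftrightarrow> (\<exists>\<gamma>\<in>I. \<forall>\<delta>\<in>I. R \<gamma> \<delta> \<longrightarrow> P (x \<delta>))" by (auto simp: up_def)
    finally show "eventually P (filtermap fst (net_filter J S)) \<longleftrightarrow>
        eventually P (filtermap x (net_filter I R))"
      by (simp add: eventually_filtermap eventually_net_filter[OF dir]
          eventually_net_filter[OF dirJ])
  qed
  have map: "filtermap (\<lambda>k. g (fst k)) (net_filter J S) =
      filtermap (\<lambda>\<delta>. g (x \<delta>)) (net_filter I R)" for g :: "'z \<Rightarrow> ennreal"
    using arg_cong[OF filt, of "filtermap g"] by (simp add: filtermap_filtermap)
  have lim: "((\<lambda>k. g (fst k)) \<longlongrightarrow> l) (net_filter J S) \<longleftrightarrow>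
      ((\<lambda>\<delta>. g (x \<delta>)) \<longlongrightarrow> l) (net_filter I R)" for g :: "'z \<Rightarrow> ennreal" and l
    using map[of g] by (simp add: filterlim_def)
  have linf: "Liminf (net_filter J S) (\<lambda>k. g (fst k)) =
      Liminf (net_filter I R) (\<lambda>\<delta>. g (x \<delta>))" for g :: "'z \<Rightarrow> ennreal"
  proof -
    have "(INF k\<in>{k\<in>J. S j k}. g (fst k)) = (INF v\<in>fst ` snd j. g v)" if "j \<in> J" for j
      by (simp add: succ[OF that, symmetric] image_image)
    then have "(SUP j\<in>J. INF k\<in>{k\<in>J. S j k}. g (fst k)) = (SUP j\<in>J. INF v\<in>fst ` snd j. g v)"
      by (rule SUP_cong[OF refl])
    also have "\<dots> = (SUP \<gamma>\<in>I. INF v\<in>fst ` snd (ix \<gamma>). g v)"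
      unfolding J_def image_image ..
    also have "\<dots> = (SUP \<gamma>\<in>I. INF \<delta>\<in>{\<delta>\<in>I. R \<gamma> \<delta>}. g (x \<delta>))"
      unfolding fs image_image up_def ..
    finally show ?thesis
      by (simp add: Liminf_net_filter[OF dir] Liminf_net_filter[OF dirJ])
  qed
  have cau: "cauchy_net d J S fst" if "cauchy_net d I R x" for d
    unfolding cauchy_net_def
  proof (rule order_tendstoI)
    fix a :: ennreal assume "a < 0" then show "\<forall>\<^sub>F j in net_filter J S.
        a < (SUP k\<in>{k\<in>J. S j k}. d (fst j) (fst k))" by simp
  next
    fix a :: ennreal assume "0 < a"
    from order_tendstoD(2)[OF that[unfolded cauchy_net_def] this]
    obtain \<gamma> where \<gamma>: "\<gamma> \<in> I"
      "\<And>\<delta>. \<delta> \<in> up \<gamma> \<Longrightarrow> (SUP e\<in>up \<delta>. d (x \<delta>) (x e)) < a"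
      unfolding eventually_net_filter[OF dir] up_def by auto
    have "(SUP k\<in>{k\<in>J. S j k}. d (fst j) (fst k)) < a" if j: "j \<in> J" "S (ix \<gamma>) j" for j
    proof -
      obtain \<delta> where \<delta>: "\<delta> \<in> up \<gamma>" "fst j = x \<delta>" "fst ` snd j = x ` up \<delta>"
        using SR[OF j(2)] by auto
      have "(SUP k\<in>{k\<in>J. S j k}. d (fst j) (fst k)) = (SUP v\<in>fst ` {k\<in>J. S j k}. d (fst j) v)"
        by (simp add: image_image)
      also have "\<dots> = (SUP e\<in>up \<delta>. d (x \<delta>) (x e))"
        by (simp only: succ[OF j(1)] \<delta> image_image)
      finally show ?thesis using \<gamma>(2)[OF \<delta>(1)] by simp
    qed
    then show "\<forall>\<^sub>F j in net_filter J S. (SUP k\<in>{k\<in>J. S j k}. d (fst j) (fst k)) < a"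
      unfolding eventually_net_filter[OF dirJ] using imageI[OF \<gamma>(1), of ix]
      unfolding J_def[symmetric] by blast
  qed
  have dom: "dominating_net d J S fst" if "dominating_net d I R x" for d
    using that lim unfolding dominating_net_def by (auto simp: J_def fs)
  have inc: "increasing_net d J S fst" if "increasing_net d I R x" for d
    unfolding increasing_net_def
  proof (intro ballI impI)
    fix j k assume jk: "j \<in> J" "S j k"
    then obtain \<gamma> where g: "\<gamma> \<in> I" "j = ix \<gamma>" by (auto simp: J_def)
    then obtain \<delta> where "\<delta> \<in> up \<gamma>" "fst k = x \<delta>" using SR[of \<gamma> k] jk(2) by blast
    then show "d (fst j) (fst k) = 0"
      using that g unfolding increasing_net_def by (auto simp: up_def fs)
  qed
  have cir: "circ_limit d Z J S fst z \<longleftrightarrow> circ_limit d Z I R x z" for d Z z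
  proof -
    have "Liminf (net_filter J S) (\<lambda>k. d c (fst k)) = Liminf (net_filter I R) (\<lambda>\<delta>. d c (x \<delta>))"
      "Liminf (net_filter J S) (\<lambda>k. d (fst k) c) = Liminf (net_filter I R) (\<lambda>\<delta>. d (x \<delta>) c)" for c
      by (rule linf[of "d c"], rule linf[of "\<lambda>v. d v c"])
    then show ?thesis unfolding circ_limit_def by simp
  qed
  show ?thesis by (rule that[OF dirJ img filt cau dom inc cir])
qed

lemma cauchy_limits_any:
  fixes x :: "'i \<Rightarrow> 'z"
  assumes "directed_index I R" "x ` I \<subseteq> Y" "cauchy_net d I R x" "circ_limit d Z I R x z" "z \<in> Z"
  shows "z \<in> cauchy_limits d Z Y"
proof (rule net_reindex[OF assms(1), of x])
  fix J :: "'z net_index set" and S y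
  assume J: "directed_index J S" "y ` J = x ` I"
    "\<And>d. cauchy_net d I R x \<Longrightarrow> cauchy_net d J S y"
    "\<And>d Z z. circ_limit d Z J S y z \<longleftrightarrow> circ_limit d Z I R x z"
  have "directed_index J S \<and> y ` J \<subseteq> Y \<and> cauchy_net d J S y \<and> circ_limit d Z J S y z"
    using assms(2) J(1,2) J(3)[OF assms(3)] J(4)[THEN iffD2, OF assms(4)] by simp
  then show ?thesis unfolding cauchy_limits_def
    using assms(5) by blast
qed

lemma dominating_limits_any:
  fixes x :: "'i \<Rightarrow> 'z"
  assumes "directed_index I R" "x ` I \<subseteq> Y" "dominating_net d I R x" "circ_limit d Z I R x z" "z \<in> Z"
  shows "z \<in> dominating_limits d Z Y"
proof (rule net_reindex[OF assms(1), of x])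
  fix J :: "'z net_index set" and S y
  assume J: "directed_index J S" "y ` J = x ` I"
    "\<And>d. dominating_net d I R x \<Longrightarrow> dominating_net d J S y"
    "\<And>d Z z. circ_limit d Z J S y z \<longleftrightarrow> circ_limit d Z I R x z"
  have "directed_index J S \<and> y ` J \<subseteq> Y \<and> dominating_net d J S y \<and> circ_limit d Z J S y z"
    using assms(2) J(1,2) J(3)[OF assms(3)] J(4)[THEN iffD2, OF assms(4)] by simp
  then show ?thesis unfolding dominating_limits_def
    using assms(5) by blast
qed

lemma increasing_limits_any:
  fixes x :: "'i \<Rightarrow> 'z"
  assumes "directed_index I R" "x ` I \<subseteq> Y" "increasing_net d I R x" "circ_limit d Z I R x z" "z \<in> Z"
  shows "z \<in> increasing_limits d Z Y"
proof (rule net_reindex[OF assms(1), of x])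
  fix J :: "'z net_index set" and S y
  assume J: "directed_index J S" "y ` J = x ` I"
    "\<And>d. increasing_net d I R x \<Longrightarrow> increasing_net d J S y"
    "\<And>d Z z. circ_limit d Z J S y z \<longleftrightarrow> circ_limit d Z I R x z"
  have "directed_index J S \<and> y ` J \<subseteq> Y \<and> increasing_net d J S y \<and> circ_limit d Z J S y z"
    using assms(2) J(1,2) J(3)[OF assms(3)] J(4)[THEN iffD2, OF assms(4)] by simp
  then show ?thesis unfolding increasing_limits_def
    using assms(5) by blast
qed

lemma d_complete_any:
  fixes x :: "'i \<Rightarrow> 'z"
  assumes "d_complete d Z" "directed_index I R" "x ` I \<subseteq> Z" "cauchy_net d I R x"
  shows "\<exists>z\<in>Z. circ_limit d Z I R x z"
proof (rule net_reindex[OF assms(2), of x])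
  fix J :: "'z net_index set" and S y
  assume J: "directed_index J S" "y ` J = x ` I"
    "\<And>d. cauchy_net d I R x \<Longrightarrow> cauchy_net d J S y"
    "\<And>d Z z. circ_limit d Z J S y z \<longleftrightarrow> circ_limit d Z I R x z"
  have "directed_index J S \<and> y ` J \<subseteq> Z \<and> cauchy_net d J S y"
    using assms(3) J(1,2) J(3)[OF assms(4)] by simp
  then have "\<exists>z\<in>Z. circ_limit d Z J S y z" using assms(1) unfolding d_complete_def by blast
  then show ?thesis by (simp only: J(4))
qed

lemma finite_elements_any:
  fixes x :: "'i \<Rightarrow> 'z"
  assumes "y \<in> finite_elements d Z" "directed_index I R" "x ` I \<subseteq> Z" "cauchy_net d I R x"
    "circ_limit d Z I R x z" "z \<in> Z"
  shows "((\<lambda>\<delta>. d y (x \<delta>)) \<longlongrightarrow> d y z) (net_filter I R)"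
proof (rule net_reindex[OF assms(2), of x])
  fix J :: "'z net_index set" and S v
  assume 1: "directed_index J S" "v ` J = x ` I"
    "filtermap v (net_filter J S) = filtermap x (net_filter I R)"
    "\<And>d. cauchy_net d I R x \<Longrightarrow> cauchy_net d J S v"
    "\<And>d Z z. circ_limit d Z J S v z \<longleftrightarrow> circ_limit d Z I R x z"
  then have "((\<lambda>\<delta>. d y (v \<delta>)) \<longlongrightarrow> d y z) (net_filter J S)"
    using assms unfolding finite_elements_def by blast
  moreover have "filtermap (\<lambda>k. d y (v k)) (net_filter J S) =
      filtermap (\<lambda>\<delta>. d y (x \<delta>)) (net_filter I R)"
    using arg_cong[OF 1(3), of "filtermap (d y)"] by (simp add: filtermap_filtermap)
  ultimately show ?thesis by (simp add: filterlim_def)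
qed

lemma d_algebraic_any:
  fixes Z :: "'z set"
  assumes "\<And>z. z \<in> Z \<Longrightarrow> \<exists>(I :: 'i set) R x. directed_index I R \<and>
    x ` I \<subseteq> finite_elements d Z \<and> cauchy_net d I R x \<and> circ_limit d Z I R x z"
  shows "d_algebraic d Z"
  unfolding d_algebraic_def
proof
  fix z assume "z \<in> Z"
  from assms[OF this] obtain I :: "'i set" and R x where *: "directed_index I R"
    "x ` I \<subseteq> finite_elements d Z" "cauchy_net d I R x" "circ_limit d Z I R x z" by blast
  show "\<exists>(I :: 'z net_index set) R x. directed_index I R \<and>
    x ` I \<subseteq> finite_elements d Z \<and> cauchy_net d I R x \<and> circ_limit d Z I R x z"
  proof (rule net_reindex[OF *(1), of x])
    fix J :: "'z net_index set" and S y
    assume J: "directed_index J S" "y ` J = x ` I"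
      "\<And>d. cauchy_net d I R x \<Longrightarrow> cauchy_net d J S y"
      "\<And>d Z z. circ_limit d Z J S y z \<longleftrightarrow> circ_limit d Z I R x z"
    have "directed_index J S \<and> y ` J \<subseteq> finite_elements d Z \<and> cauchy_net d J S y \<and>
        circ_limit d Z J S y z"
      using *(2) J(1,2) J(3)[OF *(3)] J(4)[THEN iffD2, OF *(4)] by simp
    then show ?thesis by blast
  qed
qed


section \<open>Preordered Banach spaces\<close>

text \<open>The preorder is represented by its positive cone \<open>P\<close>.\<close>

definition preordered_banach :: "'a::banach set \<Rightarrow> bool" where
  "preordered_banach P \<longleftrightarrow> closed P \<and> convex_cone P"

lemma preordered_banach_iff:
  "preordered_banach P \<longleftrightarrow>
     0 \<in> P \<and> closure P = P \<and> {r *\<^sub>R x |r x. 0 \<le> r \<and> x \<in> P} = P \<and> {x + y |x y. x \<in> P \<and> y \<in> P} = P"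
proof
  assume *: "preordered_banach P"
  then have z: "0 \<in> P" and s: "\<And>r x. 0 \<le> r \<Longrightarrow> x \<in> P \<Longrightarrow> r *\<^sub>R x \<in> P"
    and a: "\<And>x y. x \<in> P \<Longrightarrow> y \<in> P \<Longrightarrow> x + y \<in> P"
    by (auto simp: preordered_banach_def convex_cone_iff)
  have "{r *\<^sub>R x |r x. 0 \<le> r \<and> x \<in> P} = P" using s by (auto intro: exI[of _ 1])
  moreover have "{x + y |x y. x \<in> P \<and> y \<in> P} = P" using a z by (auto intro: exI[of _ 0])
  ultimately show "0 \<in> P \<and> closure P = P \<and> {r *\<^sub>R x |r x. 0 \<le> r \<and> x \<in> P} = P
      \<and> {x + y |x y. x \<in> P \<and> y \<in> P} = P"
    using z * by (simp add: preordered_banach_def)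
next
  assume *: "0 \<in> P \<and> closure P = P \<and> {r *\<^sub>R x |r x. 0 \<le> r \<and> x \<in> P} = P
      \<and> {x + y |x y. x \<in> P \<and> y \<in> P} = P"
  then have "closed P" by (metis closed_closure)
  moreover have "convex_cone P" unfolding convex_cone_iff using * by blast
  ultimately show "preordered_banach P" by (simp add: preordered_banach_def)
qed

definition cone_le :: "'a::banach set \<Rightarrow> 'a \<Rightarrow> 'a \<Rightarrow> bool" where
  "cone_le P x y \<longleftrightarrow> y - x \<in> P"

definition unit_ball_bounded :: "'a::banach set \<Rightarrow> bool" where
  "unit_ball_bounded P \<longleftrightarrow> (\<exists>x. \<forall>y\<in>cball 0 1. cone_le P x y)"

definition open_ball_directed :: "'a::banach set \<Rightarrow> bool" where
  "open_ball_directed P \<longleftrightarrow>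
     (\<forall>a\<in>ball 0 1. \<forall>b\<in>ball 0 1. \<exists>c\<in>ball 0 1. cone_le P a c \<and> cone_le P b c)"

type_synonym 'a dual = "'a \<Rightarrow>\<^sub>L real"
type_synonym 'a bidual = "'a dual \<Rightarrow>\<^sub>L real"

definition dual_cone :: "'a::banach set \<Rightarrow> 'a dual set" where
  "dual_cone P = {\<phi>. \<forall>x\<in>P. 0 \<le> blinfun_apply \<phi> x}"

definition dual_ball :: "'a::banach set \<Rightarrow> 'a dual set" where
  "dual_ball P = dual_cone P \<inter> cball 0 1"

definition dual_generated :: "'a::banach set \<Rightarrow> bool" where
  "dual_generated P \<longleftrightarrow> (UNIV :: 'a dual set) = {\<phi> - \<psi> |\<phi> \<psi>. \<phi> \<in> dual_cone P \<and> \<psi> \<in> dual_cone P}"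

lift_definition canon :: "'a::banach \<Rightarrow> 'a bidual" is "\<lambda>x (\<phi> :: 'a dual). blinfun_apply \<phi> x"
  by (rule blinfun.bounded_linear_left)

definition pos_norm :: "'a::banach set \<Rightarrow> 'a bidual \<Rightarrow> real" where
  "pos_norm P x = (SUP \<phi>\<in>dual_ball P. blinfun_apply x \<phi>)"

definition bidual_dist :: "'a::banach set \<Rightarrow> 'a bidual \<Rightarrow> 'a bidual \<Rightarrow> ennreal" where
  "bidual_dist P a b = ennreal (pos_norm P (a - b))"

text \<open>
  For functionals, the strong operator topology of the library is the topology of pointwise
  convergence, i.e. the weak* topology.
\<close>

definition lsc_bidual :: "'a::banach set \<Rightarrow> 'a bidual set" where
  "lsc_bidual P = {x. \<forall>r. openin (subtopology strong_operator_topology (dual_ball P))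
                            {\<phi>\<in>dual_ball P. r < blinfun_apply x \<phi>}}"

definition bullet_topology :: "'a::banach set \<Rightarrow> 'a bidual topology" where
  "bullet_topology P = topology_generated_by
     {{x\<in>lsc_bidual P. bidual_dist P (canon c) x < ennreal \<epsilon>} |c \<epsilon>. 0 < \<epsilon>}"


section \<open>Function spaces\<close>

text \<open>Functions on \<open>Q\<close> are represented by their extensional versions.\<close>

definition bounded_funs :: "'q topology \<Rightarrow> ('q \<Rightarrow> 'a::banach bidual) set" where
  "bounded_funs Q = {f \<in> extensional (topspace Q). bounded (f ` topspace Q)}"

text \<open>The supremum is taken in \<open>[0, \<infinity>]\<close>, so that it is 0 for empty \<open>Q\<close>.\<close>

definition sup_norm :: "'q topology \<Rightarrow> ('q \<Rightarrow> 'a::banach bidual) \<Rightarrow> ennreal" where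
  "sup_norm Q f = (SUP p\<in>topspace Q. ennreal (norm (f p)))"

definition sup_dist ::
  "'a::banach set \<Rightarrow> 'q topology \<Rightarrow> ('q \<Rightarrow> 'a bidual) \<Rightarrow> ('q \<Rightarrow> 'a bidual) \<Rightarrow> ennreal" where
  "sup_dist P Q f g = (SUP p\<in>topspace Q. bidual_dist P (f p) (g p))"

definition cont_funs :: "'q topology \<Rightarrow> ('q \<Rightarrow> 'a::banach bidual) set" where
  "cont_funs Q = {restrict (\<lambda>p. canon (g p)) (topspace Q) |g. continuous_map Q euclidean g}"

definition lsc_funs :: "'a::banach set \<Rightarrow> 'q topology \<Rightarrow> ('q \<Rightarrow> 'a bidual) set" where
  "lsc_funs P Q = {f \<in> bounded_funs Q.
     f ` topspace Q \<subseteq> lsc_bidual P \<and> continuous_map Q (bullet_topology P) f}"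

definition unit_part :: "'q topology \<Rightarrow> ('q \<Rightarrow> 'a::banach bidual) set \<Rightarrow> ('q \<Rightarrow> 'a bidual) set" where
  "unit_part Q Y = {f\<in>Y. sup_norm Q f \<le> 1}"

definition norm_closure :: "'q topology \<Rightarrow> ('q \<Rightarrow> 'a::banach bidual) set \<Rightarrow> ('q \<Rightarrow> 'a bidual) set" where
  "norm_closure Q Y =
     {f \<in> bounded_funs Q. \<forall>\<epsilon>>0. \<exists>g\<in>Y. sup_norm Q (\<lambda>p. f p - g p) < ennreal \<epsilon>}"

end

theory Submission
  imports Defs
begin

text \<open>
  Everything is reduced to estimates on the weak* compact dual ball. A minimax argument over the
  dual ball, together with Goldstine's theorem, shows that a lower semicontinuous element of the
  bidual is approximated by elements of the ball of \<open>X\<close> of the same radius that dominate, up to small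
  errors, finitely many prescribed lower approximations. Partitions of unity carry this over to
  functions on \<open>Q\<close>, so every element of \<open>S\<close> is the limit of its formal ball net. Conversely, norm
  bounded Cauchy nets converge pointwise on \<open>Q\<close> times the dual ball, and Dini's argument transfers
  the continuity to the limit and yields finiteness of continuous functions.

  In \<open>X\<close>, an estimate \<open>\<parallel>x\<parallel>\<^sub>\<le> < r\<close> is witnessed by an upper bound of norm less than \<open>r\<close>. Subtracting a
  series of such bounds turns a Cauchy sequence of continuous functions into an increasing one; this
  relates Cauchy, dominating and increasing limits. If the dual cone generates, the dual ball
  determines an equivalent norm, so that limits in \<open>B\<close> are unique and Cauchy nets with a limit are
  bounded.
\<close>

section \<open>Sublinear functionals\<close>

text \<open>The distances see a bidual element only through its values on
  \<open>dual_ball P\<close>. Limits are therefore determined only up to the preorder unless the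
  dual cone generates, and without a norm bound weak* compactness yields no limit. This is why the
  comparison of Cauchy, dominating and increasing limits uses only distances to a given limit and
  never its semicontinuity.

  Goldstine's theorem controls finitely many functionals at a time, whereas a distance is a supremum
  over the whole dual ball. For lower semicontinuous z the function sending \<phi> to \<phi> x - z
  \<phi> is upper semicontinuous, as minimax requires, but its negative need not be. So approximants
  can be kept below z up to a uniform error, while they come close to z from below only at one
  functional at a time. The same asymmetry recurs for Cauchy nets: the upper estimate against the
  limit is uniform, the lower one pointwise, and compactness has to bridge the gap.

  The least norm of an upper bound of x is sublinear in x but need not be symmetric. Hahn--Banach is
  therefore needed for sublinear functionals; the symmetric case is the cone
  \<open>{0}\<close>.\<close>

definition sublinear :: "('a::real_vector \<Rightarrow> real) \<Rightarrow> bool" where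
  "sublinear q \<longleftrightarrow> (\<forall>x y. q (x + y) \<le> q x + q y) \<and> (\<forall>r\<ge>0. \<forall>x. q (r *\<^sub>R x) = r * q x)"

lemma sublinearI:
  assumes "\<And>x y. q (x + y) \<le> q x + q y" "\<And>r x. 0 < r \<Longrightarrow> q (r *\<^sub>R x) \<le> r * q x" "q 0 = 0"
  shows "sublinear q"
  unfolding sublinear_def
proof (intro conjI allI impI)
  fix r :: real and x assume "0 \<le> r"
  show "q (r *\<^sub>R x) = r * q x"
  proof (cases "r = 0")
    case False
    with \<open>0 \<le> r\<close> have r: "0 < r" by simp
    have "q ((1/r) *\<^sub>R (r *\<^sub>R x)) \<le> (1/r) * q (r *\<^sub>R x)" using r by (intro assms(2)) simp
    then have "r * q x \<le> q (r *\<^sub>R x)" using r by (simp add: field_simps)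
    with assms(2)[OF r, of x] show ?thesis by simp
  qed (simp add: assms(3))
qed (rule assms(1))

lemma sublinear_add: "sublinear q \<Longrightarrow> q (x + y) \<le> q x + q y"
  and sublinear_scale: "sublinear q \<Longrightarrow> 0 \<le> r \<Longrightarrow> q (r *\<^sub>R x) = r * q x"
  by (auto simp: sublinear_def)

lemma sublinear_zero: "sublinear q \<Longrightarrow> q 0 = 0"
  using sublinear_scale[of q 0 0] by simp

lemma sublinear_minus: "sublinear q \<Longrightarrow> - q (- x) \<le> q x"
  using sublinear_add[of q x "-x"] sublinear_zero[of q] by simp

text \<open>The infimum lowers q in the direction of - y as far as sublinearity allows: for any
  sublinear m \<le> q, subadditivity forces m (- y) \<ge> - m y \<ge> - q y.\<close>

lemma sublinear_tangent:
  assumes q: "sublinear q"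
  obtains m where "sublinear m" "m \<le> q" "m (- y) \<le> - q y"
proof -
  define m where "m x = (INF t\<in>{0..}. q (x + t *\<^sub>R y) - t * q y)" for x
  have lb: "- q (- x) \<le> q (x + t *\<^sub>R y) - t * q y" if "0 \<le> t" for x t
    using sublinear_add[OF q, of "x + t *\<^sub>R y" "- x"] sublinear_scale[OF q that, of y]
    by (simp add: algebra_simps)
  then have bdd: "bdd_below ((\<lambda>t. q (x + t *\<^sub>R y) - t * q y) ` {0..})" for x
    by (intro bdd_belowI2) auto
  have ub: "m x \<le> q (x + t *\<^sub>R y) - t * q y" if "0 \<le> t" for x t
    unfolding m_def using that by (intro cINF_lower[OF bdd]) simp
  have gb: "c \<le> m x" if "\<And>t. 0 \<le> t \<Longrightarrow> c \<le> q (x + t *\<^sub>R y) - t * q y" for c x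
    unfolding m_def using that by (intro cINF_greatest) auto
  have "sublinear m"
  proof (rule sublinearI)
    fix x x'
    have "m (x + x') - (q (x' + s *\<^sub>R y) - s * q y) \<le> m x" if s: "0 \<le> s" for s
    proof (rule gb)
      fix t :: real assume t: "0 \<le> t"
      have "m (x + x') \<le> q (x + x' + (t + s) *\<^sub>R y) - (t + s) * q y"
        using s t by (intro ub) simp
      also have "\<dots> \<le> (q (x + t *\<^sub>R y) - t * q y) + (q (x' + s *\<^sub>R y) - s * q y)"
        using sublinear_add[OF q, of "x + t *\<^sub>R y" "x' + s *\<^sub>R y"] by (simp add: algebra_simps)
      finally show "m (x + x') - (q (x' + s *\<^sub>R y) - s * q y) \<le> q (x + t *\<^sub>R y) - t * q y"
        by simp
    qed
    then have "m (x + x') - m x \<le> m x'" by (intro gb) (simp add: algebra_simps)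
    then show "m (x + x') \<le> m x + m x'" by simp
  next
    fix r :: real and x assume r: "0 < r"
    have "m (r *\<^sub>R x) / r \<le> m x"
    proof (rule gb)
      fix t :: real assume t: "0 \<le> t"
      have "m (r *\<^sub>R x) \<le> q (r *\<^sub>R x + (r * t) *\<^sub>R y) - (r * t) * q y" using r t by (intro ub) simp
      also have "r *\<^sub>R x + (r * t) *\<^sub>R y = r *\<^sub>R (x + t *\<^sub>R y)" by (simp add: algebra_simps)
      also have "q \<dots> = r * q (x + t *\<^sub>R y)" using r by (simp add: sublinear_scale[OF q])
      finally have "m (r *\<^sub>R x) \<le> r * (q (x + t *\<^sub>R y) - t * q y)" by (simp add: algebra_simps)
      then show "m (r *\<^sub>R x) / r \<le> q (x + t *\<^sub>R y) - t * q y" using r by (simp add: field_simps)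
    qed
    then show "m (r *\<^sub>R x) \<le> r * m x" using r by (simp add: field_simps)
  next
    have "m 0 \<le> 0" using ub[of 0 0] sublinear_zero[OF q] by simp
    moreover have "0 \<le> m 0" by (rule gb) (simp add: sublinear_scale[OF q])
    ultimately show "m 0 = 0" by simp
  qed
  moreover have "m \<le> q" using ub[of 0] by (simp add: le_fun_def)
  moreover have "m (- y) \<le> - q y" using ub[of 1 "-y"] by (simp add: sublinear_zero[OF q])
  ultimately show ?thesis by (rule that)
qed

text \<open>Zorn's lemma for the reversed pointwise order. A chain is bounded by its pointwise
  infimum, which is finite because every member a satisfies - q (- x) \<le> a x.\<close>

lemma sublinear_minimal:
  assumes q: "sublinear q"
  obtains m where "sublinear m" "m \<le> q" "\<And>n. sublinear n \<Longrightarrow> n \<le> m \<Longrightarrow> n = m"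
proof -
  define A where "A = {m. sublinear m \<and> m \<le> q}"
  have "\<exists>m\<in>A. \<forall>a\<in>A. a \<le> m \<longrightarrow> a = m"
  proof (rule predicate_Zorn[where P = "\<lambda>a b. b \<le> a"])
    show "partial_order_on A (relation_of (\<lambda>a b. b \<le> a) A)"
      by (rule partial_order_on_relation_ofI) auto
  next
    fix \<C> assume "\<C> \<in> Chains (relation_of (\<lambda>a b. b \<le> a) A)"
    then have CA: "\<C> \<subseteq> A" and ch: "\<And>a b. a \<in> \<C> \<Longrightarrow> b \<in> \<C> \<Longrightarrow> a \<le> b \<or> b \<le> a"
      by (auto simp: Chains_def relation_of_def)
    show "\<exists>u\<in>A. \<forall>a\<in>\<C>. u \<le> a"
    proof (cases "\<C> = {}")
      case True
      then show ?thesis using q by (intro bexI[of _ q]) (auto simp: A_def)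
    next
      case False
      define u where "u x = (INF a\<in>\<C>. a x)" for x
      have sub: "sublinear a" "a \<le> q" if "a \<in> \<C>" for a using that CA by (auto simp: A_def)
      have "- q (- x) \<le> a x" if "a \<in> \<C>" for a x
        using sublinear_minus[OF sub(1)[OF that], of x] le_funD[OF sub(2)[OF that], of "-x"] by simp
      then have bdd: "bdd_below ((\<lambda>a. a x) ` \<C>)" for x by (intro bdd_belowI2)
      have ub: "u x \<le> a x" if "a \<in> \<C>" for a x unfolding u_def using that by (intro cINF_lower[OF bdd])
      have gb: "c \<le> u x" if "\<And>a. a \<in> \<C> \<Longrightarrow> c \<le> a x" for c x
        unfolding u_def using that False by (intro cINF_greatest) auto
      have "sublinear u"
      proof (rule sublinearI)
        fix x y
        have "u (x + y) - b y \<le> u x" if b: "b \<in> \<C>" for b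
        proof (rule gb)
          fix a assume a: "a \<in> \<C>"
          \<comment> \<open>In a chain the smaller of a and b serves both summands.\<close>
          have "u (x + y) \<le> a x + b y"
            using ch[OF a b]
          proof
            assume "a \<le> b"
            then show ?thesis
              using ub[OF a, of "x+y"] sublinear_add[OF sub(1)[OF a], of x y] le_funD[of a b y] by simp
          next
            assume "b \<le> a"
            then show ?thesis
              using ub[OF b, of "x+y"] sublinear_add[OF sub(1)[OF b], of x y] le_funD[of b a x] by simp
          qed
          then show "u (x + y) - b y \<le> a x" by simp
        qed
        then have "u (x + y) - u x \<le> u y" by (intro gb) (simp add: algebra_simps)
        then show "u (x + y) \<le> u x + u y" by simp
      next
        fix r :: real and x assume r: "0 < r"
        have "u (r *\<^sub>R x) / r \<le> u x"
        proof (rule gb)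
          fix a assume "a \<in> \<C>"
          then show "u (r *\<^sub>R x) / r \<le> a x"
            using ub[of a "r *\<^sub>R x"] sublinear_scale[OF sub(1), of a r x] r by (simp add: field_simps)
        qed
        then show "u (r *\<^sub>R x) \<le> r * u x" using r by (simp add: field_simps)
      next
        obtain a where a: "a \<in> \<C>" using False by blast
        have "u 0 \<le> 0" using ub[OF a, of 0] sublinear_zero[OF sub(1)[OF a]] by simp
        moreover have "0 \<le> u 0" by (rule gb) (simp add: sublinear_zero[OF sub(1)])
        ultimately show "u 0 = 0" by simp
      qed
      moreover have "u \<le> q"
      proof -
        obtain a where a: "a \<in> \<C>" using False by blast
        have "u \<le> a" using ub[OF a] by (simp add: le_fun_def)
        then show ?thesis using sub(2)[OF a] by (rule order_trans)
      qed
      ultimately show ?thesis using ub by (intro bexI[of _ u]) (auto simp: A_def le_fun_def)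
    qed
  qed
  then obtain m where "sublinear m" "m \<le> q" "\<And>a. a \<in> A \<Longrightarrow> a \<le> m \<Longrightarrow> a = m"
    by (auto simp: A_def)
  then show ?thesis using order_trans by (intro that[of m]) (auto simp: A_def)
qed

text \<open>A minimal sublinear functional is odd by \<open>sublinear_tangent\<close>, and an odd
  sublinear functional is linear. The value at x0 is fixed beforehand by lowering q at - x0, which
  minimisation preserves.\<close>

lemma hahn_banach_sublinear:
  fixes q :: "'a::real_vector \<Rightarrow> real"
  assumes "sublinear q"
  obtains f where "linear f" "\<And>x. f x \<le> q x" "f x0 = q x0"
proof -
  obtain q' where q': "sublinear q'" "q' \<le> q" "q' (- x0) \<le> - q x0"
    using sublinear_tangent[OF assms] by metis
  obtain m where m: "sublinear m" "m \<le> q'" "\<And>n. sublinear n \<Longrightarrow> n \<le> m \<Longrightarrow> n = m"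
    using sublinear_minimal[OF q'(1)] by metis
  have neg: "m (- y) = - m y" for y
  proof -
    obtain n where "sublinear n" "n \<le> m" "n (- y) \<le> - m y" using sublinear_tangent[OF m(1)] by metis
    then have "m (- y) \<le> - m y" using m(3)[of n] by simp
    then show ?thesis using sublinear_minus[OF m(1), of y] by simp
  qed
  have "linear m"
  proof (rule linearI)
    fix x y
    show "m (x + y) = m x + m y"
      using sublinear_add[OF m(1), of x y] sublinear_add[OF m(1), of "x + y" "- y"] neg[of y] by simp
  next
    fix r x
    show "m (r *\<^sub>R x) = r *\<^sub>R m x"
      using sublinear_scale[OF m(1), of r x] sublinear_scale[OF m(1), of "-r" x] neg[of "r *\<^sub>R x"]
      by (cases "0 \<le> r") simp_all
  qed
  moreover have le: "m x \<le> q x" for x using m(2) q'(2) by (meson le_funD order_trans)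
  moreover have "m x0 = q x0"
    using le_funD[OF m(2), of "- x0"] q'(3) neg[of x0] le[of x0] by simp
  ultimately show ?thesis by (rule that)
qed

section \<open>Minimax\<close>

text \<open>The points (f t, g t) avoid the quadrant where both coordinates are at least b, and by
  concavity a line separates them from it. The number \<alpha> in the proof is the ratio of the two
  weights: the supremum of the ratios demanded by points with f t \<ge> b, which \<open>key\<close>
  shows to be compatible with every point with g t > b.\<close>

lemma concave_combination_le:
  fixes f g :: "'a::real_vector \<Rightarrow> real"
  assumes f: "concave_on T f" and g: "concave_on T g"
    and small: "\<And>t. t \<in> T \<Longrightarrow> f t < b \<or> g t < b"
  shows "\<exists>s\<in>{0..1}. \<forall>t\<in>T. s * f t + (1 - s) * g t \<le> b"
proof (cases "(\<forall>t\<in>T. f t \<le> b) \<or> (\<forall>t\<in>T. g t \<le> b)")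
  case True
  then show ?thesis by (auto intro: bexI[of _ 0] bexI[of _ 1])
next
  case False
  then obtain t0 where t0: "t0 \<in> T" "b < g t0" by force
  define A where "A = {t\<in>T. b \<le> f t}"
  have A: "A \<noteq> {}" using False by (force simp: A_def)
  have key: "(f t1 - b) * (g t2 - b) \<le> (f t2 - b) * (g t1 - b)"
    if t1: "t1 \<in> A" and t2: "t2 \<in> T" "b \<le> g t2" for t1 t2
  proof -
    have gt1: "g t1 < b" using t1 small[of t1] by (auto simp: A_def)
    \<comment> \<open>The weight at which the chord of g between t1 and t2 takes the value b.
      Concavity gives g t \<ge> b there, so f t < b.\<close>
    define l where "l = (g t2 - b) / (g t2 - g t1)"
    have l: "0 \<le> l" "l \<le> 1" using t2 gt1 by (auto simp: l_def field_simps)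
    define t where "t = l *\<^sub>R t1 + (1 - l) *\<^sub>R t2"
    have l': "l * (g t2 - g t1) = g t2 - b" using gt1 t2 by (simp add: l_def)
    have "l * g t1 + (1 - l) * g t2 \<le> g t"
      unfolding t_def using g l t1 t2 by (auto simp: concave_on_iff A_def)
    moreover have "l * g t1 + (1 - l) * g t2 = b" using l' by (simp add: algebra_simps)
    ultimately have "b \<le> g t" by simp
    moreover have "t \<in> T"
      unfolding t_def using concave_on_imp_convex[OF g] l t1 t2 by (auto simp: convex_def A_def)
    ultimately have "f t < b" using small[of t] by force
    moreover have "l * f t1 + (1 - l) * f t2 \<le> f t"
      unfolding t_def using f l t1 t2 by (auto simp: concave_on_iff A_def)
    ultimately have "l * (f t1 - b) + (1 - l) * (f t2 - b) \<le> 0" by (simp add: algebra_simps)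
    then have "(g t2 - g t1) * (l * (f t1 - b) + (1 - l) * (f t2 - b)) \<le> 0"
      using gt1 t2 by (simp add: mult_nonneg_nonpos)
    also have "(g t2 - g t1) * (l * (f t1 - b) + (1 - l) * (f t2 - b))
        = l * (g t2 - g t1) * (f t1 - f t2) + (g t2 - g t1) * (f t2 - b)" by (simp add: algebra_simps)
    finally show ?thesis unfolding l' by (simp add: algebra_simps)
  qed
  have neg: "g t < b" if "t \<in> A" for t using that small[of t] by (auto simp: A_def)
  define \<alpha> where "\<alpha> = (SUP t\<in>A. (f t - b) / (b - g t))"
  have le: "(f t - b) / (b - g t) \<le> (b - f t2) / (g t2 - b)" if "t \<in> A" "t2 \<in> T" "b < g t2" for t t2
    using key[of t t2] that neg[of t] by (simp add: field_simps)
  have bdd: "bdd_above ((\<lambda>t. (f t - b) / (b - g t)) ` A)"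
    using le[of _ t0] t0 by (intro bdd_aboveI2[of _ _ "(b - f t0) / (g t0 - b)"]) auto
  have up: "(f t - b) / (b - g t) \<le> \<alpha>" if "t \<in> A" for t
    unfolding \<alpha>_def using that bdd by (rule cSUP_upper)
  obtain t1 where t1: "t1 \<in> A" using A by blast
  have "0 \<le> (f t1 - b) / (b - g t1)" using t1 neg[OF t1] by (simp add: A_def)
  then have \<alpha>0: "0 \<le> \<alpha>" using up[OF t1] by linarith
  have main: "f t - b + \<alpha> * (g t - b) \<le> 0" if t: "t \<in> T" for t
  proof (cases "t \<in> A")
    case True
    then show ?thesis using up[OF True] neg[OF True] by (simp add: field_simps)
  next
    case False
    then have ft: "f t < b" using t by (auto simp: A_def)
    show ?thesis
    proof (cases "b < g t")
      case True
      have "\<alpha> \<le> (b - f t) / (g t - b)"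
        unfolding \<alpha>_def using A le t True by (intro cSUP_least) auto
      then show ?thesis using True by (simp add: field_simps)
    next
      case False
      then have "\<alpha> * (g t - b) \<le> 0" using \<alpha>0 by (simp add: mult_nonneg_nonpos)
      then show ?thesis using ft by simp
    qed
  qed
  show ?thesis
  proof (intro bexI[of _ "1 / (1 + \<alpha>)"] ballI)
    fix t assume "t \<in> T"
    have "1 / (1 + \<alpha>) * f t + (1 - 1 / (1 + \<alpha>)) * g t - b
        = (f t - b + \<alpha> * (g t - b)) / (1 + \<alpha>)"
      using \<alpha>0 by (simp add: divide_simps) (simp add: algebra_simps)
    also have "\<dots> \<le> 0" using main[OF \<open>t \<in> T\<close>] \<alpha>0 by (simp add: divide_nonpos_nonneg)
    finally show "1 / (1 + \<alpha>) * f t + (1 - 1 / (1 + \<alpha>)) * g t \<le> b" by simp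
  qed (use \<alpha>0 in auto)
qed

text \<open>Induction removes one function f at a time: on the part T' of T where f t \<ge> a the
  remaining functions suffice, and T' is convex because f is concave. The two-function lemma then
  combines f with the function found on T'. The midpoint of a and b leaves room for the strict
  inequality that it needs.\<close>

lemma minimax_finite:
  fixes T :: "'a::real_vector set" and \<F> :: "('a \<Rightarrow> real) set"
  assumes "finite F" "F \<noteq> {}" "F \<subseteq> \<F>"
    and "\<And>f. f \<in> \<F> \<Longrightarrow> concave_on T f"
    and comb: "\<And>f g s. f \<in> \<F> \<Longrightarrow> g \<in> \<F> \<Longrightarrow> 0 \<le> s \<Longrightarrow> s \<le> 1 \<Longrightarrow> (\<lambda>t. s * f t + (1 - s) * g t) \<in> \<F>"
    and "\<And>t. t \<in> T \<Longrightarrow> \<exists>f\<in>F. f t < a" and "a < b"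
  shows "\<exists>g\<in>\<F>. \<forall>t\<in>T. g t \<le> b"
  using assms(1-4,6-)
proof (induction F arbitrary: T b rule: finite_ne_induct)
  case (singleton f)
  then show ?case by (intro bexI[of _ f]) fastforce+
next
  case (insert f F)
  define T' where "T' = {t\<in>T. a \<le> f t}"
  have f: "f \<in> \<F>" "concave_on T f" using insert.prems by auto
  have "convex T'"
  proof (rule convexI)
    fix x y :: 'a and u v :: real
    assume xy: "x \<in> T'" "y \<in> T'" and uv: "0 \<le> u" "0 \<le> v" "u + v = 1"
    have "u *\<^sub>R x + v *\<^sub>R y \<in> T" "u * f x + v * f y \<le> f (u *\<^sub>R x + v *\<^sub>R y)"
      using f(2) xy uv by (auto simp: concave_on_iff T'_def convex_def)
    moreover have "u * a + v * a \<le> u * f x + v * f y"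
      using xy uv by (intro add_mono mult_left_mono) (auto simp: T'_def)
    moreover have "u * a + v * a = a" using uv(3) by (metis distrib_right mult_1)
    ultimately show "u *\<^sub>R x + v *\<^sub>R y \<in> T'" by (auto simp: T'_def)
  qed
  then have "concave_on T' h" if "h \<in> \<F>" for h
    using insert.prems(2)[OF that] unfolding concave_on_iff T'_def by auto
  moreover have "\<exists>h\<in>F. h t < a" if "t \<in> T'" for t
    using insert.prems(3)[of t] that by (auto simp: T'_def)
  ultimately have "\<exists>g\<in>\<F>. \<forall>t\<in>T'. g t \<le> (a + b) / 2"
    using insert.prems by (intro insert.IH) auto
  then obtain g where g: "g \<in> \<F>" "\<And>t. t \<in> T' \<Longrightarrow> g t \<le> (a + b) / 2" by blast
  have "\<exists>s\<in>{0..1}. \<forall>t\<in>T. s * f t + (1 - s) * g t \<le> b"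
  proof (rule concave_combination_le[OF f(2) insert.prems(2)[OF g(1)]])
    fix t assume "t \<in> T"
    then show "f t < b \<or> g t < b"
      using g(2)[of t] insert.prems(4) by (cases "t \<in> T'") (auto simp: T'_def)
  qed
  then show ?case using comb[OF f(1) g(1)] by force
qed

text \<open>Each point of X has its own function and its own level below b. A finite subcover leaves
  finitely many levels, whose maximum is below b; this turns a pointwise strict bound into a uniform
  one.\<close>

lemma minimax_compact:
  fixes X :: "'a::real_vector topology" and \<F> :: "('a \<Rightarrow> real) set"
  assumes "compact_space X" "\<F> \<noteq> {}"
    and conc: "\<And>f. f \<in> \<F> \<Longrightarrow> concave_on (topspace X) f"
    and usc: "\<And>f a. f \<in> \<F> \<Longrightarrow> openin X {t\<in>topspace X. f t < a}"
    and comb: "\<And>f g s. f \<in> \<F> \<Longrightarrow> g \<in> \<F> \<Longrightarrow> 0 \<le> s \<Longrightarrow> s \<le> 1 \<Longrightarrow> (\<lambda>t. s * f t + (1 - s) * g t) \<in> \<F>"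
    and neg: "\<And>t. t \<in> topspace X \<Longrightarrow> \<exists>f\<in>\<F>. f t < b"
  shows "\<exists>g\<in>\<F>. \<exists>a<b. \<forall>t\<in>topspace X. g t \<le> a"
proof -
  define U where "U = (\<lambda>(f :: 'a \<Rightarrow> real, a). {t\<in>topspace X. f t < a})"
  have "\<exists>V. finite V \<and> V \<subseteq> U ` (\<F> \<times> {..<b}) \<and> topspace X \<subseteq> \<Union>V"
  proof -
    have "topspace X \<subseteq> \<Union>(U ` (\<F> \<times> {..<b}))"
    proof
      fix t assume t: "t \<in> topspace X"
      then obtain f where f: "f \<in> \<F>" "f t < b" using neg by blast
      then obtain a where "f t < a" "a < b" using dense by blast
      then have "t \<in> U (f, a)" "(f, a) \<in> \<F> \<times> {..<b}" using t f by (auto simp: U_def)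
      then show "t \<in> \<Union>(U ` (\<F> \<times> {..<b}))" by blast
    qed
    moreover have "\<forall>V\<in>U ` (\<F> \<times> {..<b}). openin X V" using usc by (auto simp: U_def)
    ultimately show ?thesis using assms(1) unfolding compact_space_alt by metis
  qed
  then obtain M where M: "M \<subseteq> \<F> \<times> {..<b}" "finite M" "topspace X \<subseteq> \<Union>(U ` M)"
    by (metis finite_subset_image)
  obtain f0 where f0: "f0 \<in> \<F>" using assms(2) by blast
  \<comment> \<open>The extra pair keeps the set nonempty when X is empty.\<close>
  define M' where "M' = insert (f0, b - 1) M"
  have M': "finite M'" "M' \<noteq> {}" "M' \<subseteq> \<F> \<times> {..<b}" using M f0 by (auto simp: M'_def)
  define a where "a = Max (snd ` M')"
  have "a < b" unfolding a_def using M' by (subst Max_less_iff) auto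
  then obtain c where c: "a < c" "c < b" using dense by blast
  have "\<exists>g\<in>\<F>. \<forall>t\<in>topspace X. g t \<le> c"
  proof (rule minimax_finite[of "fst ` M'" _ _ a])
    show "fst ` M' \<subseteq> \<F>" using M'(3) by auto
    fix t assume "t \<in> topspace X"
    then obtain f e where fe: "(f, e) \<in> M" "f t < e" using M(3) by (auto simp: U_def)
    have "snd (f, e) \<le> a" unfolding a_def using fe M'(1) by (intro Max_ge imageI finite_imageI) (simp_all add: M'_def)
    then show "\<exists>f\<in>fst ` M'. f t < a" using fe by (intro bexI[of _ f]) (force simp: M'_def)+
  qed (use M' c conc comb in auto)
  then show ?thesis using c(2) by blast
qed

section \<open>Weak* compactness\<close>

text \<open>Banach--Alaoglu: the ball is a closed subset of a product of compact intervals, and the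
  strong operator topology on functionals is pulled back from the product topology. It is used for
  functionals on X and again for functionals on the dual, where it provides limits in the
  bidual.\<close>

lemma compactin_strong_operator_cball:
  "compactin strong_operator_topology (cball 0 r :: ('b::real_normed_vector \<Rightarrow>\<^sub>L real) set)"
proof -
  let ?S = "blinfun_apply ` (cball 0 r :: ('b \<Rightarrow>\<^sub>L real) set)"
  \<comment> \<open>The condition \<open>0 \<le> r\<close> matters for negative r over the zero
    space, where the ball is empty although the zero map meets the other conditions.\<close>
  have eq: "?S = {f. (\<forall>x y. f (x + y) = f x + f y) \<and> (\<forall>c x. f (c *\<^sub>R x) = c * f x) \<and> (\<forall>x. \<bar>f x\<bar> \<le> r * norm x)}
      \<inter> {f. 0 \<le> r}"
  proof (intro set_eqI iffI)
    fix f assume "f \<in> ?S"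
    then obtain \<phi> where \<phi>: "f = blinfun_apply \<phi>" "norm \<phi> \<le> r" by auto
    have "\<bar>\<phi> x\<bar> \<le> r * norm x" for x
      using norm_blinfun[of \<phi> x] mult_right_mono[OF \<phi>(2), of "norm x"] by (simp add: order_trans)
    moreover have "0 \<le> r" using \<phi>(2) norm_ge_zero[of \<phi>] by linarith
    ultimately show "f \<in> {f. (\<forall>x y. f (x + y) = f x + f y) \<and> (\<forall>c x. f (c *\<^sub>R x) = c * f x) \<and> (\<forall>x. \<bar>f x\<bar> \<le> r * norm x)}
      \<inter> {f. 0 \<le> r}" by (simp add: \<phi>(1) blinfun.add_right blinfun.scaleR_right)
  next
    fix f :: "'b \<Rightarrow> real" assume f: "f \<in> {f. (\<forall>x y. f (x + y) = f x + f y) \<and> (\<forall>c x. f (c *\<^sub>R x) = c * f x) \<and> (\<forall>x. \<bar>f x\<bar> \<le> r * norm x)}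
      \<inter> {f. 0 \<le> r}"
    then have "bounded_linear f"
      by (intro bounded_linear_intro[of _ r]) (auto simp: mult.commute)
    moreover from this have "norm (Blinfun f) \<le> r"
      using f by (intro norm_blinfun_bound) (auto simp: bounded_linear_Blinfun_apply split: if_splits)
    ultimately show "f \<in> ?S" by (intro image_eqI[of _ _ "Blinfun f"]) (auto simp: bounded_linear_Blinfun_apply)
  qed
  have ev: "continuous_on UNIV (\<lambda>f :: 'b \<Rightarrow> real. f x)" for x
    by (rule continuous_on_product_coordinates)
  have "closed ?S"
    unfolding eq
    by (intro closed_Int closed_Collect_conj closed_Collect_all closed_Collect_eq closed_Collect_le
        continuous_on_add continuous_on_mult continuous_on_const continuous_on_rabs ev)
  moreover have "?S \<subseteq> PiE UNIV (\<lambda>x. {- (r * norm x)..r * norm x})"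
    unfolding eq by (auto simp: abs_le_iff minus_le_iff)
  moreover have "compact (PiE UNIV (\<lambda>x :: 'b. {- (r * norm x)..r * norm x}))"
    using compactin_PiE[of "\<lambda>_. euclidean" UNIV "\<lambda>x :: 'b. {- (r * norm x)..r * norm x}"]
    by (simp add: euclidean_product_topology)
  ultimately have comp: "compact ?S" by (metis compact_Int_closed inf.absorb_iff2)
  show ?thesis
    unfolding compactin_def
  proof (intro conjI allI impI)
    fix \<U> :: "('b \<Rightarrow>\<^sub>L real) set set"
    assume U: "Ball \<U> (openin strong_operator_topology) \<and> cball 0 r \<subseteq> \<Union>\<U>"
    define \<W> where "\<W> = {W. open W \<and> blinfun_apply -` W \<in> \<U>}"
    have "?S \<subseteq> \<Union>\<W>"
    proof
      fix f assume "f \<in> ?S"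
      then obtain \<phi> where \<phi>: "f = blinfun_apply \<phi>" "\<phi> \<in> cball 0 r" by blast
      then obtain V where V: "V \<in> \<U>" "\<phi> \<in> V" using U by blast
      then obtain W where W: "open W" "V = blinfun_apply -` W"
        using U unfolding strong_operator_topology_def openin_pullback_topology by auto
      then show "f \<in> \<Union>\<W>" using V \<phi> by (auto simp: \<W>_def)
    qed
    then obtain \<W>' where W': "\<W>' \<subseteq> \<W>" "finite \<W>'" "?S \<subseteq> \<Union>\<W>'"
      using comp unfolding compact_eq_Heine_Borel by (metis (no_types, lifting) \<W>_def mem_Collect_eq)
    then show "\<exists>\<V>. finite \<V> \<and> \<V> \<subseteq> \<U> \<and> cball 0 r \<subseteq> \<Union>\<V>"
      by (intro exI[of _ "(\<lambda>W. blinfun_apply -` W) ` \<W>'"]) (fastforce simp: \<W>_def)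
  qed (simp add: strong_operator_topology_topspace)
qed

section \<open>The positive part of the dual ball\<close>

lemma canon_apply [simp]: "blinfun_apply (canon x) \<phi> = blinfun_apply \<phi> x"
  by transfer simp

lemma canon_add: "canon (x + y) = canon x + canon y"
  and canon_diff: "canon (x - y) = canon x - canon y"
  and canon_scaleR: "canon (r *\<^sub>R x) = r *\<^sub>R canon x"
  and canon_zero: "canon 0 = 0"
  by (auto intro!: blinfun_eqI
      simp: blinfun.add_left blinfun.add_right blinfun.diff_left blinfun.diff_right
        blinfun.scaleR_left blinfun.scaleR_right)

lemma dual_ball_zero: "0 \<in> dual_ball P"
  by (simp add: dual_ball_def dual_cone_def)

lemma dual_ball_norm: "\<phi> \<in> dual_ball P \<Longrightarrow> norm \<phi> \<le> 1"
  by (simp add: dual_ball_def)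

lemma dual_ball_nonneg: "\<phi> \<in> dual_ball P \<Longrightarrow> x \<in> P \<Longrightarrow> 0 \<le> blinfun_apply \<phi> x"
  by (simp add: dual_ball_def dual_cone_def)

lemma convex_dual_ball: "convex (dual_ball P)"
proof -
  have "convex (dual_cone P)"
    by (rule convexI) (auto simp: dual_cone_def blinfun.add_left blinfun.scaleR_left)
  then show ?thesis unfolding dual_ball_def by (intro convex_Int convex_cball)
qed

lemma dual_cone_scaled:
  assumes "\<phi> \<in> dual_cone P"
  obtains \<psi> where "\<psi> \<in> dual_ball P" "\<phi> = norm \<phi> *\<^sub>R \<psi>"
proof
  \<comment> \<open>For \<phi> = 0 division by zero makes the witness 0, which also lies in the dual
    ball.\<close>
  show "(1 / norm \<phi>) *\<^sub>R \<phi> \<in> dual_ball P"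
    using assms by (auto simp: dual_ball_def dual_cone_def blinfun.scaleR_left)
qed auto

lemma blinfun_le_norm:
  fixes a :: "'b::real_normed_vector \<Rightarrow>\<^sub>L real"
  assumes "norm x \<le> 1"
  shows "\<bar>blinfun_apply a x\<bar> \<le> norm a"
  using norm_blinfun[of a x] mult_left_mono[OF assms, of "norm a"] by simp

lemma pos_norm_upper: "\<phi> \<in> dual_ball P \<Longrightarrow> blinfun_apply a \<phi> \<le> pos_norm P a"
  unfolding pos_norm_def
  using blinfun_le_norm[OF dual_ball_norm] by (intro cSUP_upper bdd_aboveI2[of _ _ "norm a"]) (auto simp: abs_le_iff)

lemma pos_norm_le_iff: "pos_norm P a \<le> r \<longleftrightarrow> (\<forall>\<phi>\<in>dual_ball P. blinfun_apply a \<phi> \<le> r)"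
proof
  assume "pos_norm P a \<le> r"
  then show "\<forall>\<phi>\<in>dual_ball P. blinfun_apply a \<phi> \<le> r" using pos_norm_upper order_trans by blast
next
  assume "\<forall>\<phi>\<in>dual_ball P. blinfun_apply a \<phi> \<le> r"
  then show "pos_norm P a \<le> r" unfolding pos_norm_def using dual_ball_zero by (intro cSUP_least) auto
qed

lemma pos_norm_nonneg: "0 \<le> pos_norm P a"
  using pos_norm_upper[OF dual_ball_zero, of a P] by (simp add: blinfun.zero_right)

lemma pos_norm_le_norm: "pos_norm P a \<le> norm a"
  using blinfun_le_norm[OF dual_ball_norm] by (fastforce simp: pos_norm_le_iff abs_le_iff)

lemma pos_norm_add: "pos_norm P (a + b) \<le> pos_norm P a + pos_norm P b"
  by (auto simp: pos_norm_le_iff blinfun.add_left intro!: add_mono pos_norm_upper)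

lemma pos_norm_triangle: "pos_norm P (a - c) \<le> pos_norm P (a - b) + pos_norm P (b - c)"
  using pos_norm_add[of P "a - b" "b - c"] by simp

lemma pos_norm_scaleR: "0 \<le> r \<Longrightarrow> pos_norm P (r *\<^sub>R a) \<le> r * pos_norm P a"
  by (auto simp: pos_norm_le_iff blinfun.scaleR_left intro!: mult_left_mono pos_norm_upper)

lemma convex_pos_norm_less: "convex {a. pos_norm P (a - b) < r}"
proof (rule convexI)
  fix x y and u v :: real
  assume xy: "x \<in> {a. pos_norm P (a - b) < r}" "y \<in> {a. pos_norm P (a - b) < r}"
    and uv: "0 \<le> u" "0 \<le> v" "u + v = 1"
  have "u *\<^sub>R x + v *\<^sub>R y - b = u *\<^sub>R x + v *\<^sub>R y - (u + v) *\<^sub>R b" using uv by simp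
  also have "\<dots> = u *\<^sub>R (x - b) + v *\<^sub>R (y - b)" by (simp add: algebra_simps)
  finally have "pos_norm P (u *\<^sub>R x + v *\<^sub>R y - b) \<le> u * pos_norm P (x - b) + v * pos_norm P (y - b)"
    using pos_norm_add[of P "u *\<^sub>R (x - b)" "v *\<^sub>R (y - b)"] pos_norm_scaleR[of u P "x - b"]
      pos_norm_scaleR[of v P "y - b"] uv by simp
  also have "\<dots> < r" using xy uv by (intro convex_bound_lt) auto
  finally show "u *\<^sub>R x + v *\<^sub>R y \<in> {a. pos_norm P (a - b) < r}" by simp
qed

lemma convex_pos_norm_less': "convex {a. pos_norm P (b - a) < r}"
proof (rule convexI)
  fix x y and u v :: real
  assume xy: "x \<in> {a. pos_norm P (b - a) < r}" "y \<in> {a. pos_norm P (b - a) < r}"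
    and uv: "0 \<le> u" "0 \<le> v" "u + v = 1"
  have "b - (u *\<^sub>R x + v *\<^sub>R y) = (u + v) *\<^sub>R b - (u *\<^sub>R x + v *\<^sub>R y)" using uv by simp
  also have "\<dots> = u *\<^sub>R (b - x) + v *\<^sub>R (b - y)" by (simp add: algebra_simps)
  finally have "pos_norm P (b - (u *\<^sub>R x + v *\<^sub>R y)) \<le> u * pos_norm P (b - x) + v * pos_norm P (b - y)"
    using pos_norm_add[of P "u *\<^sub>R (b - x)" "v *\<^sub>R (b - y)"] pos_norm_scaleR[of u P "b - x"]
      pos_norm_scaleR[of v P "b - y"] uv by simp
  also have "\<dots> < r" using xy uv by (intro convex_bound_lt) auto
  finally show "u *\<^sub>R x + v *\<^sub>R y \<in> {a. pos_norm P (b - a) < r}" by simp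
qed

lemma convex_canon_vimage: "convex A \<Longrightarrow> convex {x. canon x \<in> A}"
  by (rule convexI) (auto simp: canon_add canon_scaleR dest: convexD)

text \<open>Hahn--Banach turns the supremum over the dual ball into an infimum over upper bounds.\<close>

lemma pos_norm_canon_less:
  assumes P: "convex_cone P" and less: "pos_norm P (canon x) < r"
  obtains b where "norm b < r" "b - x \<in> P"
proof -
  have P0: "0 \<in> P" and Ps: "\<And>r x. 0 \<le> r \<Longrightarrow> x \<in> P \<Longrightarrow> r *\<^sub>R x \<in> P"
    and Pa: "\<And>x y. x \<in> P \<Longrightarrow> y \<in> P \<Longrightarrow> x + y \<in> P"
    using P by (auto simp: convex_cone_iff)
  define q where "q x = (INF b\<in>{b. b - x \<in> P}. norm b)" for x
  have bdd: "bdd_below (norm ` {b. b - x \<in> P})" for x by (intro bdd_belowI2[of _ 0]) simp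
  have ub: "q x \<le> norm b" if "b - x \<in> P" for x b
    unfolding q_def using that by (intro cINF_lower[OF bdd]) simp
  have gb: "c \<le> q x" if "\<And>b. b - x \<in> P \<Longrightarrow> c \<le> norm b" for c x
    unfolding q_def using that P0 by (intro cINF_greatest) (auto intro: exI[of _ x])
  have "sublinear q"
  proof (rule sublinearI)
    fix x y
    have "q (x + y) - norm b \<le> q y" if b: "b - x \<in> P" for b
    proof (rule gb)
      fix c assume "c - y \<in> P"
      then have "b + c - (x + y) \<in> P" using Pa[OF b, of "c - y"] by (simp add: algebra_simps)
      then show "q (x + y) - norm b \<le> norm c" using ub norm_triangle_ineq[of b c] by fastforce
    qed
    then have "q (x + y) - q y \<le> q x" by (intro gb) (simp add: algebra_simps)
    then show "q (x + y) \<le> q x + q y" by simp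
  next
    fix r :: real and x assume r: "0 < r"
    have "q (r *\<^sub>R x) / r \<le> q x"
    proof (rule gb)
      fix b assume "b - x \<in> P"
      then have "r *\<^sub>R b - r *\<^sub>R x \<in> P" using Ps[of r "b - x"] r by (simp add: algebra_simps)
      then show "q (r *\<^sub>R x) / r \<le> norm b" using ub[of "r *\<^sub>R b" "r *\<^sub>R x"] r by (simp add: field_simps)
    qed
    then show "q (r *\<^sub>R x) \<le> r * q x" using r by (simp add: field_simps)
  next
    have "q 0 \<le> 0" using ub[of 0 0] P0 by simp
    moreover have "0 \<le> q 0" by (rule gb) simp
    ultimately show "q 0 = 0" by simp
  qed
  \<comment> \<open>A functional below q that touches it at x lies in the dual ball: q is at most
    the norm because x is its own upper bound, and q is at most 0 on - P because 0 is an upper bound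
    there.\<close>
  then obtain f where f: "linear f" "\<And>x. f x \<le> q x" "f x = q x"
    using hahn_banach_sublinear by metis
  have fn: "f x \<le> norm x" for x using f(2)[of x] ub[of x x] P0 by simp
  have "bounded_linear f"
  proof (rule bounded_linear_intro[of _ 1])
    show "norm (f x) \<le> norm x * 1" for x
      using fn[of x] fn[of "-x"] linear_neg[OF f(1), of x] by (simp add: abs_le_iff)
  qed (use f(1) in \<open>auto simp: linear_add linear_scale\<close>)
  then have app: "blinfun_apply (Blinfun f) = f" by (rule bounded_linear_Blinfun_apply)
  have "norm (Blinfun f) \<le> 1"
    using fn fn[of "- x" for x] linear_neg[OF f(1)] by (intro norm_blinfun_bound) (auto simp: app abs_le_iff)
  moreover have "0 \<le> f y" if "y \<in> P" for y
    using f(2)[of "-y"] ub[of 0 "-y"] that linear_neg[OF f(1), of y] by simp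
  ultimately have "Blinfun f \<in> dual_ball P" by (simp add: dual_ball_def dual_cone_def app)
  from pos_norm_upper[OF this, of "canon x"] have "q x < r" using less f(3) by (simp add: app)
  have "\<exists>b. b - x \<in> P \<and> norm b < r"
    using gb[of x r] \<open>q x < r\<close> by (meson not_le)
  then show ?thesis using that by blast
qed

text \<open>For the cone \<open>{0}\<close> the only upper bound of x is x itself, so
  \<open>pos_norm_canon_less\<close> becomes the usual Hahn--Banach formula for the norm.\<close>

lemma norm_canon: "norm (canon x) = norm x"
proof (rule antisym)
  show "norm (canon x) \<le> norm x"
    proof (rule norm_blinfun_bound)
    show "norm (blinfun_apply (canon x) \<phi>) \<le> norm x * norm \<phi>" for \<phi>
      using norm_blinfun[of \<phi> x] by (simp add: mult.commute)
  qed simp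
  show "norm x \<le> norm (canon x)"
  proof (rule field_le_epsilon)
    fix e :: real assume "0 < e"
    then have "pos_norm {0} (canon x) < norm (canon x) + e"
      using pos_norm_le_norm[of "{0}" "canon x"] by simp
    then obtain b where "norm b < norm (canon x) + e" "b - x \<in> {0}"
      by (rule pos_norm_canon_less[rotated]) (auto simp: convex_cone_iff)
    then show "norm x \<le> norm (canon x) + e" by simp
  qed
qed

definition weak_dual_ball :: "'a::banach set \<Rightarrow> 'a dual topology" where
  "weak_dual_ball P = subtopology strong_operator_topology (dual_ball P)"

lemma topspace_weak_dual_ball [simp]: "topspace (weak_dual_ball P) = dual_ball P"
  by (simp add: weak_dual_ball_def strong_operator_topology_topspace)

lemma continuous_weak_dual_ball:
  "continuous_map (weak_dual_ball P) euclideanreal (\<lambda>\<phi>. blinfun_apply \<phi> x)"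
  unfolding weak_dual_ball_def
  by (intro continuous_map_from_subtopology strong_operator_topology_continuous_evaluation)

lemma compact_weak_dual_ball: "compact_space (weak_dual_ball P)"
proof -
  have "closedin strong_operator_topology {\<phi>\<in>topspace strong_operator_topology. blinfun_apply \<phi> x \<in> {0::real..}}"
    for x :: 'a
    by (rule closedin_continuous_map_preimage[OF strong_operator_topology_continuous_evaluation])
      simp
  \<comment> \<open>The index 0 imposes no condition on \<phi>; it keeps the index set of the
    intersection nonempty.\<close>
  then have "closedin strong_operator_topology (\<Inter>x\<in>insert 0 P. {\<phi> :: 'a dual. blinfun_apply \<phi> x \<in> {0..}})"
    by (intro closedin_INT) (simp_all add: strong_operator_topology_topspace)
  moreover have "(\<Inter>x\<in>insert 0 P. {\<phi> :: 'a dual. blinfun_apply \<phi> x \<in> {0..}}) = dual_cone P"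
    by (auto simp: dual_cone_def)
  ultimately have "compactin strong_operator_topology (dual_ball P)"
    unfolding dual_ball_def using compactin_strong_operator_cball[where 'b='a and r=1]
    by (metis closed_Int_compactin)
  then show ?thesis unfolding weak_dual_ball_def by (rule compact_space_subtopology)
qed

lemma lsc_bidual_iff:
  "z \<in> lsc_bidual P \<longleftrightarrow> (\<forall>r. openin (weak_dual_ball P) {\<phi>\<in>dual_ball P. r < blinfun_apply z \<phi>})"
  by (simp add: lsc_bidual_def weak_dual_ball_def)

text \<open>Evaluation at x is weak* continuous and z is lower semicontinuous, so the difference is
  upper semicontinuous. The union in the proof runs over levels s that separate the two
  terms.\<close>

lemma openin_dual_ball_less:
  assumes "z \<in> lsc_bidual P"
  shows "openin (weak_dual_ball P) {\<phi>\<in>dual_ball P. blinfun_apply \<phi> x - blinfun_apply z \<phi> < r}"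
proof -
  have "{\<phi>\<in>dual_ball P. blinfun_apply \<phi> x - blinfun_apply z \<phi> < r} =
    (\<Union>s. {\<phi>\<in>topspace (weak_dual_ball P). blinfun_apply \<phi> x \<in> {..<s + r}} \<inter> {\<phi>\<in>dual_ball P. s < blinfun_apply z \<phi>})"
  proof (intro set_eqI iffI)
    fix \<phi> assume "\<phi> \<in> {\<phi>\<in>dual_ball P. blinfun_apply \<phi> x - blinfun_apply z \<phi> < r}"
    moreover from this obtain s where "blinfun_apply \<phi> x - r < s" "s < blinfun_apply z \<phi>"
      using dense[of "blinfun_apply \<phi> x - r" "blinfun_apply z \<phi>"] by force
    ultimately show "\<phi> \<in> (\<Union>s. {\<phi>\<in>topspace (weak_dual_ball P). blinfun_apply \<phi> x \<in> {..<s + r}} \<inter> {\<phi>\<in>dual_ball P. s < blinfun_apply z \<phi>})"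
      by (intro UN_I[of s]) auto
  qed auto
  moreover have "openin (weak_dual_ball P) {\<phi>\<in>topspace (weak_dual_ball P). blinfun_apply \<phi> x \<in> {..<s + r}}" for s
    by (rule openin_continuous_map_preimage[OF continuous_weak_dual_ball]) simp
  ultimately show ?thesis using assms unfolding lsc_bidual_iff by (simp only:) (intro openin_Union openin_Int; auto)
qed

lemma canon_lsc: "canon x \<in> lsc_bidual P"
proof -
  have "openin (weak_dual_ball P) {\<phi>\<in>topspace (weak_dual_ball P). blinfun_apply \<phi> x \<in> {r<..}}" for r
    by (rule openin_continuous_map_preimage[OF continuous_weak_dual_ball]) simp
  then show ?thesis by (simp add: lsc_bidual_iff)
qed

section \<open>Approximation of bidual elements\<close>

text \<open>Testing \<psi> at the multiples of x and - x of norm r bounds the absolute value of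
  \<psi> x by - m / r times the norm of x. In Goldstine's theorem this gives the contradiction;
  later it converts a lower bound of the unit ball into an estimate for positive
  functionals.\<close>

lemma norm_le_neg_bound:
  fixes \<psi> :: "'b::real_normed_vector \<Rightarrow>\<^sub>L real"
  assumes "\<And>x. norm x \<le> r \<Longrightarrow> m \<le> blinfun_apply \<psi> x" "0 \<le> r"
  shows "m \<le> - (r * norm \<psi>)"
proof (cases "r = 0")
  case True
  then show ?thesis using assms(1)[of 0] by (simp add: blinfun.zero_right)
next
  case False
  with assms(2) have r: "0 < r" by simp
  have m: "m \<le> 0" using assms(1)[of 0] r by (simp add: blinfun.zero_right)
  have "\<bar>blinfun_apply \<psi> x\<bar> \<le> - m / r * norm x" for x
  proof (cases "x = 0")
    case False
    define y where "y = (r / norm x) *\<^sub>R x"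
    have "norm y \<le> r" "norm (- y) \<le> r" using r False by (auto simp: y_def)
    then have "m \<le> blinfun_apply \<psi> y" "m \<le> blinfun_apply \<psi> (- y)" using assms(1) by auto
    then have "\<bar>blinfun_apply \<psi> y\<bar> \<le> - m" by (simp add: abs_le_iff blinfun.minus_right)
    then show ?thesis using r False
      by (simp add: y_def blinfun.scaleR_right abs_mult field_simps)
  qed (simp add: blinfun.zero_right)
  then have "norm \<psi> \<le> - m / r" using m r by (intro norm_blinfun_bound) (auto simp: divide_nonpos_pos)
  then show ?thesis using r by (simp add: field_simps)
qed

lemma concave_on_affine:
  assumes "convex T" "linear l"
  shows "concave_on T (\<lambda>x. a - l x + b)"
  unfolding concave_on_iff
proof (intro conjI ballI allI impI assms)
  fix x y and u v :: real assume "u + v = 1"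
  then have v: "v = 1 - u" by simp
  show "u * (a - l x + b) + v * (a - l y + b) \<le> a - l (u *\<^sub>R x + v *\<^sub>R y) + b"
    unfolding v by (simp add: linear_add[OF assms(2)] linear_diff[OF assms(2)] linear_scale[OF assms(2)] algebra_simps)
qed

text \<open>Applied to \<open>\<phi>\<close> and \<open>- \<phi>\<close> the one-sided estimate says that \<open>z\<close> is in the weak* closure of \<open>G\<close>.\<close>

definition weakly_near :: "'a::banach set \<Rightarrow> 'a bidual \<Rightarrow> bool" where
  "weakly_near G z \<longleftrightarrow> convex G \<and>
     (\<forall>\<Phi> e. finite \<Phi> \<and> 0 < e \<longrightarrow> (\<exists>c\<in>G. \<forall>\<phi>\<in>\<Phi>. blinfun_apply \<phi> c < blinfun_apply z \<phi> + e))"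

text \<open>Minimax over the ball, with functionals as parameters: if every c failed at some \<phi>
  in \<Phi>, one functional \<psi> would satisfy z \<psi> + e / 2 \<le> \<psi> c for all c in the
  ball, contradicting norm z \<le> r. Convex combinations of the functions \<open>f \<phi>\<close>
  have the same form, so the outcome is a single functional.\<close>

lemma goldstine:
  fixes z :: "'a::banach bidual"
  assumes z: "norm z \<le> r"
  shows "weakly_near (cball 0 r) z"
  unfolding weakly_near_def
proof (intro conjI allI impI convex_cball)
  fix \<Phi> :: "'a dual set" and e :: real assume "finite \<Phi> \<and> 0 < e"
  then have \<Phi>: "finite \<Phi>" and e: "0 < e" by auto
  have r: "0 \<le> r" using z norm_ge_zero[of z] by linarith
  show "\<exists>c\<in>cball 0 r. \<forall>\<phi>\<in>\<Phi>. blinfun_apply \<phi> c < blinfun_apply z \<phi> + e"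
  proof (rule ccontr)
    assume no: "\<not> ?thesis"
    have ne: "\<Phi> \<noteq> {}"
    proof
      assume "\<Phi> = {}"
      then show False using no r by (auto dest: spec[of _ 0])
    qed
    define f where "f = (\<lambda>(\<phi> :: 'a dual) c. blinfun_apply z \<phi> - blinfun_apply \<phi> c + e)"
    have "\<exists>g\<in>range f. \<forall>c\<in>cball 0 r. g c \<le> e / 2"
    proof (rule minimax_finite[of "f ` \<Phi>" _ _ "e / 3"])
      fix g assume "g \<in> range f"
      then show "concave_on (cball 0 r) g"
        by (auto simp: f_def intro!: concave_on_affine linear_compose_neg bounded_linear.linear
            blinfun.bounded_linear_right simp del: linear_compose_neg)
    next
      fix g h and s :: real assume "g \<in> range f" "h \<in> range f"
      then obtain \<phi> \<psi> where "g = f \<phi>" "h = f \<psi>" by auto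
      then have "(\<lambda>t. s * g t + (1 - s) * h t) = f (s *\<^sub>R \<phi> + (1 - s) *\<^sub>R \<psi>)"
        by (auto simp: f_def blinfun.add_left blinfun.scaleR_left blinfun.add_right blinfun.diff_left
            blinfun.diff_right blinfun.scaleR_right algebra_simps)
      then show "(\<lambda>t. s * g t + (1 - s) * h t) \<in> range f" by simp
    next
      fix c :: 'a assume "c \<in> cball 0 r"
      then obtain \<phi> where "\<phi> \<in> \<Phi>" "\<not> blinfun_apply \<phi> c < blinfun_apply z \<phi> + e" using no by blast
      then show "\<exists>g\<in>f ` \<Phi>. g c < e / 3" using e by (intro bexI[of _ "f \<phi>"]) (auto simp: f_def)
    qed (use \<Phi> ne e in auto)
    then obtain \<psi> where "\<forall>c\<in>cball 0 r. f \<psi> c \<le> e / 2" by blast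
    then have \<psi>: "f \<psi> c \<le> e / 2" if "norm c \<le> r" for c using that by simp
    have "blinfun_apply z \<psi> + e / 2 \<le> - (r * norm \<psi>)"
    proof (rule norm_le_neg_bound[OF _ r])
      fix x :: 'a assume "norm x \<le> r"
      from \<psi>[OF this] show "blinfun_apply z \<psi> + e / 2 \<le> blinfun_apply \<psi> x" by (simp add: f_def)
    qed
    moreover have "- (r * norm \<psi>) \<le> blinfun_apply z \<psi>"
      using norm_blinfun[of z \<psi>] mult_right_mono[OF z, of "norm \<psi>"] by simp
    ultimately show False using e by simp
  qed
qed

text \<open>By minimax a uniform estimate over the dual ball only has to be met at one functional at a time.\<close>

lemma weakly_near_refine:
  assumes G: "weakly_near G z" and s: "\<bar>s\<bar> = 1"
    and usc: "\<And>x a. openin (weak_dual_ball P) {\<phi>\<in>dual_ball P. blinfun_apply k \<phi> + blinfun_apply \<phi> x < a}"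
    and less: "\<And>\<phi>. \<phi> \<in> dual_ball P \<Longrightarrow> blinfun_apply k \<phi> + s * blinfun_apply z \<phi> < b"
  shows "weakly_near {c\<in>G. pos_norm P (k + s *\<^sub>R canon c) < b} z"
  unfolding weakly_near_def
proof (intro conjI allI impI)
  have G': "convex G" using G by (simp add: weakly_near_def)
  define h where "h c = (\<lambda>\<phi> :: 'a dual. blinfun_apply k \<phi> + blinfun_apply \<phi> (s *\<^sub>R c))" for c
  show "convex {c\<in>G. pos_norm P (k + s *\<^sub>R canon c) < b}"
  proof (rule convexI)
    fix x y and u v :: real
    assume xy: "x \<in> {c\<in>G. pos_norm P (k + s *\<^sub>R canon c) < b}" "y \<in> {c\<in>G. pos_norm P (k + s *\<^sub>R canon c) < b}"
      and uv: "0 \<le> u" "0 \<le> v" "u + v = 1"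
    have "k + s *\<^sub>R canon (u *\<^sub>R x + v *\<^sub>R y) = (u + v) *\<^sub>R k + s *\<^sub>R canon (u *\<^sub>R x + v *\<^sub>R y)"
      using uv by simp
    also have "\<dots> = u *\<^sub>R (k + s *\<^sub>R canon x) + v *\<^sub>R (k + s *\<^sub>R canon y)"
      by (simp add: canon_add canon_scaleR algebra_simps)
    finally have "pos_norm P (k + s *\<^sub>R canon (u *\<^sub>R x + v *\<^sub>R y))
        \<le> u * pos_norm P (k + s *\<^sub>R canon x) + v * pos_norm P (k + s *\<^sub>R canon y)"
      using pos_norm_add[of P "u *\<^sub>R (k + s *\<^sub>R canon x)" "v *\<^sub>R (k + s *\<^sub>R canon y)"]
        pos_norm_scaleR[of u P "k + s *\<^sub>R canon x"] pos_norm_scaleR[of v P "k + s *\<^sub>R canon y"] uv by simp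
    also have "\<dots> < b" using xy uv by (intro convex_bound_lt) auto
    finally show "u *\<^sub>R x + v *\<^sub>R y \<in> {c\<in>G. pos_norm P (k + s *\<^sub>R canon c) < b}"
      using xy uv G' by (auto simp: convex_def)
  qed
  fix \<Phi> :: "'a dual set" and e :: real assume "finite \<Phi> \<and> 0 < e"
  then have \<Phi>: "finite \<Phi>" and e: "0 < e" by auto
  define H where "H = {c\<in>G. \<forall>\<phi>\<in>\<Phi>. blinfun_apply \<phi> c < blinfun_apply z \<phi> + e}"
  have near: "\<exists>c\<in>G. \<forall>\<phi>\<in>\<Psi>. blinfun_apply \<phi> c < blinfun_apply z \<phi> + \<delta>" if "finite \<Psi>" "0 < \<delta>" for \<Psi> \<delta>
    using G that by (simp add: weakly_near_def)
  \<comment> \<open>The members of H already meet the estimates on \<Phi>, so the function that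
    minimax selects comes from a c that is near z on \<Phi> and satisfies the uniform bound on the
    dual ball.\<close>
  have "\<exists>g\<in>h ` H. \<exists>a<b. \<forall>t\<in>topspace (weak_dual_ball P). g t \<le> a"
  proof (rule minimax_compact)
    show "h ` H \<noteq> {}" using near[OF \<Phi> e] by (auto simp: H_def)
    show "concave_on (topspace (weak_dual_ball P)) g" if "g \<in> h ` H" for g
      using that convex_dual_ball[of P] unfolding concave_on_iff h_def
      by (auto simp: blinfun.add_left blinfun.scaleR_left blinfun.add_right blinfun.scaleR_right algebra_simps)
    show "openin (weak_dual_ball P) {t\<in>topspace (weak_dual_ball P). g t < a}" if "g \<in> h ` H" for g a
      using that usc by (auto simp: h_def)
  next
    fix g1 g2 and u :: real assume "g1 \<in> h ` H" "g2 \<in> h ` H" and u: "0 \<le> u" "u \<le> 1"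
    then obtain c1 c2 where c: "c1 \<in> H" "g1 = h c1" "c2 \<in> H" "g2 = h c2" by auto
    have "(\<lambda>t. u * g1 t + (1 - u) * g2 t) = h (u *\<^sub>R c1 + (1 - u) *\<^sub>R c2)"
      by (rule ext) (simp add: h_def c blinfun.add_right blinfun.diff_right blinfun.scaleR_right algebra_simps)
    moreover have "u *\<^sub>R c1 + (1 - u) *\<^sub>R c2 \<in> H"
      using c u G' unfolding H_def
      by (auto simp: convex_def blinfun.add_right blinfun.scaleR_right intro!: convex_bound_lt)
    ultimately show "(\<lambda>t. u * g1 t + (1 - u) * g2 t) \<in> h ` H" by auto
  next
    fix \<phi> assume "\<phi> \<in> topspace (weak_dual_ball P)"
    then have \<phi>: "\<phi> \<in> dual_ball P" by simp
    \<comment> \<open>Testing also at \<open>s *\<^sub>R \<phi>\<close> makes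
      \<open>h c \<phi>\<close> exceed k \<phi> + s z \<phi> by less than \<delta>, hence stay below
      b.\<close>
    define \<delta> where "\<delta> = min e (b - (blinfun_apply k \<phi> + s * blinfun_apply z \<phi>))"
    have "0 < \<delta>" using e less[OF \<phi>] by (simp add: \<delta>_def)
    then obtain c where c: "c \<in> G" "\<forall>\<psi>\<in>insert (s *\<^sub>R \<phi>) \<Phi>. blinfun_apply \<psi> c < blinfun_apply z \<psi> + \<delta>"
      using near[of "insert (s *\<^sub>R \<phi>) \<Phi>" \<delta>] \<Phi> by auto
    have "\<forall>\<psi>\<in>\<Phi>. blinfun_apply \<psi> c < blinfun_apply z \<psi> + e"
      using c(2) by (fastforce simp: \<delta>_def)
    then have "c \<in> H" using c(1) by (simp add: H_def)
    moreover have "h c \<phi> < b"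
      using c(2) by (auto simp: h_def \<delta>_def blinfun.scaleR_left blinfun.scaleR_right)
    ultimately show "\<exists>f\<in>h ` H. f \<phi> < b" by blast
  qed (rule compact_weak_dual_ball)
  then obtain c a where c: "c \<in> H" "a < b" "\<And>\<phi>. \<phi> \<in> dual_ball P \<Longrightarrow> h c \<phi> \<le> a" by auto
  have "pos_norm P (k + s *\<^sub>R canon c) \<le> a"
    using c(3) by (simp add: pos_norm_le_iff h_def blinfun.add_left blinfun.scaleR_left blinfun.scaleR_right)
  then have "c \<in> {c\<in>G. pos_norm P (k + s *\<^sub>R canon c) < b}" using c by (simp add: H_def)
  moreover have "\<forall>\<phi>\<in>\<Phi>. blinfun_apply \<phi> c < blinfun_apply z \<phi> + e" using c(1) by (simp add: H_def)
  ultimately show "\<exists>c\<in>{c\<in>G. pos_norm P (k + s *\<^sub>R canon c) < b}. \<forall>\<phi>\<in>\<Phi>. blinfun_apply \<phi> c < blinfun_apply z \<phi> + e"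
    by blast
qed

text \<open>Three refinements of the ball supplied by Goldstine's theorem. The two with sign - 1
  involve only weak* continuous functions; the one with sign 1 has k = - z and uses lower
  semicontinuity. Two elements c1 and c2 are carried along because directedness of the approximants
  compares two of them. Testing at - \<phi> gives the lower estimate at \<phi>.\<close>

lemma lsc_bidual_approx:
  assumes z: "z \<in> lsc_bidual P" "norm z \<le> r"
    and c: "pos_norm P (canon c1 - z) < \<epsilon>1" "pos_norm P (canon c2 - z) < \<epsilon>2" and \<epsilon>: "0 < \<epsilon>" "0 < \<eta>"
  obtains c where "norm c \<le> r" "pos_norm P (canon c1 - canon c) < \<epsilon>1"
    "pos_norm P (canon c2 - canon c) < \<epsilon>2" "pos_norm P (canon c - z) < \<epsilon>"
    "blinfun_apply z \<phi> < blinfun_apply \<phi> c + \<eta>"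
proof -
  have near: "weakly_near {b\<in>G. pos_norm P (canon x - canon b) < e} z"
    if G: "weakly_near G z" and x: "pos_norm P (canon x - z) < e" for G x e
  proof -
    have "openin (weak_dual_ball P) {\<phi>\<in>topspace (weak_dual_ball P). blinfun_apply \<phi> (x + y) \<in> {..<a}}" for a y
      by (rule openin_continuous_map_preimage[OF continuous_weak_dual_ball]) simp
    moreover have "blinfun_apply (canon x) \<phi> + (- 1) * blinfun_apply z \<phi> < e" if "\<phi> \<in> dual_ball P" for \<phi>
      using pos_norm_upper[OF that, of "canon x - z"] x by (simp add: blinfun.diff_left)
    ultimately have "weakly_near {b\<in>G. pos_norm P (canon x + (- 1) *\<^sub>R canon b) < e} z"
      using G by (intro weakly_near_refine) (auto simp: blinfun.add_right)
    then show ?thesis by simp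
  qed
  have "weakly_near {b\<in>cball 0 r. pos_norm P (canon c1 - canon b) < \<epsilon>1} z"
    by (intro near[OF _ c(1)] goldstine z)
  then have "weakly_near {b\<in>{b\<in>cball 0 r. pos_norm P (canon c1 - canon b) < \<epsilon>1}. pos_norm P (canon c2 - canon b) < \<epsilon>2} z"
    by (intro near[OF _ c(2)])
  then have "weakly_near {b\<in>{b\<in>{b\<in>cball 0 r. pos_norm P (canon c1 - canon b) < \<epsilon>1}. pos_norm P (canon c2 - canon b) < \<epsilon>2}.
      pos_norm P (- z + 1 *\<^sub>R canon b) < \<epsilon>} z"
    by (rule weakly_near_refine)
      (use openin_dual_ball_less[OF z(1)] \<epsilon> in \<open>auto simp: blinfun.minus_left\<close>)
  then obtain b where b: "norm b \<le> r" "pos_norm P (canon c1 - canon b) < \<epsilon>1"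
      "pos_norm P (canon c2 - canon b) < \<epsilon>2" "pos_norm P (- z + canon b) < \<epsilon>"
      "blinfun_apply (- \<phi>) b < blinfun_apply z (- \<phi>) + \<eta>"
    using \<epsilon>(2) unfolding weakly_near_def by (auto dest!: spec[of _ "{- \<phi>}"])
  then show ?thesis by (intro that[of b]) (auto simp: blinfun.minus_left blinfun.minus_right)
qed

section \<open>Continuous selections\<close>

lemma continuous_map_scaleR:
  fixes f :: "'q \<Rightarrow> real" and g :: "'q \<Rightarrow> 'b::real_normed_vector"
  assumes "continuous_map X euclidean f" "continuous_map X euclidean g"
  shows "continuous_map X euclidean (\<lambda>x. f x *\<^sub>R g x)"
  using assms by (simp add: continuous_map_atin tendsto_scaleR)

text \<open>Where the bump function \<open>h q\<close> is positive at p, the point p lies in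
  \<open>U q\<close> and so \<open>s q p\<close> is in \<open>A p\<close>. Normalising finitely many
  bump functions therefore gives a convex combination of elements of \<open>A p\<close>.\<close>

lemma continuous_selection:
  fixes A :: "'q \<Rightarrow> 'b::real_normed_vector set"
  assumes Q: "compact_space Q" "Hausdorff_space Q"
    and conv: "\<And>q. q \<in> topspace Q \<Longrightarrow> convex (A q)"
    and loc: "\<And>q. q \<in> topspace Q \<Longrightarrow>
      \<exists>s U. continuous_map Q euclidean s \<and> openin Q U \<and> q \<in> U \<and> (\<forall>p\<in>U. s p \<in> A p)"
  obtains s where "continuous_map Q euclidean s" "\<And>q. q \<in> topspace Q \<Longrightarrow> s q \<in> A q"
proof -
  have "completely_regular_space Q"
    using Q by (simp add: compact_Hausdorff_or_regular_imp_normal_space normal_imp_completely_regular_space)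
  obtain s U where sU: "\<And>q. q \<in> topspace Q \<Longrightarrow> continuous_map Q euclidean (s q)"
    "\<And>q. q \<in> topspace Q \<Longrightarrow> openin Q (U q)" "\<And>q. q \<in> topspace Q \<Longrightarrow> q \<in> U q"
    "\<And>q p. q \<in> topspace Q \<Longrightarrow> p \<in> U q \<Longrightarrow> s q p \<in> A p"
    using loc by metis
  have "\<exists>h :: 'q \<Rightarrow> real. continuous_map Q euclidean h \<and> (\<forall>p\<in>topspace Q. 0 \<le> h p) \<and> 0 < h q \<and>
      (\<forall>p\<in>topspace Q. 0 < h p \<longrightarrow> p \<in> U q)" if q: "q \<in> topspace Q" for q
  proof -
    have "closedin Q (topspace Q - U q)" "q \<in> topspace Q - (topspace Q - U q)" using sU q by auto
    then obtain f :: "'q \<Rightarrow> real" where f: "continuous_map Q (top_of_set {0..1}) f" "f q = 0"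
      "f ` (topspace Q - U q) \<subseteq> {1}"
      using \<open>completely_regular_space Q\<close> unfolding completely_regular_space_def by blast
    then have "continuous_map Q euclidean f" "\<And>p. p \<in> topspace Q \<Longrightarrow> f p \<le> 1"
      by (auto simp: continuous_map_in_subtopology)
    then show ?thesis using f(2,3)
      by (intro exI[of _ "\<lambda>p. 1 - f p"]) (auto intro!: continuous_intros)
  qed
  then obtain h :: "'q \<Rightarrow> 'q \<Rightarrow> real" where h: "\<And>q. q \<in> topspace Q \<Longrightarrow> continuous_map Q euclidean (h q)"
    "\<And>q p. q \<in> topspace Q \<Longrightarrow> p \<in> topspace Q \<Longrightarrow> 0 \<le> h q p" "\<And>q. q \<in> topspace Q \<Longrightarrow> 0 < h q q"
    "\<And>q p. q \<in> topspace Q \<Longrightarrow> p \<in> topspace Q \<Longrightarrow> 0 < h q p \<Longrightarrow> p \<in> U q"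
    by metis
  define V where "V q = {p\<in>topspace Q. h q p \<in> {0<..}}" for q
  have "openin Q (V q)" if "q \<in> topspace Q" for q
    unfolding V_def using h(1)[OF that] by (rule openin_continuous_map_preimage) simp
  moreover have "topspace Q \<subseteq> \<Union>(V ` topspace Q)" using h(3) by (auto simp: V_def)
  ultimately obtain \<V> where "finite \<V>" "\<V> \<subseteq> V ` topspace Q" "topspace Q \<subseteq> \<Union>\<V>"
    using Q(1) unfolding compact_space_alt by (metis (no_types, lifting) imageE)
  then obtain F where F: "F \<subseteq> topspace Q" "finite F" "topspace Q \<subseteq> \<Union>(V ` F)"
    by (metis finite_subset_image)
  define t where "t p = (\<Sum>q\<in>F. h q p)" for p
  have tpos: "0 < t p" if p: "p \<in> topspace Q" for p
  proof -
    obtain q where "q \<in> F" "p \<in> V q" using F(3) p by blast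
    then have q: "q \<in> F" "0 < h q p" by (auto simp: V_def)
    show ?thesis unfolding t_def using F(1,2) h(2) p q by (intro sum_pos2[of _ q]) auto
  qed
  show ?thesis
  proof (rule that[of "\<lambda>p. \<Sum>q\<in>F. (h q p / t p) *\<^sub>R s q p"])
    have "continuous_map Q euclidean t" unfolding t_def using F h(1) by (intro continuous_map_sum) auto
    then show "continuous_map Q euclidean (\<lambda>p. \<Sum>q\<in>F. (h q p / t p) *\<^sub>R s q p)"
      using F h(1) sU(1) tpos less_imp_neq[OF tpos]
      by (intro continuous_map_sum continuous_map_scaleR continuous_map_real_divide) auto
  next
    fix p assume p: "p \<in> topspace Q"
    \<comment> \<open>Only indices with positive weight at p are known to give points of
      \<open>A p\<close>.\<close>
    define F' where "F' = {q\<in>F. 0 < h q p}"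
    have F': "finite F'" "F' \<subseteq> F" using F by (auto simp: F'_def)
    have z: "h q p = 0" if "q \<in> F - F'" for q
      using that h(2)[of q p] F(1) p by (force simp: F'_def)
    have "(\<Sum>q\<in>F. (h q p / t p) *\<^sub>R s q p) = (\<Sum>q\<in>F'. (h q p / t p) *\<^sub>R s q p)"
      using F F' z by (intro sum.mono_neutral_right) auto
    also have "\<dots> \<in> A p"
    proof (rule convex_sum[OF F'(1) conv[OF p]])
      have "(\<Sum>q\<in>F'. h q p / t p) = (\<Sum>q\<in>F. h q p / t p)"
        using F F' z by (intro sum.mono_neutral_left) auto
      also have "\<dots> = 1" using tpos[OF p] by (simp add: t_def flip: sum_divide_distrib)
      finally show "(\<Sum>q\<in>F'. h q p / t p) = 1" .
      show "0 \<le> h q p / t p" if "q \<in> F'" for q using that tpos[OF p] by (simp add: F'_def)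
      show "s q p \<in> A p" if "q \<in> F'" for q
        using that F(1) h(4)[of q p] sU(4)[of q p] p by (auto simp: F'_def)
    qed
    finally show "(\<Sum>q\<in>F. (h q p / t p) *\<^sub>R s q p) \<in> A p" .
  qed
qed

section \<open>Nets for the supremum distance\<close>

text \<open>For r \<ge> 0 this is the estimate \<open>sup_dist P Q f g \<le> ennreal r\<close>,
  written for reals so that errors can be added, halved and compared linearly.\<close>

definition le_by :: "'a::banach set \<Rightarrow> 'q topology \<Rightarrow> real \<Rightarrow> ('q \<Rightarrow> 'a bidual) \<Rightarrow> ('q \<Rightarrow> 'a bidual) \<Rightarrow> bool" where
  "le_by P Q r f g \<longleftrightarrow> (\<forall>q\<in>topspace Q. \<forall>\<phi>\<in>dual_ball P. blinfun_apply (f q) \<phi> \<le> blinfun_apply (g q) \<phi> + r)"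

lemma le_byD: "le_by P Q r f g \<Longrightarrow> q \<in> topspace Q \<Longrightarrow> \<phi> \<in> dual_ball P \<Longrightarrow> blinfun_apply (f q) \<phi> \<le> blinfun_apply (g q) \<phi> + r"
  by (simp add: le_by_def)

lemma le_by_iff: "le_by P Q r f g \<longleftrightarrow> (\<forall>q\<in>topspace Q. pos_norm P (f q - g q) \<le> r)"
  by (auto simp: le_by_def pos_norm_le_iff blinfun.diff_left algebra_simps)

lemma le_by_trans: "le_by P Q r f g \<Longrightarrow> le_by P Q s g h \<Longrightarrow> le_by P Q (r + s) f h"
  unfolding le_by_def by fastforce

lemma le_by_mono: "le_by P Q r f g \<Longrightarrow> r \<le> s \<Longrightarrow> le_by P Q s f g"
  unfolding le_by_def by fastforce

lemma le_by_refl: "0 \<le> r \<Longrightarrow> le_by P Q r f f"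
  by (simp add: le_by_def)

lemma le_by_limit:
  assumes "\<And>e. 0 < e \<Longrightarrow> le_by P Q (r + e) f g"
  shows "le_by P Q r f g"
  unfolding le_by_def
proof (intro ballI, rule field_le_epsilon)
  fix q \<phi> and e :: real assume "q \<in> topspace Q" "\<phi> \<in> dual_ball P" "0 < e"
  with assms[of e] show "blinfun_apply (f q) \<phi> \<le> blinfun_apply (g q) \<phi> + r + e"
    by (simp add: le_by_def algebra_simps)
qed

lemma le_by_norm:
  assumes "\<And>q. q \<in> topspace Q \<Longrightarrow> norm (f q - g q) \<le> r"
  shows "le_by P Q r f g"
  unfolding le_by_iff using assms pos_norm_le_norm order_trans by blast

lemma sup_dist_le_iff: "0 \<le> r \<Longrightarrow> sup_dist P Q f g \<le> ennreal r \<longleftrightarrow> le_by P Q r f g"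
  by (simp add: sup_dist_def bidual_dist_def SUP_le_iff le_by_iff)

lemma sup_dist_zero_iff: "sup_dist P Q f g = 0 \<longleftrightarrow> le_by P Q 0 f g"
  using sup_dist_le_iff[of 0 P Q f g] by simp

lemma sup_dist_lessD:
  assumes "sup_dist P Q f g < ennreal r"
  obtains s where "0 \<le> s" "s < r" "le_by P Q s f g"
proof -
  obtain s where s: "0 \<le> s" "sup_dist P Q f g = ennreal s"
    using assms by (cases "sup_dist P Q f g") auto
  then show ?thesis using assms sup_dist_le_iff[of s P Q f g]
    by (intro that[of s]) (auto simp: ennreal_less_iff)
qed

lemma less_sup_distD:
  assumes "y < sup_dist P Q f g"
  obtains r q \<phi> where "y = ennreal r" "0 \<le> r" "q \<in> topspace Q" "\<phi> \<in> dual_ball P"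
    "r < blinfun_apply (f q) \<phi> - blinfun_apply (g q) \<phi>"
proof -
  obtain r where r: "0 \<le> r" "y = ennreal r" using assms by (cases y) auto
  then have "\<not> le_by P Q r f g" using assms sup_dist_le_iff[of r P Q f g] by auto
  then show ?thesis using that r by (force simp: le_by_def)
qed

lemma less_sup_distI:
  assumes "q \<in> topspace Q" "\<phi> \<in> dual_ball P" "r < blinfun_apply (f q) \<phi> - blinfun_apply (g q) \<phi>" "0 \<le> r"
  shows "ennreal r < sup_dist P Q f g"
proof -
  have "\<not> le_by P Q r f g" using assms by (force simp: le_by_def)
  then show ?thesis using assms(4) sup_dist_le_iff[of r P Q f g] by auto
qed

lemma ennreal_positive_below:
  assumes "(0 :: ennreal) < a"
  obtains r where "0 < r" "ennreal r < a"
proof -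
  obtain b where b: "0 < b" "b < a" using dense assms by blast
  then obtain r where "b = ennreal r" "0 \<le> r" by (cases b) auto
  then show ?thesis using b by (intro that[of r]) auto
qed

lemma sup_dist_tendsto:
  assumes "\<And>r. 0 < r \<Longrightarrow> eventually (\<lambda>x. le_by P Q r (f x) (g x)) F"
  shows "((\<lambda>x. sup_dist P Q (f x) (g x)) \<longlongrightarrow> 0) F"
proof (rule order_tendstoI)
  fix a :: ennreal assume "0 < a"
  then obtain r where r: "0 < r" "ennreal r < a" by (rule ennreal_positive_below)
  from assms[OF r(1)] show "\<forall>\<^sub>F x in F. sup_dist P Q (f x) (g x) < a"
  proof eventually_elim
    case (elim x)
    then have "sup_dist P Q (f x) (g x) \<le> ennreal r" using r(1) by (simp add: sup_dist_le_iff)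
    then show ?case using r(2) by (rule le_less_trans)
  qed
qed simp

section \<open>Cauchy nets and their limits\<close>

lemma eventually_net_filterD:
  "directed_index I R \<Longrightarrow> eventually (\<lambda>\<delta>. \<delta> \<in> I) (net_filter I R)"
  unfolding eventually_net_filter by (auto simp: directed_index_def)

lemma eventually_net_above: "directed_index I R \<Longrightarrow> \<gamma> \<in> I \<Longrightarrow> eventually (\<lambda>\<delta>. \<delta> \<in> I \<and> R \<gamma> \<delta>) (net_filter I R)"
  unfolding eventually_net_filter by blast

lemma net_filter_neq_bot: "directed_index I R \<Longrightarrow> net_filter I R \<noteq> bot"
  unfolding trivial_limit_def eventually_net_filter by (fastforce simp: directed_index_def)

lemma directed_index_nat: "directed_index (UNIV :: nat set) (<)"
proof -
  have "\<exists>k. m < k \<and> n < k" for m n :: nat by (intro exI[of _ "Suc (max m n)"]) auto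
  then show ?thesis unfolding directed_index_def transp_on_def by auto
qed

text \<open>A filter version in which later indices enter only eventually. It follows from the net
  version and lets sequences be treated together with nets.\<close>

definition cauchy_along where
  "cauchy_along P Q F x \<longleftrightarrow>
     (\<forall>\<epsilon>>0. eventually (\<lambda>\<gamma>. eventually (\<lambda>\<delta>. le_by P Q \<epsilon> (x \<gamma>) (x \<delta>)) F) F)"

lemma cauchy_net_along:
  assumes I: "directed_index I R" and "cauchy_net (sup_dist P Q) I R x"
  shows "cauchy_along P Q (net_filter I R) x"
  unfolding cauchy_along_def
proof (intro allI impI)
  fix \<epsilon> :: real assume \<epsilon>: "0 < \<epsilon>"
  have "\<forall>\<^sub>F \<gamma> in net_filter I R. (SUP \<delta>\<in>{\<delta>\<in>I. R \<gamma> \<delta>}. sup_dist P Q (x \<gamma>) (x \<delta>)) < ennreal \<epsilon>"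
    using assms(2) \<epsilon> unfolding cauchy_net_def by (intro order_tendstoD(2)[of _ 0]) auto
  with eventually_net_filterD[OF I]
  show "\<forall>\<^sub>F \<gamma> in net_filter I R. \<forall>\<^sub>F \<delta> in net_filter I R. le_by P Q \<epsilon> (x \<gamma>) (x \<delta>)"
  proof eventually_elim
    case (elim \<gamma>)
    have "sup_dist P Q (x \<gamma>) (x \<delta>) \<le> ennreal \<epsilon>" if "\<delta> \<in> I" "R \<gamma> \<delta>" for \<delta>
      using elim(2) that 
      by (intro order_trans[OF SUP_upper less_imp_le[OF elim(2)]]) simp
    then have "le_by P Q \<epsilon> (x \<gamma>) (x \<delta>)" if "\<delta> \<in> I" "R \<gamma> \<delta>" for \<delta>
      using that \<epsilon> by (simp flip: sup_dist_le_iff)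
    then show ?case using eventually_net_above[OF I elim(1)] by (auto elim: eventually_mono)
  qed
qed

lemma cauchy_netI:
  assumes I: "directed_index I R"
    and x: "\<And>\<epsilon>. 0 < \<epsilon> \<Longrightarrow> \<exists>\<gamma>\<in>I. \<forall>\<delta>\<in>I. R \<gamma> \<delta> \<longrightarrow> (\<forall>\<eta>\<in>I. R \<delta> \<eta> \<longrightarrow> le_by P Q \<epsilon> (x \<delta>) (x \<eta>))"
  shows "cauchy_net (sup_dist P Q) I R x"
  unfolding cauchy_net_def
proof (rule order_tendstoI)
  fix a :: ennreal assume "0 < a"
  then obtain r where r: "0 < r" "ennreal r < a" by (rule ennreal_positive_below)
  note r0 = r(1)
  then obtain \<gamma> where \<gamma>: "\<gamma> \<in> I" "\<And>\<delta> \<eta>. \<delta> \<in> I \<Longrightarrow> R \<gamma> \<delta> \<Longrightarrow> \<eta> \<in> I \<Longrightarrow> R \<delta> \<eta> \<Longrightarrow> le_by P Q r (x \<delta>) (x \<eta>)"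
    using x by blast
  have "(SUP \<eta>\<in>{\<eta>\<in>I. R \<delta> \<eta>}. sup_dist P Q (x \<delta>) (x \<eta>)) < a" if "\<delta> \<in> I" "R \<gamma> \<delta>" for \<delta>
  proof -
    have "(SUP \<eta>\<in>{\<eta>\<in>I. R \<delta> \<eta>}. sup_dist P Q (x \<delta>) (x \<eta>)) \<le> ennreal r"
      using \<gamma>(2)[OF that] r0 by (auto intro!: SUP_least simp: sup_dist_le_iff)
    then show ?thesis using r(2) by (rule le_less_trans)
  qed
  then show "\<forall>\<^sub>F \<gamma> in net_filter I R. (SUP \<delta>\<in>{\<delta>\<in>I. R \<gamma> \<delta>}. sup_dist P Q (x \<gamma>) (x \<delta>)) < a"
    unfolding eventually_net_filter[OF I] using \<gamma>(1) by blast
qed simp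

lemma dominating_netD:
  assumes "dominating_net (sup_dist P Q) I R x" "\<gamma> \<in> I" "0 < \<epsilon>"
  shows "eventually (\<lambda>\<delta>. le_by P Q \<epsilon> (x \<gamma>) (x \<delta>)) (net_filter I R)"
proof -
  have "\<forall>\<^sub>F \<delta> in net_filter I R. sup_dist P Q (x \<gamma>) (x \<delta>) < ennreal \<epsilon>"
    using assms unfolding dominating_net_def by (intro order_tendstoD(2)[of _ 0]) auto
  then show ?thesis by eventually_elim (metis le_by_mono less_imp_le sup_dist_lessD)
qed

lemma increasing_net_cauchy:
  assumes I: "directed_index I R" and x: "increasing_net (sup_dist P Q) I R x"
  shows "cauchy_net (sup_dist P Q) I R x"
proof (rule cauchy_netI[OF I])
  fix \<epsilon> :: real assume "0 < \<epsilon>"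
  obtain \<gamma> where "\<gamma> \<in> I" using I by (auto simp: directed_index_def)
  moreover have "le_by P Q \<epsilon> (x \<delta>) (x \<eta>)" if "\<delta> \<in> I" "\<eta> \<in> I" "R \<delta> \<eta>" for \<delta> \<eta>
  proof (rule le_by_mono)
    show "le_by P Q 0 (x \<delta>) (x \<eta>)" using x that unfolding increasing_net_def sup_dist_zero_iff by blast
  qed (use \<open>0 < \<epsilon>\<close> in simp)
  ultimately show "\<exists>\<gamma>\<in>I. \<forall>\<delta>\<in>I. R \<gamma> \<delta> \<longrightarrow> (\<forall>\<eta>\<in>I. R \<delta> \<eta> \<longrightarrow> le_by P Q \<epsilon> (x \<delta>) (x \<eta>))" by blast
qed

text \<open>A strict lower bound on a distance is witnessed by one q and one \<phi>, so pointwise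
  convergence suffices for both inequalities, whatever the set Z of test functions.\<close>

lemma circ_limit_pointwise:
  assumes "\<And>q \<phi>. q \<in> topspace Q \<Longrightarrow> \<phi> \<in> dual_ball P \<Longrightarrow>
    ((\<lambda>\<delta>. blinfun_apply (x \<delta> q) \<phi>) \<longlongrightarrow> blinfun_apply (z q) \<phi>) (net_filter I R)"
  shows "circ_limit (sup_dist P Q) Z I R x z"
  unfolding circ_limit_def le_Liminf_iff
proof (intro ballI conjI allI impI)
  fix c y assume "y < sup_dist P Q z c"
  then obtain r q \<phi> where r: "y = ennreal r" "0 \<le> r" "q \<in> topspace Q" "\<phi> \<in> dual_ball P"
    "r < blinfun_apply (z q) \<phi> - blinfun_apply (c q) \<phi>" by (rule less_sup_distD)
  have "\<forall>\<^sub>F \<delta> in net_filter I R. r + blinfun_apply (c q) \<phi> < blinfun_apply (x \<delta> q) \<phi>"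
    using assms[OF r(3,4)] r(5) by (intro order_tendstoD(1)) auto
  then show "\<forall>\<^sub>F \<delta> in net_filter I R. y < sup_dist P Q (x \<delta>) c"
    unfolding r(1) by eventually_elim (rule less_sup_distI[OF r(3,4) _ r(2)], simp)
next
  fix c y assume "y < sup_dist P Q c z"
  then obtain r q \<phi> where r: "y = ennreal r" "0 \<le> r" "q \<in> topspace Q" "\<phi> \<in> dual_ball P"
    "r < blinfun_apply (c q) \<phi> - blinfun_apply (z q) \<phi>" by (rule less_sup_distD)
  have "\<forall>\<^sub>F \<delta> in net_filter I R. blinfun_apply (x \<delta> q) \<phi> < blinfun_apply (c q) \<phi> - r"
    using assms[OF r(3,4)] r(5) by (intro order_tendstoD(2)) auto
  then show "\<forall>\<^sub>F \<delta> in net_filter I R. y < sup_dist P Q c (x \<delta>)"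
    unfolding r(1) by eventually_elim (rule less_sup_distI[OF r(3,4) _ r(2)], simp)
qed

lemma Liminf_le_eventually:
  fixes f :: "'i \<Rightarrow> ennreal"
  assumes "F \<noteq> bot" "eventually (\<lambda>x. f x \<le> c) F"
  shows "Liminf F f \<le> c"
  using Liminf_le_Limsup[OF assms(1), of f] Limsup_bounded[OF assms(2)] by (rule order_trans)

lemma circ_limit_upper_at:
  assumes I: "directed_index I R" and lim: "circ_limit (sup_dist P Q) Z I R x z" and c: "c \<in> Z"
    and ev: "eventually (\<lambda>\<delta>. le_by P Q \<epsilon> c (x \<delta>)) (net_filter I R)" and \<epsilon>: "0 \<le> \<epsilon>"
  shows "le_by P Q \<epsilon> c z"
proof -
  have "sup_dist P Q c z \<le> Liminf (net_filter I R) (\<lambda>\<delta>. sup_dist P Q c (x \<delta>))"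
    using lim c by (simp add: circ_limit_def)
  also have "\<dots> \<le> ennreal \<epsilon>"
    using ev \<epsilon> by (intro Liminf_le_eventually net_filter_neq_bot[OF I]) (simp add: sup_dist_le_iff)
  finally show ?thesis using \<epsilon> by (simp add: sup_dist_le_iff)
qed

lemma circ_limit_lower_at:
  assumes I: "directed_index I R" and lim: "circ_limit (sup_dist P Q) Z I R x z" and c: "c \<in> Z"
    and ev: "eventually (\<lambda>\<delta>. le_by P Q \<epsilon> (x \<delta>) c) (net_filter I R)" and \<epsilon>: "0 \<le> \<epsilon>"
  shows "le_by P Q \<epsilon> z c"
proof -
  have "sup_dist P Q z c \<le> Liminf (net_filter I R) (\<lambda>\<delta>. sup_dist P Q (x \<delta>) c)"
    using lim c by (simp add: circ_limit_def)
  also have "\<dots> \<le> ennreal \<epsilon>"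
    using ev \<epsilon> by (intro Liminf_le_eventually net_filter_neq_bot[OF I]) (simp add: sup_dist_le_iff)
  finally show ?thesis using \<epsilon> by (simp add: sup_dist_le_iff)
qed

text \<open>A term of the net may itself serve as the test function, because the net lies in
  Z.\<close>

lemma circ_limit_upper:
  assumes I: "directed_index I R" and x: "cauchy_along P Q (net_filter I R) x" and sub: "x ` I \<subseteq> Z"
    and lim: "circ_limit (sup_dist P Q) Z I R x z" and \<epsilon>: "0 < \<epsilon>"
  shows "eventually (\<lambda>\<delta>. le_by P Q \<epsilon> (x \<delta>) z) (net_filter I R)"
proof -
  have "\<forall>\<^sub>F \<gamma> in net_filter I R. \<forall>\<^sub>F \<delta> in net_filter I R. le_by P Q \<epsilon> (x \<gamma>) (x \<delta>)"
    using x \<epsilon> by (simp add: cauchy_along_def)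
  with eventually_net_filterD[OF I] show ?thesis
  proof eventually_elim
    case (elim \<gamma>)
    then show ?case using sub \<epsilon> by (intro circ_limit_upper_at[OF I lim]) auto
  qed
qed

text \<open>The net is eventually below z' up to any error, and the limit z inherits upper bounds
  that lie in Z. Exchanging z and z' shows that limits are determined up to the preorder.\<close>

lemma circ_limit_unique:
  assumes I: "directed_index I R" and x: "cauchy_along P Q (net_filter I R) x" and sub: "x ` I \<subseteq> Z"
    and z: "circ_limit (sup_dist P Q) Z I R x z" and z': "circ_limit (sup_dist P Q) Z I R x z'" "z' \<in> Z"
  shows "le_by P Q 0 z z'"
proof (rule le_by_limit)
  fix e :: real assume "0 < e"
  then show "le_by P Q (0 + e) z z'"
    using circ_limit_upper[OF I x sub z'(1), of e] by (intro circ_limit_lower_at[OF I z z'(2)]) auto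
qed

section \<open>Continuous and lower semicontinuous functions\<close>

definition canon_fun :: "'q topology \<Rightarrow> ('q \<Rightarrow> 'a::banach) \<Rightarrow> 'q \<Rightarrow> 'a bidual" where
  "canon_fun Q g = restrict (\<lambda>p. canon (g p)) (topspace Q)"

lemma canon_fun_apply [simp]: "q \<in> topspace Q \<Longrightarrow> canon_fun Q g q = canon (g q)"
  by (simp add: canon_fun_def)

lemma cont_funs_eq: "cont_funs Q = canon_fun Q ` {g. continuous_map Q euclidean g}"
  by (auto simp: cont_funs_def canon_fun_def)

lemma sup_norm_le_iff: "0 \<le> r \<Longrightarrow> sup_norm Q f \<le> ennreal r \<longleftrightarrow> (\<forall>q\<in>topspace Q. norm (f q) \<le> r)"
  by (simp add: sup_norm_def SUP_le_iff)

lemma bounded_fun_bound: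
  assumes "f \<in> bounded_funs Q"
  obtains r where "0 < r" "\<And>q. q \<in> topspace Q \<Longrightarrow> norm (f q) \<le> r"
  using assms bounded_pos[of "f ` topspace Q"] by (auto simp: bounded_funs_def)

lemma bounded_funsI: "f \<in> extensional (topspace Q) \<Longrightarrow> (\<And>q. q \<in> topspace Q \<Longrightarrow> norm (f q) \<le> r) \<Longrightarrow> f \<in> bounded_funs Q"
  by (auto simp: bounded_funs_def bounded_iff)

text \<open>The balls around 0 cover \<open>lsc_bidual P\<close>, so continuity into the generated
  topology reduces to openness of the preimages of balls; for e \<le> 0 these are empty.\<close>

lemma lsc_funs_iff:
  "f \<in> lsc_funs P Q \<longleftrightarrow> f \<in> bounded_funs Q \<and> (\<forall>q\<in>topspace Q. f q \<in> lsc_bidual P) \<and>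
     (\<forall>c e. openin Q {q\<in>topspace Q. pos_norm P (canon c - f q) < e})"
proof -
  define ball where "ball c e = {x\<in>lsc_bidual P. bidual_dist P (canon c) x < ennreal e}" for c e
  have ball: "x \<in> ball c e \<longleftrightarrow> x \<in> lsc_bidual P \<and> pos_norm P (canon c - x) < e" for x c e
    using pos_norm_nonneg[of P "canon c - x"] by (auto simp: ball_def bidual_dist_def ennreal_less_iff)
  have bullet: "bullet_topology P = topology_generated_by {ball c e |c e. 0 < e}"
    by (simp add: bullet_topology_def ball_def)
  have all: "f ` topspace Q \<subseteq> \<Union>{ball c e |c e. 0 < e}" if "f ` topspace Q \<subseteq> lsc_bidual P"
  proof
    fix x assume "x \<in> f ` topspace Q"
    then have "x \<in> ball 0 (pos_norm P (canon 0 - x) + 1)" using that by (auto simp: ball)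
    moreover have "0 < pos_norm P (canon 0 - x) + 1" using pos_norm_nonneg[of P "canon 0 - x"] by simp
    ultimately show "x \<in> \<Union>{ball c e |c e. 0 < e}" by blast
  qed
  have pre: "f -` ball c e \<inter> topspace Q = {q\<in>topspace Q. pos_norm P (canon c - f q) < e}"
    if "f ` topspace Q \<subseteq> lsc_bidual P" for c e
    using that by (auto simp: ball)
  have triv: "openin Q {q\<in>topspace Q. pos_norm P (canon c - f q) < e}" if "\<not> 0 < e" for c e
  proof -
    have "{q\<in>topspace Q. pos_norm P (canon c - f q) < e} = {}"
      using that order_trans[OF _ pos_norm_nonneg[of P]] by (auto simp: not_less)
    then show ?thesis by (simp only: openin_empty)
  qed
  have "continuous_map Q (bullet_topology P) f \<longleftrightarrow>
      (\<forall>c e. openin Q {q\<in>topspace Q. pos_norm P (canon c - f q) < e})"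
    if "f ` topspace Q \<subseteq> lsc_bidual P"
  proof -
    have "continuous_map Q (bullet_topology P) f \<longleftrightarrow> (\<forall>c e. 0 < e \<longrightarrow> openin Q (f -` ball c e \<inter> topspace Q))"
      unfolding bullet continuous_on_generated_topo_iff using all[OF that] by blast
    then show ?thesis using pre[OF that] triv by metis
  qed
  then show ?thesis by (auto simp: lsc_funs_def)
qed

section \<open>Continuous choices over a compact Hausdorff space\<close>

locale preordered_functions =
  fixes P :: "'a::banach set" and Q :: "'q topology"
  assumes cone: "preordered_banach P" and compact: "compact_space Q" and hausdorff: "Hausdorff_space Q"
begin

abbreviation contQ :: "('q \<Rightarrow> 'a) \<Rightarrow> bool" where
  "contQ g \<equiv> continuous_map Q euclidean g"

lemma openin_norm_less: "contQ g \<Longrightarrow> openin Q {q\<in>topspace Q. norm (g q - x) < e}"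
  using openin_continuous_map_preimage[of Q euclideanreal "\<lambda>q. norm (g q - x)" "{..<e}"]
  by (simp add: continuous_map_norm continuous_map_diff)

lemma continuous_attains_less:
  assumes "contQ g" "\<And>q. q \<in> topspace Q \<Longrightarrow> norm (g q) < r" "0 < r"
  obtains s where "0 < s" "s < r" "\<And>q. q \<in> topspace Q \<Longrightarrow> norm (g q) < s"
proof -
  define V where "V s = {q\<in>topspace Q. norm (g q - 0) < s}" for s
  have "topspace Q \<subseteq> \<Union>(V ` {0<..<r})"
  proof
    fix q assume q: "q \<in> topspace Q"
    then obtain s where "norm (g q) < s" "s < r" using assms(2) dense by blast
    moreover from this have "0 < s" using norm_ge_zero[of "g q"] by linarith
    ultimately show "q \<in> \<Union>(V ` {0<..<r})" using q by (auto simp: V_def)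
  qed
  moreover have "\<forall>U\<in>V ` {0<..<r}. openin Q U" unfolding V_def using openin_norm_less[OF assms(1)] by blast
  ultimately obtain \<V> where "finite \<V>" "\<V> \<subseteq> V ` {0<..<r}" "topspace Q \<subseteq> \<Union>\<V>"
    using compact unfolding compact_space_alt by metis
  then obtain F where F: "F \<subseteq> {0<..<r}" "finite F" "topspace Q \<subseteq> \<Union>(V ` F)" by (metis finite_subset_image)
  \<comment> \<open>The radius r / 2 keeps the set nonempty when Q is empty.\<close>
  define F' where "F' = insert (r/2) F"
  have F': "finite F'" "F' \<noteq> {}" "F' \<subseteq> {0<..<r}" using F assms(3) by (auto simp: F'_def)
  have "Max F' \<in> {0<..<r}" using Max_in[OF F'(1,2)] F'(3) by blast
  moreover have "norm (g q) < Max F'" if q: "q \<in> topspace Q" for q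
  proof -
    obtain s where s: "s \<in> F" "norm (g q) < s" using F(3) q by (auto simp: V_def)
    have "s \<le> Max F'" using s F' by (intro Max_ge) (auto simp: F'_def)
    then show ?thesis using s by simp
  qed
  ultimately show ?thesis by (intro that[of "Max F'"]) auto
qed

text \<open>As functions of the vector \<open>g q\<close> both distances are 1-Lipschitz for the
  norm, since \<open>canon\<close> is isometric.\<close>

lemma openin_pos_norm_less: "contQ g \<Longrightarrow> openin Q {q\<in>topspace Q. pos_norm P (canon (g q) - z) < e}"
  and openin_pos_norm_less': "contQ g \<Longrightarrow> openin Q {q\<in>topspace Q. pos_norm P (z - canon (g q)) < e}"
proof -
  have le: "pos_norm P (canon x - canon y) \<le> norm (x - y)" for x y
    using pos_norm_le_norm[of P "canon (x - y)"] unfolding norm_canon by (simp add: canon_diff)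
  have lip: "pos_norm P (canon x - z) \<le> pos_norm P (canon y - z) + norm (x - y)"
    "pos_norm P (z - canon x) \<le> pos_norm P (z - canon y) + norm (x - y)" for x y
    using pos_norm_triangle[of P "canon x" z "canon y"] pos_norm_triangle[of P z "canon x" "canon y"]
      le[of x y] le[of y x] unfolding norm_minus_commute[of y x] by linarith+
  assume g: "contQ g"
  have "openin Q {q\<in>topspace Q. h (g q) < e}"
    if h: "\<And>x y. h x \<le> h y + norm (x - y)" for h :: "'a \<Rightarrow> real"
  proof (subst openin_subopen, intro ballI)
    fix q assume q: "q \<in> {q\<in>topspace Q. h (g q) < e}"
    show "\<exists>U. openin Q U \<and> q \<in> U \<and> U \<subseteq> {q\<in>topspace Q. h (g q) < e}"
    proof (intro exI[of _ "{p\<in>topspace Q. norm (g p - g q) < e - h (g q)}"] conjI openin_norm_less[OF g])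
      show "{p\<in>topspace Q. norm (g p - g q) < e - h (g q)} \<subseteq> {q\<in>topspace Q. h (g q) < e}"
      proof clarify
        fix p assume "norm (g p - g q) < e - h (g q)"
        then show "h (g p) < e" using h[of "g p" "g q"] by simp
      qed
    qed (use q in auto)
  qed
  from this[of "\<lambda>x. pos_norm P (canon x - z)"] this[of "\<lambda>x. pos_norm P (z - canon x)"] lip
  show "openin Q {q\<in>topspace Q. pos_norm P (canon (g q) - z) < e}"
    "openin Q {q\<in>topspace Q. pos_norm P (z - canon (g q)) < e}" by blast+
qed

lemma canon_fun_bounded:
  assumes g: "contQ g"
  shows "canon_fun Q g \<in> bounded_funs Q"
proof -
  have "compactin euclidean (g ` topspace Q)"
    using compact g by (intro image_compactin) (auto simp: compact_space_def)
  then have "bounded (g ` topspace Q)" by (simp add: compact_imp_bounded)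
  then show ?thesis
    by (auto simp: bounded_funs_def bounded_iff norm_canon) (simp add: canon_fun_def)
qed

lemma canon_fun_lsc:
  assumes g: "contQ g"
  shows "canon_fun Q g \<in> lsc_funs P Q"
proof -
  have "{q\<in>topspace Q. pos_norm P (canon c - canon_fun Q g q) < e}
      = {q\<in>topspace Q. pos_norm P (canon c - canon (g q)) < e}" for c e by auto
  then show ?thesis
    using canon_fun_bounded[OF g] openin_pos_norm_less'[OF g] by (simp add: lsc_funs_iff canon_lsc)
qed

text \<open>The admissible bounds at a point form a convex set, which
  \<open>pos_norm_canon_less\<close> shows to be nonempty, so they can be selected
  continuously.\<close>

lemma continuous_upper_bound:
  assumes g: "contQ g" and less: "\<And>q. q \<in> topspace Q \<Longrightarrow> pos_norm P (canon (g q)) < r"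
  obtains b where "contQ b" "\<And>q. q \<in> topspace Q \<Longrightarrow> norm (b q) < r"
    "\<And>q \<phi>. q \<in> topspace Q \<Longrightarrow> \<phi> \<in> dual_ball P \<Longrightarrow> blinfun_apply \<phi> (g q) \<le> blinfun_apply \<phi> (b q)"
proof -
  have P: "convex_cone P" using cone by (simp add: preordered_banach_def)
  define A where "A q = {b. norm b < r \<and> (\<forall>\<phi>\<in>dual_ball P. blinfun_apply \<phi> (g q) \<le> blinfun_apply \<phi> b)}" for q
  have "\<exists>b. contQ b \<and> (\<forall>q\<in>topspace Q. b q \<in> A q)"
  proof (rule continuous_selection[OF compact hausdorff, of A])
    fix q
    have "A q = ball 0 r \<inter> (\<Inter>\<phi>\<in>dual_ball P. {b. blinfun_apply \<phi> (g q) \<le> blinfun_apply \<phi> b})"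
      by (auto simp: A_def)
    moreover have "convex {b. blinfun_apply \<phi> (g q) \<le> blinfun_apply \<phi> b}" for \<phi> :: "'a dual"
    proof (rule convexI)
      fix x y and u v :: real
      assume "x \<in> {b. blinfun_apply \<phi> (g q) \<le> blinfun_apply \<phi> b}" "y \<in> {b. blinfun_apply \<phi> (g q) \<le> blinfun_apply \<phi> b}"
        "0 \<le> u" "0 \<le> v" "u + v = 1"
      then have "- (u * blinfun_apply \<phi> x + v * blinfun_apply \<phi> y) \<le> - blinfun_apply \<phi> (g q)"
        using convex_bound_le[of "- blinfun_apply \<phi> x" "- blinfun_apply \<phi> (g q)" "- blinfun_apply \<phi> y" u v] by simp
      then show "u *\<^sub>R x + v *\<^sub>R y \<in> {b. blinfun_apply \<phi> (g q) \<le> blinfun_apply \<phi> b}"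
        by (simp add: blinfun.add_right blinfun.scaleR_right)
    qed
    ultimately show "convex (A q)" by (auto intro!: convex_Int convex_INT)
  next
    fix q assume q: "q \<in> topspace Q"
    obtain b where b: "norm b < r" "b - g q \<in> P" using pos_norm_canon_less[OF P less[OF q]] by blast
    \<comment> \<open>The gap b - g q in P is kept fixed, so s stays above g everywhere, and its
      norm stays below r near q.\<close>
    define s where "s p = b + (g p - g q)" for p
    have s: "contQ s" unfolding s_def using g by (intro continuous_intros) auto
    moreover have "s p \<in> A p" if "norm (s p - 0) < r" for p
      using that dual_ball_nonneg[OF _ b(2)] by (auto simp: A_def s_def blinfun.add_right blinfun.diff_right)
    ultimately show "\<exists>s U. contQ s \<and> openin Q U \<and> q \<in> U \<and> (\<forall>p\<in>U. s p \<in> A p)"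
      using q b openin_norm_less[OF s, of 0 r]
      by (intro exI[of _ s] exI[of _ "{p\<in>topspace Q. norm (s p - 0) < r}"]) (auto simp: s_def)
  qed blast
  then show ?thesis using that by (auto simp: A_def)
qed

text \<open>The constant x found at q by \<open>lsc_bidual_approx\<close> remains admissible near q:
  the estimates against c1 and c2 are open conditions because these are norm continuous, the one
  against f because f is continuous into the bullet topology.\<close>

lemma continuous_approx:
  assumes f: "f \<in> lsc_funs P Q" "\<And>q. q \<in> topspace Q \<Longrightarrow> norm (f q) \<le> r"
    and c: "contQ c1" "\<And>q. q \<in> topspace Q \<Longrightarrow> pos_norm P (canon (c1 q) - f q) < e1"
      "contQ c2" "\<And>q. q \<in> topspace Q \<Longrightarrow> pos_norm P (canon (c2 q) - f q) < e2"
    and e: "0 < e" "0 < \<eta>"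
  obtains c where "contQ c" "\<And>q. q \<in> topspace Q \<Longrightarrow> norm (c q) \<le> r"
    "\<And>q. q \<in> topspace Q \<Longrightarrow> pos_norm P (canon (c1 q) - canon (c q)) < e1"
    "\<And>q. q \<in> topspace Q \<Longrightarrow> pos_norm P (canon (c2 q) - canon (c q)) < e2"
    "\<And>q. q \<in> topspace Q \<Longrightarrow> pos_norm P (canon (c q) - f q) < e"
    "q0 \<in> topspace Q \<Longrightarrow> blinfun_apply (f q0) \<phi>0 < blinfun_apply \<phi>0 (c q0) + \<eta>"
proof -
  define A where "A q = cball 0 r \<inter> {x. canon x \<in> {y. pos_norm P (canon (c1 q) - y) < e1}}
    \<inter> {x. canon x \<in> {y. pos_norm P (canon (c2 q) - y) < e2}}
    \<inter> {x. canon x \<in> {y. pos_norm P (y - f q) < e}}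
    \<inter> {x. q = q0 \<longrightarrow> blinfun_apply (f q0) \<phi>0 - \<eta> < blinfun_apply \<phi>0 x}" for q
  have "\<exists>c. contQ c \<and> (\<forall>q\<in>topspace Q. c q \<in> A q)"
  proof (rule continuous_selection[OF compact hausdorff, of A])
    fix q
    have "convex {x. q = q0 \<longrightarrow> m < blinfun_apply \<phi>0 x}" for m
    proof (rule convexI)
      fix x y and u v :: real
      assume *: "x \<in> {x. q = q0 \<longrightarrow> m < blinfun_apply \<phi>0 x}" "y \<in> {x. q = q0 \<longrightarrow> m < blinfun_apply \<phi>0 x}"
        "0 \<le> u" "0 \<le> v" "u + v = 1"
      show "u *\<^sub>R x + v *\<^sub>R y \<in> {x. q = q0 \<longrightarrow> m < blinfun_apply \<phi>0 x}"
        using * convex_bound_lt[of "- blinfun_apply \<phi>0 x" "- m" "- blinfun_apply \<phi>0 y" u v]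
        by (auto simp: blinfun.add_right blinfun.scaleR_right)
    qed
    then show "convex (A q)" unfolding A_def
      by (intro convex_Int convex_cball convex_canon_vimage convex_pos_norm_less convex_pos_norm_less')
  next
    fix q assume q: "q \<in> topspace Q"
    have fq: "f q \<in> lsc_bidual P" using f(1) q by (simp add: lsc_funs_iff)
    obtain x where x: "norm x \<le> r" "pos_norm P (canon (c1 q) - canon x) < e1"
      "pos_norm P (canon (c2 q) - canon x) < e2" "pos_norm P (canon x - f q) < e"
      "blinfun_apply (f q) \<phi>0 < blinfun_apply \<phi>0 x + \<eta>"
      using lsc_bidual_approx[OF fq f(2)[OF q] c(2)[OF q] c(4)[OF q] e] by metis
    \<comment> \<open>The estimate at \<phi>0 concerns q0 alone. A neighbourhood of any other point
      omits q0, so that its constant is never tested there.\<close>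
    define U where "U = {p\<in>topspace Q. pos_norm P (canon (c1 p) - canon x) < e1} \<inter>
      {p\<in>topspace Q. pos_norm P (canon (c2 p) - canon x) < e2} \<inter>
      {p\<in>topspace Q. pos_norm P (canon x - f p) < e} \<inter>
      (if q = q0 then topspace Q else topspace Q - {q0})"
    have "openin Q (topspace Q - {q0})"
      using Hausdorff_imp_t1_space[OF hausdorff] by (cases "q0 \<in> topspace Q") (auto simp: t1_space_openin_delete_alt)
    then have "openin Q U" unfolding U_def using f(1) c(1,3)
      by (intro openin_Int openin_pos_norm_less) (auto simp: lsc_funs_iff)
    moreover have "q \<in> U" using q x by (auto simp: U_def)
    moreover have "\<forall>p\<in>U. x \<in> A p" using x by (auto simp: U_def A_def split: if_splits)
    ultimately show "\<exists>s U. contQ s \<and> openin Q U \<and> q \<in> U \<and> (\<forall>p\<in>U. s p \<in> A p)"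
      by (intro exI[of _ "\<lambda>_. x"] exI[of _ U]) auto
  qed blast
  then obtain c where "contQ c" "\<And>q. q \<in> topspace Q \<Longrightarrow> c q \<in> A q" by blast
  then show ?thesis by (intro that[of c]) (fastforce simp: A_def)+
qed

section \<open>Uniform limits and series of continuous functions\<close>

lemma continuous_uniform_limit:
  fixes g :: "'q \<Rightarrow> 'b::real_normed_vector"
  assumes "\<And>e. 0 < e \<Longrightarrow> \<exists>h. continuous_map Q euclidean h \<and> (\<forall>q\<in>topspace Q. norm (g q - h q) < e)"
  shows "continuous_map Q euclidean g"
proof -
  have "continuous_map Q Met_TC.mtopology g"
    unfolding Met_TC.continuous_map_to_metric
  proof (intro ballI allI impI)
    fix q and e :: real assume q: "q \<in> topspace Q" and e: "0 < e"
    obtain h where h: "continuous_map Q euclidean h" "\<And>q. q \<in> topspace Q \<Longrightarrow> norm (g q - h q) < e/3"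
      using assms[of "e/3"] e by auto
    have "openin Q {p\<in>topspace Q. norm (h p - h q) \<in> {..<e/3}}"
      using h(1) by (intro openin_continuous_map_preimage) (auto intro!: continuous_intros)
    moreover have "g p \<in> Met_TC.mball (g q) e" if "p \<in> topspace Q" "norm (h p - h q) < e/3" for p
    proof -
      have "norm (g q - g p) = norm ((g q - h q) - (h p - h q) - (g p - h p))" by simp
      also have "\<dots> \<le> norm (g q - h q) + norm (h p - h q) + norm (g p - h p)"
        by (meson add_mono_thms_linordered_semiring(3) norm_triangle_ineq4 order_trans)
      also have "\<dots> < e" using h(2)[OF q] h(2)[OF that(1)] that(2) by simp
      finally show ?thesis by (simp add: dist_norm)
    qed
    ultimately show "\<exists>U. openin Q U \<and> q \<in> U \<and> (\<forall>y\<in>U. g y \<in> Met_TC.mball (g q) e)"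
      using q e by (intro exI[of _ "{p\<in>topspace Q. norm (h p - h q) \<in> {..<e/3}}"]) auto
  qed
  then show ?thesis by simp
qed

lemma continuous_suminf:
  fixes b :: "nat \<Rightarrow> 'q \<Rightarrow> 'b::banach"
  assumes b: "\<And>n. continuous_map Q euclidean (b n)" and a: "summable a"
    and le: "\<And>n q. q \<in> topspace Q \<Longrightarrow> norm (b n q) \<le> a n"
  shows "continuous_map Q euclidean (\<lambda>q. \<Sum>n. b n q)"
proof (rule continuous_uniform_limit)
  fix e :: real assume "0 < e"
  then obtain N where N: "norm (\<Sum>i. a (i + N)) < e" using suminf_exist_split[OF _ a] by blast
  have "norm ((\<Sum>n. b n q) - (\<Sum>n<N. b n q)) < e" if q: "q \<in> topspace Q" for q
  proof -
    have "summable (\<lambda>n. b n q)" using a le[OF q] by (rule summable_comparison_test'[of _ 0])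
    then have "(\<Sum>n. b n q) - (\<Sum>n<N. b n q) = (\<Sum>n. b (n + N) q)" by (rule suminf_minus_initial_segment[symmetric])
    also have "norm \<dots> \<le> (\<Sum>n. a (n + N))" using le[OF q] summable_ignore_initial_segment[OF a] by (rule norm_suminf_le)
    finally show ?thesis using N by simp
  qed
  moreover have "continuous_map Q euclidean (\<lambda>q. \<Sum>n<N. b n q)" using b by (intro continuous_map_sum) auto
  ultimately show "\<exists>h. continuous_map Q euclidean h \<and> (\<forall>q\<in>topspace Q. norm ((\<Sum>n. b n q) - h q) < e)" by blast
qed

text \<open>Subtracting the tails of a series of continuous upper bounds for the differences
  \<open>w n - w (Suc n)\<close> turns an almost increasing sequence into an increasing one.\<close>

lemma increasing_correction:
  assumes w: "\<And>n. contQ (w n)" and e: "0 < e"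
    and less: "\<And>n q. q \<in> topspace Q \<Longrightarrow> pos_norm P (canon (w n q) - canon (w (Suc n) q)) < e / 2 ^ Suc n"
  obtains y where "\<And>n. contQ (y n)" "\<And>n q. q \<in> topspace Q \<Longrightarrow> norm (w n q - y n q) \<le> e / 2 ^ n"
    "\<And>m n. m \<le> n \<Longrightarrow> le_by P Q 0 (canon_fun Q (y m)) (canon_fun Q (y n))"
proof -
  have "\<exists>b. contQ b \<and> (\<forall>q\<in>topspace Q. norm (b q) < e / 2 ^ Suc n) \<and>
    (\<forall>q\<in>topspace Q. \<forall>\<phi>\<in>dual_ball P. blinfun_apply \<phi> (w n q - w (Suc n) q) \<le> blinfun_apply \<phi> (b q))" for n
    by (rule continuous_upper_bound[of "\<lambda>q. w n q - w (Suc n) q" "e / 2 ^ Suc n"])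
      (use w less in \<open>auto simp: canon_diff intro!: continuous_intros\<close>)
  then obtain b where b: "\<And>n. contQ (b n)" "\<And>n q. q \<in> topspace Q \<Longrightarrow> norm (b n q) < e / 2 ^ Suc n"
    "\<And>n q \<phi>. q \<in> topspace Q \<Longrightarrow> \<phi> \<in> dual_ball P \<Longrightarrow> blinfun_apply \<phi> (w n q - w (Suc n) q) \<le> blinfun_apply \<phi> (b n q)"
    by metis
  \<comment> \<open>Since t n = b n + t (Suc n), the increment of w n - t n is w (Suc n) - w n + b
    n, which is nonnegative on the dual ball. The exponent Suc n in the hypothesis makes these tails
    at most e / 2 ^ n in norm.\<close>
  define t where "t n q = (\<Sum>k. b (n + k) q)" for n q
  have sums: "(\<lambda>k. e / 2 ^ Suc (n + k)) sums (e / 2 ^ n)" for n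
  proof -
    have "(\<lambda>k. (e / 2 ^ n) * (1/2) ^ Suc k) sums ((e / 2 ^ n) * 1)"
      by (intro sums_mult power_half_series)
    then show ?thesis by (simp add: power_add field_simps)
  qed
  have bn: "norm (b (n + k) q) \<le> e / 2 ^ Suc (n + k)" if "q \<in> topspace Q" for n k q
    using b(2)[OF that] less_imp_le by blast
  have summ: "summable (\<lambda>k. b (n + k) q)" if "q \<in> topspace Q" for n q
    using sums_summable[OF sums[of n]] bn[OF that] by (rule summable_comparison_test'[of _ 0])
  have tn: "norm (t n q) \<le> e / 2 ^ n" if "q \<in> topspace Q" for n q
    unfolding t_def using sums_unique[OF sums[of n]] norm_suminf_le[OF bn[OF that] sums_summable[OF sums[of n]]]
    by simp
  have step: "t n q = b n q + t (Suc n) q" if "q \<in> topspace Q" for n q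
    using suminf_split_head[OF summ[OF that, of n]] by (simp add: t_def)
  have t: "contQ (t n)" for n
    unfolding t_def using b(1) sums_summable[OF sums[of n]] bn by (rule continuous_suminf)
  show ?thesis
  proof (rule that[of "\<lambda>n q. w n q - t n q"])
    show "contQ (\<lambda>q. w n q - t n q)" for n using w t by (intro continuous_intros)
    show "norm (w n q - (w n q - t n q)) \<le> e / 2 ^ n" if "q \<in> topspace Q" for n q using tn[OF that] by simp
    have inc: "blinfun_apply \<phi> (w n q - t n q) \<le> blinfun_apply \<phi> (w (Suc n) q - t (Suc n) q)"
      if "q \<in> topspace Q" "\<phi> \<in> dual_ball P" for n q \<phi>
      using b(3)[OF that, of n] step[OF that(1), of n] by (simp add: blinfun.diff_right blinfun.add_right)
    show "le_by P Q 0 (canon_fun Q (\<lambda>q. w m q - t m q)) (canon_fun Q (\<lambda>q. w n q - t n q))" if mn: "m \<le> n" for m n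
      unfolding le_by_def
    proof (intro ballI)
      fix q \<phi> assume q: "q \<in> topspace Q" "\<phi> \<in> dual_ball P"
      show "blinfun_apply (canon_fun Q (\<lambda>q. w m q - t m q) q) \<phi> \<le> blinfun_apply (canon_fun Q (\<lambda>q. w n q - t n q) q) \<phi> + 0"
        using lift_Suc_mono_le[of "\<lambda>n. blinfun_apply \<phi> (w n q - t n q)", OF inc[OF q] mn] q by simp
    qed
  qed
qed

end

section \<open>Limits of Cauchy nets\<close>

lemma compactin_cluster_point:
  assumes C: "compactin X C" and F: "F \<noteq> bot" and x: "eventually (\<lambda>\<delta>. x \<delta> \<in> C) F"
  obtains z where "z \<in> C" "\<And>U. openin X U \<Longrightarrow> z \<in> U \<Longrightarrow> frequently (\<lambda>\<delta>. x \<delta> \<in> U) F"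
proof (rule ccontr)
  note obt = that
  assume no: "\<not> thesis"
  have "\<exists>U. openin X U \<and> z \<in> U \<and> eventually (\<lambda>\<delta>. x \<delta> \<notin> U) F" if "z \<in> C" for z
    using obt[of z] that no unfolding frequently_def by blast
  then obtain U where U: "\<And>z. z \<in> C \<Longrightarrow> openin X (U z)" "\<And>z. z \<in> C \<Longrightarrow> z \<in> U z"
    "\<And>z. z \<in> C \<Longrightarrow> eventually (\<lambda>\<delta>. x \<delta> \<notin> U z) F" by metis
  then have "\<exists>\<F>. finite \<F> \<and> \<F> \<subseteq> U ` C \<and> C \<subseteq> \<Union>\<F>"
    by (intro compactinD[OF C]) auto
  then obtain G where G: "G \<subseteq> C" "finite G" "C \<subseteq> \<Union>(U ` G)" by (metis finite_subset_image)
  have "eventually (\<lambda>\<delta>. \<forall>z\<in>G. x \<delta> \<notin> U z) F"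
    using G(1) U(3) by (intro eventually_ball_finite G(2)) auto
  with x have "eventually (\<lambda>_. False) F" by eventually_elim (use G(3) in blast)
  then show False using F by (simp add: trivial_limit_def)
qed

text \<open>Compactness of the bidual ball gives a cluster point z. On K the Cauchy condition makes
  the values almost increasing: a term well above z \<phi> would keep all later terms away from z
  \<phi>, and a term near z \<phi> keeps the later ones from falling.\<close>

lemma bidual_limit:
  fixes x :: "'i \<Rightarrow> 'a::banach bidual"
  assumes F: "F \<noteq> bot" and bound: "eventually (\<lambda>\<delta>. norm (x \<delta>) \<le> r) F"
    and cauchy: "\<And>\<epsilon>. 0 < \<epsilon> \<Longrightarrow> eventually (\<lambda>\<gamma>. eventually (\<lambda>\<delta>. \<forall>\<phi>\<in>K.
      blinfun_apply (x \<gamma>) \<phi> \<le> blinfun_apply (x \<delta>) \<phi> + \<epsilon>) F) F"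
  obtains z where "norm z \<le> r" "\<And>\<phi>. \<phi> \<in> K \<Longrightarrow> ((\<lambda>\<delta>. blinfun_apply (x \<delta>) \<phi>) \<longlongrightarrow> blinfun_apply z \<phi>) F"
proof -
  have "eventually (\<lambda>\<delta>. x \<delta> \<in> cball 0 r) F" using bound by simp
  then obtain z where z: "z \<in> cball 0 r"
    "\<And>U. openin strong_operator_topology U \<Longrightarrow> z \<in> U \<Longrightarrow> frequently (\<lambda>\<delta>. x \<delta> \<in> U) F"
    using compactin_cluster_point[OF compactin_strong_operator_cball F] by metis
  have near: "frequently (\<lambda>\<delta>. \<bar>blinfun_apply (x \<delta>) \<phi> - blinfun_apply z \<phi>\<bar> < e) F" if "0 < e" for \<phi> and e :: real
  proof -
    have "openin strong_operator_topology
        {y\<in>topspace strong_operator_topology. blinfun_apply y \<phi> \<in> ball (blinfun_apply z \<phi>) e}"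
      by (rule openin_continuous_map_preimage[OF strong_operator_topology_continuous_evaluation]) simp
    then have "frequently (\<lambda>\<delta>. x \<delta> \<in> {y\<in>topspace strong_operator_topology. blinfun_apply y \<phi> \<in> ball (blinfun_apply z \<phi>) e}) F"
      using that by (intro z(2)) (auto simp: strong_operator_topology_topspace)
    then show ?thesis by (simp add: strong_operator_topology_topspace dist_real_def abs_minus_commute)
  qed
  have "((\<lambda>\<delta>. blinfun_apply (x \<delta>) \<phi>) \<longlongrightarrow> blinfun_apply z \<phi>) F" if \<phi>: "\<phi> \<in> K" for \<phi>
  proof (rule tendstoI)
    fix e :: real assume "0 < e"
    then have e: "0 < e / 3" by simp
    have good: "eventually (\<lambda>\<gamma>. eventually (\<lambda>\<delta>. blinfun_apply (x \<gamma>) \<phi> \<le> blinfun_apply (x \<delta>) \<phi> + e / 3) F) F"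
      using cauchy[OF e] by eventually_elim (use \<phi> in \<open>auto elim: eventually_mono\<close>)
    have up: "eventually (\<lambda>\<gamma>. blinfun_apply (x \<gamma>) \<phi> < blinfun_apply z \<phi> + e) F"
      using good
    proof eventually_elim
      case (elim \<gamma>)
      from frequently_eventually_frequently[OF near[OF e, of \<phi>] elim]
      obtain \<delta> where "\<bar>blinfun_apply (x \<delta>) \<phi> - blinfun_apply z \<phi>\<bar> < e / 3"
        "blinfun_apply (x \<gamma>) \<phi> \<le> blinfun_apply (x \<delta>) \<phi> + e / 3" using frequently_ex by blast
      then show ?case using \<open>0 < e\<close> by linarith
    qed
    from frequently_eventually_frequently[OF near[OF e, of \<phi>] good]
    obtain \<gamma> where \<gamma>: "\<bar>blinfun_apply (x \<gamma>) \<phi> - blinfun_apply z \<phi>\<bar> < e / 3"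
      "eventually (\<lambda>\<delta>. blinfun_apply (x \<gamma>) \<phi> \<le> blinfun_apply (x \<delta>) \<phi> + e / 3) F" using frequently_ex by blast
    from \<gamma>(2) up show "\<forall>\<^sub>F \<delta> in F. dist (blinfun_apply (x \<delta>) \<phi>) (blinfun_apply z \<phi>) < e"
    proof eventually_elim
      case (elim \<delta>)
      then show ?case using \<gamma>(1) \<open>0 < e\<close> unfolding dist_real_def by linarith
    qed
  qed
  then show ?thesis using z(1) that by simp
qed

definition pointwise_limit ::
    "'a::banach set \<Rightarrow> 'q topology \<Rightarrow> 'i filter \<Rightarrow> ('i \<Rightarrow> 'q \<Rightarrow> 'a bidual) \<Rightarrow> ('q \<Rightarrow> 'a bidual) \<Rightarrow> bool" where
  "pointwise_limit P Q F x z \<longleftrightarrow> (\<forall>q\<in>topspace Q. \<forall>\<phi>\<in>dual_ball P.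
     ((\<lambda>\<delta>. blinfun_apply (x \<delta> q) \<phi>) \<longlongrightarrow> blinfun_apply (z q) \<phi>) F)"

text \<open>This estimate is uniform in q and \<phi> because the Cauchy condition is, and it
  survives the passage to the limit. The opposite one, \<open>pointwise_limit_lower\<close>, holds
  only at a given q and \<phi>.\<close>

lemma pointwise_limit_upper:
  assumes F: "F \<noteq> bot" and x: "cauchy_along P Q F x" and lim: "pointwise_limit P Q F x z" and e: "0 < e"
  shows "eventually (\<lambda>\<gamma>. le_by P Q e (x \<gamma>) z) F"
proof -
  have "eventually (\<lambda>\<gamma>. eventually (\<lambda>\<delta>. le_by P Q e (x \<gamma>) (x \<delta>)) F) F"
    using x e by (simp add: cauchy_along_def)
  then show ?thesis
  proof eventually_elim
    case (elim \<gamma>)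
    show ?case unfolding le_by_def
    proof (intro ballI)
      fix q \<phi> assume q: "q \<in> topspace Q" "\<phi> \<in> dual_ball P"
      have "((\<lambda>\<delta>. blinfun_apply (x \<delta> q) \<phi> + e) \<longlongrightarrow> blinfun_apply (z q) \<phi> + e) F"
        using lim q by (intro tendsto_add tendsto_const) (simp add: pointwise_limit_def)
      then show "blinfun_apply (x \<gamma> q) \<phi> \<le> blinfun_apply (z q) \<phi> + e"
        using F elim q by (elim tendsto_lowerbound) (auto simp: le_by_def elim: eventually_mono)
    qed
  qed
qed

lemma pointwise_limit_lower:
  assumes "pointwise_limit P Q F x z" "q \<in> topspace Q" "\<phi> \<in> dual_ball P" "0 < e"
  shows "eventually (\<lambda>\<gamma>. blinfun_apply (z q) \<phi> < blinfun_apply (x \<gamma> q) \<phi> + e) F"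
proof -
  have "eventually (\<lambda>\<gamma>. blinfun_apply (z q) \<phi> - e < blinfun_apply (x \<gamma> q) \<phi>) F"
    using assms by (intro order_tendstoD(1)[of _ "blinfun_apply (z q) \<phi>"]) (auto simp: pointwise_limit_def)
  then show ?thesis by eventually_elim simp
qed

text \<open>Each \<phi> has a term x (g \<phi>) of the net that satisfies the estimate at \<phi>
  and, by upper semicontinuity, near \<phi>. Finitely many such terms serve the whole dual ball, and
  the Cauchy condition carries their estimates to all late terms.\<close>

lemma dini_point:
  assumes F: "F \<noteq> bot" and x: "cauchy_along P Q F x" and lim: "pointwise_limit P Q F x z" and q: "q \<in> topspace Q"
    and lsc: "eventually (\<lambda>\<delta>. x \<delta> q \<in> lsc_bidual P) F" and less: "pos_norm P (canon a - z q) < r"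
  shows "eventually (\<lambda>\<gamma>. pos_norm P (canon a - x \<gamma> q) < r) F"
proof -
  define m where "m = pos_norm P (canon a - z q)"
  \<comment> \<open>One e pays for approximating z \<phi>, one for passing to a late term, and the
    third keeps the inequality strict.\<close>
  define e where "e = (r - m) / 3"
  have e: "0 < e" using less by (simp add: e_def m_def)
  have "\<exists>\<gamma>. x \<gamma> q \<in> lsc_bidual P \<and> eventually (\<lambda>\<delta>. le_by P Q e (x \<gamma>) (x \<delta>)) F \<and>
      blinfun_apply \<phi> a - blinfun_apply (x \<gamma> q) \<phi> < m + e" if \<phi>: "\<phi> \<in> dual_ball P" for \<phi>
  proof -
    have "eventually (\<lambda>\<gamma>. x \<gamma> q \<in> lsc_bidual P \<and> eventually (\<lambda>\<delta>. le_by P Q e (x \<gamma>) (x \<delta>)) F \<and>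
        blinfun_apply (z q) \<phi> < blinfun_apply (x \<gamma> q) \<phi> + e) F"
      using lsc x e pointwise_limit_lower[OF lim q \<phi> e] by (auto simp: cauchy_along_def intro!: eventually_conj)
    then obtain \<gamma> where "x \<gamma> q \<in> lsc_bidual P" "eventually (\<lambda>\<delta>. le_by P Q e (x \<gamma>) (x \<delta>)) F"
        "blinfun_apply (z q) \<phi> < blinfun_apply (x \<gamma> q) \<phi> + e" using eventually_happens'[OF F] by blast
    moreover have "blinfun_apply \<phi> a - blinfun_apply (z q) \<phi> \<le> m"
      using pos_norm_upper[OF \<phi>, of "canon a - z q"] by (simp add: m_def blinfun.diff_left)
    ultimately show ?thesis by (intro exI[of _ \<gamma>]) auto
  qed
  then obtain g where g: "\<And>\<phi>. \<phi> \<in> dual_ball P \<Longrightarrow> x (g \<phi>) q \<in> lsc_bidual P"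
    "\<And>\<phi>. \<phi> \<in> dual_ball P \<Longrightarrow> eventually (\<lambda>\<delta>. le_by P Q e (x (g \<phi>)) (x \<delta>)) F"
    "\<And>\<phi>. \<phi> \<in> dual_ball P \<Longrightarrow> blinfun_apply \<phi> a - blinfun_apply (x (g \<phi>) q) \<phi> < m + e" by metis
  define V where "V \<phi> = {\<psi>\<in>dual_ball P. blinfun_apply \<psi> a - blinfun_apply (x (g \<phi>) q) \<psi> < m + e}" for \<phi>
  have "compactin (weak_dual_ball P) (dual_ball P)" using compact_weak_dual_ball[of P] by (simp add: compact_space_def)
  then have "\<exists>\<F>. finite \<F> \<and> \<F> \<subseteq> V ` dual_ball P \<and> dual_ball P \<subseteq> \<Union>\<F>"
    using openin_dual_ball_less[OF g(1)] g(3) by (intro compactinD) (auto simp: V_def)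
  then obtain G where G: "G \<subseteq> dual_ball P" "finite G" "dual_ball P \<subseteq> \<Union>(V ` G)" by (metis finite_subset_image)
  have "eventually (\<lambda>\<delta>. \<forall>\<phi>\<in>G. le_by P Q e (x (g \<phi>)) (x \<delta>)) F"
    using G(1) g(2) by (intro eventually_ball_finite G(2)) auto
  then show ?thesis
  proof eventually_elim
    case (elim \<delta>)
    have "pos_norm P (canon a - x \<delta> q) \<le> m + 2 * e"
      unfolding pos_norm_le_iff
    proof
      fix \<psi> assume \<psi>: "\<psi> \<in> dual_ball P"
      then obtain \<phi> where "\<phi> \<in> G" "blinfun_apply \<psi> a - blinfun_apply (x (g \<phi>) q) \<psi> < m + e"
        using G(3) by (auto simp: V_def)
      moreover from this have "blinfun_apply (x (g \<phi>) q) \<psi> \<le> blinfun_apply (x \<delta> q) \<psi> + e"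
        using elim le_byD[OF _ q \<psi>] by blast
      ultimately show "blinfun_apply (canon a - x \<delta> q) \<psi> \<le> m + 2 * e" by (simp add: blinfun.diff_left)
    qed
    also have "\<dots> < r" using less by (simp add: e_def m_def field_simps)
    finally show ?case .
  qed
qed

context preordered_functions
begin

text \<open>Openness of a level set passes from a single term to the limit: at the given point the
  term comes close to z, by pointwise convergence or by \<open>dini_point\<close>, while z dominates
  the term everywhere up to a uniform error.\<close>

lemma lsc_funs_complete:
  assumes F: "F \<noteq> bot" and x: "cauchy_along P Q F x" and S: "eventually (\<lambda>\<delta>. x \<delta> \<in> lsc_funs P Q) F"
    and bound: "eventually (\<lambda>\<delta>. \<forall>q\<in>topspace Q. norm (x \<delta> q) \<le> r) F"
  obtains z where "z \<in> lsc_funs P Q" "\<And>q. q \<in> topspace Q \<Longrightarrow> norm (z q) \<le> r" "pointwise_limit P Q F x z"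
proof -
  have "\<exists>z. norm z \<le> r \<and> (\<forall>\<phi>\<in>dual_ball P. ((\<lambda>\<delta>. blinfun_apply (x \<delta> q) \<phi>) \<longlongrightarrow> blinfun_apply z \<phi>) F)"
    if q: "q \<in> topspace Q" for q
  proof (rule bidual_limit[OF F, of "\<lambda>\<delta>. x \<delta> q" r "dual_ball P"])
    show "eventually (\<lambda>\<delta>. norm (x \<delta> q) \<le> r) F" using bound q by (auto elim: eventually_mono)
    fix e :: real assume "0 < e"
    then have "eventually (\<lambda>\<gamma>. eventually (\<lambda>\<delta>. le_by P Q e (x \<gamma>) (x \<delta>)) F) F" using x by (simp add: cauchy_along_def)
    then show "\<forall>\<^sub>F \<gamma> in F. \<forall>\<^sub>F \<delta> in F. \<forall>\<phi>\<in>dual_ball P. blinfun_apply (x \<gamma> q) \<phi> \<le> blinfun_apply (x \<delta> q) \<phi> + e"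
      by eventually_elim (use q in \<open>auto simp: le_by_def elim: eventually_mono\<close>)
  qed blast
  then obtain z0 where z0: "\<And>q. q \<in> topspace Q \<Longrightarrow> norm (z0 q) \<le> r"
    "\<And>q \<phi>. q \<in> topspace Q \<Longrightarrow> \<phi> \<in> dual_ball P \<Longrightarrow> ((\<lambda>\<delta>. blinfun_apply (x \<delta> q) \<phi>) \<longlongrightarrow> blinfun_apply (z0 q) \<phi>) F"
    by metis
  define z where "z = restrict z0 (topspace Q)"
  have z: "norm (z q) \<le> r" if "q \<in> topspace Q" for q using z0(1) that by (simp add: z_def)
  have lim: "pointwise_limit P Q F x z" using z0(2) by (simp add: pointwise_limit_def z_def)
  have lscx: "eventually (\<lambda>\<delta>. x \<delta> q \<in> lsc_bidual P) F" if "q \<in> topspace Q" for q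
    using S that by (auto simp: lsc_funs_iff elim: eventually_mono)
  have "z q \<in> lsc_bidual P" if q: "q \<in> topspace Q" for q
    unfolding lsc_bidual_iff
  proof (intro allI, subst openin_subopen, intro ballI)
    fix s \<phi> assume \<phi>: "\<phi> \<in> {\<phi>\<in>dual_ball P. s < blinfun_apply (z q) \<phi>}"
    define e where "e = (blinfun_apply (z q) \<phi> - s) / 3"
    have e: "0 < e" using \<phi> by (simp add: e_def)
    have "eventually (\<lambda>\<gamma>. x \<gamma> q \<in> lsc_bidual P \<and> le_by P Q e (x \<gamma>) z \<and>
        blinfun_apply (z q) \<phi> < blinfun_apply (x \<gamma> q) \<phi> + e) F"
      using \<phi> by (intro eventually_conj lscx q pointwise_limit_upper[OF F x lim e] pointwise_limit_lower[OF lim q _ e]) simp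
    then obtain \<gamma> where \<gamma>: "x \<gamma> q \<in> lsc_bidual P" "le_by P Q e (x \<gamma>) z"
        "blinfun_apply (z q) \<phi> < blinfun_apply (x \<gamma> q) \<phi> + e" using eventually_happens'[OF F] by blast
    show "\<exists>T. openin (weak_dual_ball P) T \<and> \<phi> \<in> T \<and> T \<subseteq> {\<phi>\<in>dual_ball P. s < blinfun_apply (z q) \<phi>}"
    proof (intro exI[of _ "{\<phi>\<in>dual_ball P. s + e < blinfun_apply (x \<gamma> q) \<phi>}"] conjI)
      show "openin (weak_dual_ball P) {\<phi>\<in>dual_ball P. s + e < blinfun_apply (x \<gamma> q) \<phi>}"
        using \<gamma>(1) by (simp add: lsc_bidual_iff)
      show "\<phi> \<in> {\<phi>\<in>dual_ball P. s + e < blinfun_apply (x \<gamma> q) \<phi>}" using \<phi> \<gamma>(3) by (simp add: e_def field_simps)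
      show "{\<phi>\<in>dual_ball P. s + e < blinfun_apply (x \<gamma> q) \<phi>} \<subseteq> {\<phi>\<in>dual_ball P. s < blinfun_apply (z q) \<phi>}"
        using \<gamma>(2) q by (auto simp: le_by_def) (meson add_less_cancel_right less_le_trans)
    qed
  qed
  moreover have "openin Q {q\<in>topspace Q. pos_norm P (canon c - z q) < e}" for c e
  proof (subst openin_subopen, intro ballI)
    fix q assume q: "q \<in> {q\<in>topspace Q. pos_norm P (canon c - z q) < e}"
    then obtain e' where e': "pos_norm P (canon c - z q) < e'" "e' < e" using dense by blast
    have "eventually (\<lambda>\<gamma>. x \<gamma> \<in> lsc_funs P Q \<and> le_by P Q (e - e') (x \<gamma>) z \<and> pos_norm P (canon c - x \<gamma> q) < e') F"
      using q e' by (intro eventually_conj S pointwise_limit_upper[OF F x lim] dini_point[OF F x lim] lscx) auto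
    then obtain \<gamma> where \<gamma>: "x \<gamma> \<in> lsc_funs P Q" "le_by P Q (e - e') (x \<gamma>) z" "pos_norm P (canon c - x \<gamma> q) < e'"
      using eventually_happens'[OF F] by blast
    show "\<exists>T. openin Q T \<and> q \<in> T \<and> T \<subseteq> {q\<in>topspace Q. pos_norm P (canon c - z q) < e}"
    proof (intro exI[of _ "{q\<in>topspace Q. pos_norm P (canon c - x \<gamma> q) < e'}"] conjI)
      show "openin Q {q\<in>topspace Q. pos_norm P (canon c - x \<gamma> q) < e'}" using \<gamma>(1) by (simp add: lsc_funs_iff)
      show "q \<in> {q\<in>topspace Q. pos_norm P (canon c - x \<gamma> q) < e'}" using q \<gamma>(3) by simp
      show "{q\<in>topspace Q. pos_norm P (canon c - x \<gamma> q) < e'} \<subseteq> {q\<in>topspace Q. pos_norm P (canon c - z q) < e}"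
      proof clarify
        fix p assume p: "p \<in> topspace Q" "pos_norm P (canon c - x \<gamma> p) < e'"
        have "pos_norm P (x \<gamma> p - z p) \<le> e - e'" using \<gamma>(2) p by (simp add: le_by_iff)
        then show "pos_norm P (canon c - z p) < e" using p(2) pos_norm_triangle[of P "canon c" "z p" "x \<gamma> p"] by simp
      qed
    qed
  qed
  ultimately have "z \<in> lsc_funs P Q"
    unfolding lsc_funs_iff using z by (auto intro!: bounded_funsI[of _ _ r] simp: z_def)
  then show ?thesis using z lim by (rule that)
qed

text \<open>Dini's argument a second time, now over Q, with \<open>dini_point\<close> as the
  pointwise statement. The three errors e come from the strict estimate at q, the variation of y
  near q and the passage to late terms.\<close>

lemma dini_functions:
  assumes F: "F \<noteq> bot" and x: "cauchy_along P Q F x" and S: "eventually (\<lambda>\<delta>. x \<delta> \<in> lsc_funs P Q) F"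
    and lim: "pointwise_limit P Q F x z" and y: "contQ y" and le: "le_by P Q r (canon_fun Q y) z" "r < r'"
  shows "eventually (\<lambda>\<delta>. le_by P Q r' (canon_fun Q y) (x \<delta>)) F"
proof -
  define e where "e = (r' - r) / 3"
  have e: "0 < e" using le by (simp add: e_def)
  have "\<exists>\<gamma>. x \<gamma> \<in> lsc_funs P Q \<and> eventually (\<lambda>\<delta>. le_by P Q e (x \<gamma>) (x \<delta>)) F \<and>
      pos_norm P (canon (y q) - x \<gamma> q) < r + e" if q: "q \<in> topspace Q" for q
  proof -
    have lsc: "eventually (\<lambda>\<delta>. x \<delta> q \<in> lsc_bidual P) F"
      using S q by (auto simp: lsc_funs_iff elim: eventually_mono)
    have "pos_norm P (canon (y q) - z q) < r + e" using le(1) q e by (force simp: le_by_iff)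
    then have "eventually (\<lambda>\<gamma>. x \<gamma> \<in> lsc_funs P Q \<and> eventually (\<lambda>\<delta>. le_by P Q e (x \<gamma>) (x \<delta>)) F \<and>
      pos_norm P (canon (y q) - x \<gamma> q) < r + e) F"
      using x e by (intro eventually_conj S dini_point[OF F x lim q lsc]) (auto simp: cauchy_along_def)
    then show ?thesis using eventually_happens'[OF F] by blast
  qed
  then obtain g where g: "\<And>q. q \<in> topspace Q \<Longrightarrow> x (g q) \<in> lsc_funs P Q"
    "\<And>q. q \<in> topspace Q \<Longrightarrow> eventually (\<lambda>\<delta>. le_by P Q e (x (g q)) (x \<delta>)) F"
    "\<And>q. q \<in> topspace Q \<Longrightarrow> pos_norm P (canon (y q) - x (g q) q) < r + e" by metis
  define V where "V q = {p\<in>topspace Q. pos_norm P (canon (y q) - x (g q) p) < r + e} \<inter> {p\<in>topspace Q. norm (y p - y q) < e}" for q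
  have "openin Q (V q)" if "q \<in> topspace Q" for q
    unfolding V_def using g(1)[OF that] openin_norm_less[OF y] by (intro openin_Int) (auto simp: lsc_funs_iff)
  then have "\<exists>\<F>. finite \<F> \<and> \<F> \<subseteq> V ` topspace Q \<and> topspace Q \<subseteq> \<Union>\<F>"
    using g(3) e compact unfolding compact_space_def by (intro compactinD) (auto simp: V_def)
  then obtain G where G: "G \<subseteq> topspace Q" "finite G" "topspace Q \<subseteq> \<Union>(V ` G)" by (metis finite_subset_image)
  have "eventually (\<lambda>\<delta>. \<forall>q\<in>G. le_by P Q e (x (g q)) (x \<delta>)) F"
    using G(1) g(2) by (intro eventually_ball_finite G(2)) auto
  then show ?thesis
  proof eventually_elim
    case (elim \<delta>)
    show ?case unfolding le_by_iff
    proof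
      fix p assume p: "p \<in> topspace Q"
      then obtain q where q: "q \<in> G" "pos_norm P (canon (y q) - x (g q) p) < r + e" "norm (y p - y q) < e"
        using G(3) by (auto simp: V_def)
      have "pos_norm P (x (g q) p - x \<delta> p) \<le> e" using elim q(1) p by (simp add: le_by_iff)
      moreover have "pos_norm P (canon (y p) - canon (y q)) < e"
        using pos_norm_le_norm[of P "canon (y p - y q)"] q(3) unfolding norm_canon by (simp add: canon_diff)
      ultimately show "pos_norm P (canon_fun Q y p - x \<delta> p) \<le> r'"
        using p q(2) pos_norm_triangle[of P "canon (y p)" "x \<delta> p" "canon (y q)"]
          pos_norm_triangle[of P "canon (y q)" "x \<delta> p" "x (g q) p"] by (simp add: e_def field_simps)
    qed
  qed
qed

text \<open>The lower estimate holds because the terms are eventually below z up to any error. For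
  the upper one z is compared with the pointwise limit z', to which \<open>dini_functions\<close>
  applies; z \<le> z' since limits agree up to the preorder. The set Z stands both for the unit part
  of S, with r = 1, and for S itself.\<close>

lemma dist_tendsto_of_bounded:
  assumes I: "directed_index I R" and x: "cauchy_along P Q (net_filter I R) x" and sub: "x ` I \<subseteq> Z"
    and Z: "Z \<subseteq> lsc_funs P Q" "\<And>f. f \<in> lsc_funs P Q \<Longrightarrow> (\<And>q. q \<in> topspace Q \<Longrightarrow> norm (f q) \<le> r) \<Longrightarrow> f \<in> Z"
    and bound: "eventually (\<lambda>\<delta>. \<forall>q\<in>topspace Q. norm (x \<delta> q) \<le> r) (net_filter I R)"
    and z: "z \<in> Z" "circ_limit (sup_dist P Q) Z I R x z" and y: "contQ y"
  shows "((\<lambda>\<delta>. sup_dist P Q (canon_fun Q y) (x \<delta>)) \<longlongrightarrow> sup_dist P Q (canon_fun Q y) z) (net_filter I R)"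
proof -
  let ?F = "net_filter I R"
  note F = net_filter_neq_bot[OF I]
  have S: "eventually (\<lambda>\<delta>. x \<delta> \<in> lsc_funs P Q) ?F"
    using eventually_net_filterD[OF I] by eventually_elim (use sub Z in auto)
  obtain z' where z': "z' \<in> lsc_funs P Q" "\<And>q. q \<in> topspace Q \<Longrightarrow> norm (z' q) \<le> r" "pointwise_limit P Q ?F x z'"
    using lsc_funs_complete[OF F x S bound] by metis
  have "z' \<in> Z" using z' Z(2) by blast
  moreover have "circ_limit (sup_dist P Q) Z I R x z'"
    using z'(3) by (intro circ_limit_pointwise) (simp add: pointwise_limit_def)
  ultimately have "le_by P Q 0 z z'" using circ_limit_unique[OF I x sub z(2)] by blast
  note zz' = this
  show ?thesis
  proof (rule order_tendstoI)
    fix a assume "a < sup_dist P Q (canon_fun Q y) z"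
    then obtain s q \<phi> where s: "a = ennreal s" "0 \<le> s" "q \<in> topspace Q" "\<phi> \<in> dual_ball P"
      "s < blinfun_apply (canon_fun Q y q) \<phi> - blinfun_apply (z q) \<phi>" by (rule less_sup_distD)
    define e where "e = blinfun_apply (canon_fun Q y q) \<phi> - blinfun_apply (z q) \<phi> - s"
    have "eventually (\<lambda>\<delta>. le_by P Q (e / 2) (x \<delta>) z) ?F"
      using s(5) by (intro circ_limit_upper[OF I x sub z(2)]) (simp add: e_def)
    then show "eventually (\<lambda>\<delta>. a < sup_dist P Q (canon_fun Q y) (x \<delta>)) ?F"
    proof eventually_elim
      case (elim \<delta>)
      show ?case unfolding s(1)
        using le_byD[OF elim s(3,4)] s(5) by (intro less_sup_distI[OF s(3,4) _ s(2)]) (simp add: e_def field_simps)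
    qed
  next
    fix a assume a: "sup_dist P Q (canon_fun Q y) z < a"
    then obtain b where b: "sup_dist P Q (canon_fun Q y) z < b" "b < a" using dense by blast
    then obtain t where t: "0 \<le> t" "b = ennreal t" by (cases b) auto
    obtain s where s: "0 \<le> s" "s < t" "le_by P Q s (canon_fun Q y) z"
      using b(1) unfolding t(2) by (rule sup_dist_lessD)
    have "le_by P Q s (canon_fun Q y) z'" using le_by_trans[OF s(3) zz'] by simp
    then have "eventually (\<lambda>\<delta>. le_by P Q t (canon_fun Q y) (x \<delta>)) ?F"
      using s(2) by (rule dini_functions[OF F x S z'(3) y])
    then show "eventually (\<lambda>\<delta>. sup_dist P Q (canon_fun Q y) (x \<delta>) < a) ?F"
    proof eventually_elim
      case (elim \<delta>)
      then have "sup_dist P Q (canon_fun Q y) (x \<delta>) \<le> b" using t by (simp add: sup_dist_le_iff)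
      then show ?case using b(2) by (rule le_less_trans)
    qed
  qed
qed

section \<open>Formal ball nets\<close>

text \<open>The strict order of formal balls: the distance of the centres is less than the
  difference of the radii. Strictness leaves room to insert further balls.\<close>

definition ball_order :: "('q \<Rightarrow> 'a bidual) \<times> real \<Rightarrow> ('q \<Rightarrow> 'a bidual) \<times> real \<Rightarrow> bool" where
  "ball_order a b \<longleftrightarrow> (\<exists>s\<ge>0. s + snd b < snd a \<and> le_by P Q s (fst a) (fst b))"

lemma ball_order_trans: "ball_order a b \<Longrightarrow> ball_order b c \<Longrightarrow> ball_order a c"
proof -
  assume "ball_order a b" "ball_order b c"
  then obtain s t where "0 \<le> s" "s + snd b < snd a" "le_by P Q s (fst a) (fst b)"
    "0 \<le> t" "t + snd c < snd b" "le_by P Q t (fst b) (fst c)" by (auto simp: ball_order_def)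
  then show "ball_order a c" unfolding ball_order_def
    by (intro exI[of _ "s + t"]) (auto intro: le_by_trans)
qed

lemma ball_orderD: "ball_order a b \<Longrightarrow> 0 < snd b \<Longrightarrow> le_by P Q (snd a) (fst a) (fst b) \<and> snd b < snd a"
  unfolding ball_order_def by (auto intro: le_by_mono)

text \<open>Beyond an index of radius at most e all radii are at most e, and a radius bounds the
  distance to every later centre. So the Cauchy property is built into the order.\<close>

lemma formal_ball_net:
  assumes pos: "\<And>a. a \<in> \<Gamma> \<Longrightarrow> 0 < snd a" and ne: "\<Gamma> \<noteq> {}"
    and dir: "\<And>a b. a \<in> \<Gamma> \<Longrightarrow> b \<in> \<Gamma> \<Longrightarrow> \<exists>c\<in>\<Gamma>. ball_order a c \<and> ball_order b c"
    and small: "\<And>e. 0 < e \<Longrightarrow> \<exists>a\<in>\<Gamma>. snd a \<le> e"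
  shows "directed_index \<Gamma> ball_order" "cauchy_net (sup_dist P Q) \<Gamma> ball_order fst"
proof -
  show I: "directed_index \<Gamma> ball_order"
    unfolding directed_index_def using ne dir by (auto intro!: transp_onI intro: ball_order_trans)
  show "cauchy_net (sup_dist P Q) \<Gamma> ball_order fst"
  proof (rule cauchy_netI[OF I])
    fix e :: real assume "0 < e"
    then obtain a where a: "a \<in> \<Gamma>" "snd a \<le> e" using small by blast
    have "le_by P Q e (fst b) (fst c)" if "b \<in> \<Gamma>" "ball_order a b" "c \<in> \<Gamma>" "ball_order b c" for b c
      using ball_orderD[OF that(2) pos[OF that(1)]] ball_orderD[OF that(4) pos[OF that(3)]] a(2)
      by (auto intro: le_by_mono)
    then show "\<exists>\<gamma>\<in>\<Gamma>. \<forall>\<delta>\<in>\<Gamma>. ball_order \<gamma> \<delta> \<longrightarrow> (\<forall>\<eta>\<in>\<Gamma>. ball_order \<delta> \<eta> \<longrightarrow> le_by P Q e (fst \<delta>) (fst \<eta>))"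
      using a(1) by blast
  qed
qed

definition cont_ball :: "real \<Rightarrow> ('q \<Rightarrow> 'a bidual) set" where
  "cont_ball r = canon_fun Q ` {c. contQ c \<and> (\<forall>q\<in>topspace Q. norm (c q) \<le> r)}"

text \<open>The net consists of all formal balls around continuous functions of norm at most r that
  contain f strictly. \<open>continuous_approx\<close> gives directedness and, through its free
  functional, balls whose centre comes close to f at a prescribed q and \<phi>.\<close>

lemma lsc_function_is_limit:
  assumes f: "f \<in> lsc_funs P Q" "\<And>q. q \<in> topspace Q \<Longrightarrow> norm (f q) \<le> r" and r: "0 < r"
  obtains \<Gamma> where "directed_index \<Gamma> ball_order" "fst ` \<Gamma> \<subseteq> cont_ball r"
    "cauchy_net (sup_dist P Q) \<Gamma> ball_order fst" "pointwise_limit P Q (net_filter \<Gamma> ball_order) fst f"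
proof -
  define \<Gamma> where "\<Gamma> = {(c, e). c \<in> cont_ball r \<and> 0 < e \<and> (\<exists>s\<ge>0. s < e \<and> le_by P Q s c f)}"
  have above: "\<exists>c\<in>cont_ball r. (c, e) \<in> \<Gamma> \<and> le_by P Q t1 (canon_fun Q c1) c \<and> le_by P Q t2 (canon_fun Q c2) c \<and>
      (q \<in> topspace Q \<longrightarrow> blinfun_apply (f q) \<phi> < blinfun_apply (c q) \<phi> + e)"
    if c: "contQ c1" "contQ c2" "s1 < t1" "s2 < t2" "le_by P Q s1 (canon_fun Q c1) f" "le_by P Q s2 (canon_fun Q c2) f"
      and e: "0 < e" for c1 c2 s1 s2 t1 t2 e q \<phi>
  proof -
    have c': "pos_norm P (canon (c1 q) - f q) < t1" "pos_norm P (canon (c2 q) - f q) < t2"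
      if "q \<in> topspace Q" for q using c(3-6) that by (force simp: le_by_iff)+
    have "0 < e / 2" using e by simp
    then obtain c where c: "contQ c" "\<And>q. q \<in> topspace Q \<Longrightarrow> norm (c q) \<le> r"
      "\<And>q. q \<in> topspace Q \<Longrightarrow> pos_norm P (canon (c1 q) - canon (c q)) < t1"
      "\<And>q. q \<in> topspace Q \<Longrightarrow> pos_norm P (canon (c2 q) - canon (c q)) < t2"
      "\<And>q. q \<in> topspace Q \<Longrightarrow> pos_norm P (canon (c q) - f q) < e / 2"
      "q \<in> topspace Q \<Longrightarrow> blinfun_apply (f q) \<phi> < blinfun_apply \<phi> (c q) + e / 2"
      using continuous_approx[OF f c(1) c'(1) c(2) c'(2), of "e / 2" "e / 2" q \<phi>] by metis
    have "canon_fun Q c \<in> cont_ball r" using c(1,2) by (auto simp: cont_ball_def)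
    moreover have "le_by P Q (e / 2) (canon_fun Q c) f" unfolding le_by_iff using c(5) by (auto intro: less_imp_le)
    ultimately have "(canon_fun Q c, e) \<in> \<Gamma>" using e by (auto simp: \<Gamma>_def intro!: exI[of _ "e / 2"])
    then show ?thesis using \<open>canon_fun Q c \<in> cont_ball r\<close> c(3,4,6) e
      by (intro bexI[of _ "canon_fun Q c"]) (auto simp: le_by_iff intro: less_imp_le)
  qed
  \<comment> \<open>The zero function is within r of f; fed into \<open>above\<close>, it yields
    balls of every radius.\<close>
  have zero: "le_by P Q r (canon_fun Q (\<lambda>_. 0)) f"
    using f(2) by (intro le_by_norm) (simp add: canon_zero)
  have small: "\<exists>c. (c, e) \<in> \<Gamma> \<and> (q \<in> topspace Q \<longrightarrow> blinfun_apply (f q) \<phi> < blinfun_apply (c q) \<phi> + e)"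
    if "0 < e" for e q \<phi>
    using above[of "\<lambda>_. 0" "\<lambda>_. 0" r "r + 1" r "r + 1" e q \<phi>] zero that by auto
  have \<Gamma>D: "0 < snd a" "le_by P Q (snd a) (fst a) f" if "a \<in> \<Gamma>" for a
    using that by (auto simp: \<Gamma>_def intro: le_by_mono)
  have dir: "\<exists>c\<in>\<Gamma>. ball_order a c \<and> ball_order b c" if "a \<in> \<Gamma>" "b \<in> \<Gamma>" for a b
  proof -
    from that obtain c1 e1 s1 c2 e2 s2 where ab: "a = (canon_fun Q c1, e1)" "b = (canon_fun Q c2, e2)" "contQ c1" "contQ c2"
      "0 \<le> s1" "s1 < e1" "le_by P Q s1 (canon_fun Q c1) f" "0 \<le> s2" "s2 < e2" "le_by P Q s2 (canon_fun Q c2) f"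
      by (auto simp: \<Gamma>_def cont_ball_def)
    \<comment> \<open>A quarter of the smaller slack pays for the new error e and the new radius e
      with strict inequality.\<close>
    define e where "e = min (e1 - s1) (e2 - s2) / 4"
    have e: "0 < e" using ab by (simp add: e_def)
    obtain c where c: "(c, e) \<in> \<Gamma>" "le_by P Q (s1 + e) (canon_fun Q c1) c" "le_by P Q (s2 + e) (canon_fun Q c2) c"
      using above[of c1 c2 s1 "s1 + e" s2 "s2 + e" e] ab e by auto
    have "s1 + e + e < e1" "s2 + e + e < e2" using e by (auto simp: e_def min_def field_simps split: if_splits)
    then have "ball_order a (c, e)" "ball_order b (c, e)"
      unfolding ball_order_def ab using ab e c exI[of _ "s1 + e"] exI[of _ "s2 + e"] by auto
    then show ?thesis using c(1) by blast
  qed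
  have "\<exists>a\<in>\<Gamma>. snd a \<le> e" if "0 < e" for e using small[OF that] by force
  note net = formal_ball_net[OF \<Gamma>D(1) _ dir this]
  have net: "directed_index \<Gamma> ball_order" "cauchy_net (sup_dist P Q) \<Gamma> ball_order fst"
    using small[of 1] by (auto intro!: net)
  have "fst ` \<Gamma> \<subseteq> cont_ball r" by (auto simp: \<Gamma>_def)
  moreover have "pointwise_limit P Q (net_filter \<Gamma> ball_order) fst f"
    unfolding pointwise_limit_def
  proof (intro ballI tendstoI)
    fix q \<phi> and e :: real assume q: "q \<in> topspace Q" "\<phi> \<in> dual_ball P" and e: "0 < e"
    \<comment> \<open>The lower estimate starts from a ball close to f at q and \<phi> and loses at
      most e / 3 afterwards; the upper one holds for every ball in \<Gamma> up to its
      radius.\<close>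
    then obtain c where c: "(c, e / 3) \<in> \<Gamma>" "blinfun_apply (f q) \<phi> < blinfun_apply (c q) \<phi> + e / 3"
      using small[of "e / 3" q \<phi>] by auto
    show "\<forall>\<^sub>F a in net_filter \<Gamma> ball_order. dist (blinfun_apply (fst a q) \<phi>) (blinfun_apply (f q) \<phi>) < e"
      using eventually_net_above[OF net(1) c(1)]
    proof eventually_elim
      case (elim a)
      have "blinfun_apply (c q) \<phi> \<le> blinfun_apply (fst a q) \<phi> + e / 3" "snd a < e / 3"
        using ball_orderD[of "(c, e / 3)" a] elim \<Gamma>D(1)[of a] le_byD[OF _ q] by auto
      moreover have "blinfun_apply (fst a q) \<phi> \<le> blinfun_apply (f q) \<phi> + snd a"
        using \<Gamma>D(2)[of a] elim le_byD[OF _ q] by blast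
      ultimately show ?case using c(2) e by (simp add: dist_real_def abs_less_iff)
    qed
  qed
  ultimately show ?thesis by (intro that[OF net(1) _ net(2)])
qed

section \<open>Directed generating sets\<close>

lemma cont_funs_bounded: "cont_funs Q \<subseteq> (bounded_funs Q :: ('q \<Rightarrow> 'a bidual) set)"
  using canon_fun_bounded by (auto simp: cont_funs_eq)

text \<open>A net-free form of being a limit: Cauchy limits and dominating limits of continuous functions
  are both characterised by the existence of such a directed set.\<close>

definition generates :: "('q \<Rightarrow> 'a bidual) set \<Rightarrow> ('q \<Rightarrow> 'a bidual) \<Rightarrow> bool" where
  "generates I z \<longleftrightarrow> I \<subseteq> cont_funs Q \<and> I \<noteq> {} \<and> (\<forall>c\<in>I. le_by P Q 0 c z) \<and>
     (\<forall>c1\<in>I. \<forall>c2\<in>I. \<forall>r>0. \<exists>c\<in>I. le_by P Q r c1 c \<and> le_by P Q r c2 c) \<and>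
     (\<forall>e\<in>bounded_funs Q. sup_dist P Q z e \<le> (SUP c\<in>I. sup_dist P Q c e))"

lemma sup_dist_le_add:
  assumes "le_by P Q r f g" "0 \<le> r"
  shows "sup_dist P Q f h \<le> ennreal r + sup_dist P Q g h"
proof (cases "sup_dist P Q g h")
  case (real s)
  then have "le_by P Q s g h" using sup_dist_le_iff[of s P Q g h] by simp
  then have "sup_dist P Q f h \<le> ennreal (r + s)"
    using le_by_trans[OF assms(1)] assms(2) real by (subst sup_dist_le_iff) auto
  then show ?thesis using real assms(2) by simp
qed simp

text \<open>The terms y j need not belong to I: being below z and eventually above each member of I
  up to any error is enough. This admits nets that have been shifted or corrected to become
  increasing.\<close>

lemma generates_circ_limit:
  assumes I: "generates I z" and J: "directed_index J R"
    and below: "\<And>j. j \<in> J \<Longrightarrow> le_by P Q 0 (y j) z"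
    and cofinal: "\<And>c r. c \<in> I \<Longrightarrow> 0 < r \<Longrightarrow> eventually (\<lambda>j. le_by P Q r c (y j)) (net_filter J R)"
  shows "circ_limit (sup_dist P Q) (bounded_funs Q) J R y z"
  unfolding circ_limit_def le_Liminf_iff
proof (intro ballI conjI allI impI)
  fix e a assume e: "e \<in> bounded_funs Q" "a < sup_dist P Q z e"
  then have "a < (SUP c\<in>I. sup_dist P Q c e)" using I by (auto simp: generates_def intro: less_le_trans)
  then obtain c where c: "c \<in> I" "a < sup_dist P Q c e" by (auto simp: less_SUP_iff)
  obtain r q \<phi> where r: "a = ennreal r" "0 \<le> r" "q \<in> topspace Q" "\<phi> \<in> dual_ball P"
    "r < blinfun_apply (c q) \<phi> - blinfun_apply (e q) \<phi>" using c(2) by (rule less_sup_distD)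
  define \<eta> where "\<eta> = (blinfun_apply (c q) \<phi> - blinfun_apply (e q) \<phi> - r) / 2"
  have "0 < \<eta>" using r(5) by (simp add: \<eta>_def)
  from cofinal[OF c(1) this]
  show "\<forall>\<^sub>F \<delta> in net_filter J R. a < sup_dist P Q (y \<delta>) e"
  proof eventually_elim
    case (elim \<delta>)
    show ?case unfolding r(1)
      using le_byD[OF elim r(3,4)] r(5) by (intro less_sup_distI[OF r(3,4) _ r(2)]) (simp add: \<eta>_def field_simps)
  qed
next
  fix e a assume "a < sup_dist P Q e z"
  then obtain r q \<phi> where r: "a = ennreal r" "0 \<le> r" "q \<in> topspace Q" "\<phi> \<in> dual_ball P"
    "r < blinfun_apply (e q) \<phi> - blinfun_apply (z q) \<phi>" by (rule less_sup_distD)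
  show "\<forall>\<^sub>F \<delta> in net_filter J R. a < sup_dist P Q e (y \<delta>)"
    using eventually_net_filterD[OF J]
  proof eventually_elim
    case (elim \<delta>)
    show ?case unfolding r(1)
      using le_byD[OF below[OF elim] r(3,4)] r(5) by (intro less_sup_distI[OF r(3,4) _ r(2)]) simp
  qed
qed

text \<open>The set I collects the continuous functions that are eventually below the net up to
  every error. The Cauchy and the dominating case differ mainly in the proof of \<open>near\<close>,
  that members of I bound the late terms from above up to e.\<close>

lemma net_generates:
  assumes J: "directed_index J R" and sub: "x ` J \<subseteq> cont_funs Q"
    and lim: "circ_limit (sup_dist P Q) (bounded_funs Q) J R x z"
    and upper: "\<And>e. 0 < e \<Longrightarrow> eventually (\<lambda>\<delta>. le_by P Q e (x \<delta>) z) (net_filter J R)"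
    and I: "I = {c\<in>cont_funs Q. \<forall>e>0. eventually (\<lambda>\<delta>. le_by P Q e c (x \<delta>)) (net_filter J R)}"
    and near: "\<And>e. 0 < e \<Longrightarrow> eventually (\<lambda>\<delta>. \<exists>c\<in>I. le_by P Q e (x \<delta>) c) (net_filter J R)"
  shows "generates I z"
proof -
  let ?F = "net_filter J R"
  note F = net_filter_neq_bot[OF J]
  have ID: "eventually (\<lambda>\<delta>. le_by P Q e c (x \<delta>)) ?F" if "c \<in> I" "0 < e" for c e using that I by simp
  have "I \<noteq> {}" using eventually_happens'[OF F near[of 1]] by auto
  moreover have "le_by P Q 0 c z" if c: "c \<in> I" for c
  proof (rule le_by_limit)
    fix e :: real assume e: "0 < e"
    have "eventually (\<lambda>\<delta>. le_by P Q (e/2) c (x \<delta>) \<and> le_by P Q (e/2) (x \<delta>) z) ?F"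
      using e by (intro eventually_conj ID c upper) auto
    then obtain \<delta> where "le_by P Q (e/2) c (x \<delta>)" "le_by P Q (e/2) (x \<delta>) z" using eventually_happens'[OF F] by blast
    from le_by_trans[OF this] show "le_by P Q (0 + e) c z" by simp
  qed
  moreover have "\<exists>c\<in>I. le_by P Q r c1 c \<and> le_by P Q r c2 c" if c: "c1 \<in> I" "c2 \<in> I" "0 < r" for c1 c2 r
  proof -
    have "eventually (\<lambda>\<delta>. le_by P Q (r/2) c1 (x \<delta>) \<and> le_by P Q (r/2) c2 (x \<delta>) \<and> (\<exists>c\<in>I. le_by P Q (r/2) (x \<delta>) c)) ?F"
      using c by (intro eventually_conj ID near) auto
    then obtain \<delta> c where d: "le_by P Q (r/2) c1 (x \<delta>)" "le_by P Q (r/2) c2 (x \<delta>)" "c \<in> I" "le_by P Q (r/2) (x \<delta>) c"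
      using eventually_happens'[OF F] by blast
    from le_by_trans[OF d(1,4)] le_by_trans[OF d(2,4)] show ?thesis using d(3) by auto
  qed
  moreover have "sup_dist P Q z e \<le> (SUP c\<in>I. sup_dist P Q c e)" if e: "e \<in> bounded_funs Q" for e
  proof (rule ennreal_le_epsilon)
    fix r :: real assume r: "0 < r"
    have "sup_dist P Q z e \<le> Liminf ?F (\<lambda>\<delta>. sup_dist P Q (x \<delta>) e)"
      using lim e by (simp add: circ_limit_def)
    also have "\<dots> \<le> (SUP c\<in>I. sup_dist P Q c e) + ennreal r"
    proof (rule Liminf_le_eventually[OF F])
      show "\<forall>\<^sub>F \<delta> in ?F. sup_dist P Q (x \<delta>) e \<le> (SUP c\<in>I. sup_dist P Q c e) + ennreal r"
        using near[OF r]
      proof eventually_elim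
        case (elim \<delta>)
        then obtain c where c: "c \<in> I" "le_by P Q r (x \<delta>) c" by blast
        have "sup_dist P Q (x \<delta>) e \<le> ennreal r + sup_dist P Q c e"
          using c(2) r by (intro sup_dist_le_add) auto
        also have "\<dots> \<le> ennreal r + (SUP c\<in>I. sup_dist P Q c e)" using c(1) by (intro add_left_mono SUP_upper)
        finally show ?case by (simp add: add.commute)
      qed
    qed
    finally show "sup_dist P Q z e \<le> (SUP c\<in>I. sup_dist P Q c e) + ennreal r" .
  qed
  ultimately show ?thesis unfolding generates_def using I by auto
qed

text \<open>Every term of a dominating net lies in I, so \<open>near\<close> holds with the term
  itself.\<close>

lemma dominating_net_generates:
  assumes J: "directed_index J R" and sub: "x ` J \<subseteq> cont_funs Q" and dom: "dominating_net (sup_dist P Q) J R x"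
    and lim: "circ_limit (sup_dist P Q) (bounded_funs Q) J R x z"
  shows "\<exists>I. generates I z"
proof -
  define I where "I = {c\<in>cont_funs Q. \<forall>e>0. eventually (\<lambda>\<delta>. le_by P Q e c (x \<delta>)) (net_filter J R)}"
  have xI: "x \<gamma> \<in> I" if "\<gamma> \<in> J" for \<gamma>
    using that sub dominating_netD[OF dom that] by (auto simp: I_def)
  have "generates I z"
  proof (rule net_generates[OF J sub lim _ I_def])
    fix e :: real assume e: "0 < e"
    show "\<forall>\<^sub>F \<delta> in net_filter J R. le_by P Q e (x \<delta>) z"
      using eventually_net_filterD[OF J]
    proof eventually_elim
      case (elim \<delta>)
      show ?case
        using e elim sub cont_funs_bounded by (intro circ_limit_upper_at[OF J lim] dominating_netD[OF dom]) auto
    qed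
    show "\<forall>\<^sub>F \<delta> in net_filter J R. \<exists>c\<in>I. le_by P Q e (x \<delta>) c"
      using eventually_net_filterD[OF J]
    proof eventually_elim
      case (elim \<delta>)
      show ?case using xI[OF elim] e by (intro bexI[of _ "x \<delta>"] le_by_refl) auto
    qed
  qed
  then show ?thesis ..
qed

text \<open>To approximate \<open>x \<gamma>\<close> from \<open>I\<close>, extract from the net a rapidly Cauchy sequence starting at \<open>\<gamma>\<close> and
  take the first term of the corrected increasing sequence.\<close>

lemma cauchy_net_generates:
  assumes J: "directed_index J R" and sub: "x ` J \<subseteq> cont_funs Q" and cau: "cauchy_net (sup_dist P Q) J R x"
    and lim: "circ_limit (sup_dist P Q) (bounded_funs Q) J R x z"
  shows "\<exists>I. generates I z"
proof -
  let ?F = "net_filter J R"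
  note F = net_filter_neq_bot[OF J]
  note along = cauchy_net_along[OF J cau]
  define I where "I = {c\<in>cont_funs Q. \<forall>e>0. eventually (\<lambda>\<delta>. le_by P Q e c (x \<delta>)) ?F}"
  have "generates I z"
  proof (rule net_generates[OF J sub lim _ I_def])
    fix e :: real assume e: "0 < e"
    show "\<forall>\<^sub>F \<delta> in ?F. le_by P Q e (x \<delta>) z"
      using circ_limit_upper[OF J along _ lim e] sub cont_funs_bounded by blast
    \<comment> \<open>Half of e / 2 ^ Suc n, because \<open>increasing_correction\<close> asks for a
      strict inequality and \<open>le_by\<close> gives a weak one.\<close>
    define d where "d n = e / 2 ^ (n + 2)" for n :: nat
    have d: "0 < d n" "d n < e / 2 ^ Suc n" for n using e by (simp_all add: d_def field_simps)
    define good where "good n \<gamma> \<longleftrightarrow> \<gamma> \<in> J \<and> eventually (\<lambda>\<delta>. le_by P Q (d n) (x \<gamma>) (x \<delta>)) ?F" for n \<gamma>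
    have good: "eventually (good n) ?F" for n
      unfolding good_def using along d(1)[of n]
      by (intro eventually_conj eventually_net_filterD[OF J]) (simp add: cauchy_along_def)
    show "\<forall>\<^sub>F \<delta> in ?F. \<exists>c\<in>I. le_by P Q e (x \<delta>) c"
      using good[of 0]
    proof eventually_elim
      case (elim \<gamma>0)
      \<comment> \<open>The clause for n = 0 makes the sequence start at the given index
        \<gamma>0.\<close>
      have "\<exists>g. \<forall>n. (good n (g n) \<and> (n = 0 \<longrightarrow> g n = \<gamma>0)) \<and> le_by P Q (d n) (x (g n)) (x (g (Suc n)))"
      proof (rule dependent_nat_choice)
        show "\<exists>\<gamma>. good 0 \<gamma> \<and> (0 = 0 \<longrightarrow> \<gamma> = \<gamma>0)" using elim by blast
        fix \<gamma> n assume "good n \<gamma> \<and> (n = 0 \<longrightarrow> \<gamma> = \<gamma>0)"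
        then have "eventually (\<lambda>\<delta>. le_by P Q (d n) (x \<gamma>) (x \<delta>)) ?F" by (simp add: good_def)
        with good[of "Suc n"] have "eventually (\<lambda>\<delta>. good (Suc n) \<delta> \<and> le_by P Q (d n) (x \<gamma>) (x \<delta>)) ?F"
          by (rule eventually_conj)
        then show "\<exists>\<delta>. (good (Suc n) \<delta> \<and> (Suc n = 0 \<longrightarrow> \<delta> = \<gamma>0)) \<and> le_by P Q (d n) (x \<gamma>) (x \<delta>)"
          using eventually_happens'[OF F] by blast
      qed
      then obtain g where g: "\<And>n. good n (g n)" "g 0 = \<gamma>0" "\<And>n. le_by P Q (d n) (x (g n)) (x (g (Suc n)))" by blast
      have "\<exists>w. contQ w \<and> x (g n) = canon_fun Q w" for n
        using g(1)[of n] sub by (auto simp: good_def cont_funs_eq)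
      then obtain w where w: "\<And>n. contQ (w n)" "\<And>n. x (g n) = canon_fun Q (w n)" by metis
      have "pos_norm P (canon (w n q) - canon (w (Suc n) q)) < e / 2 ^ Suc n" if "q \<in> topspace Q" for n q
        using g(3)[of n] d(2)[of n] that by (force simp: le_by_iff w(2))
      note less = this
      obtain y where y: "\<And>n. contQ (y n)" "\<And>n q. q \<in> topspace Q \<Longrightarrow> norm (w n q - y n q) \<le> e / 2 ^ n"
        "\<And>m n. m \<le> n \<Longrightarrow> le_by P Q 0 (canon_fun Q (y m)) (canon_fun Q (y n))"
        by (rule increasing_correction[of w e]) (use w(1) e less in auto)
      have yw: "le_by P Q (e / 2 ^ n) (canon_fun Q (y n)) (x (g n))" "le_by P Q (e / 2 ^ n) (x (g n)) (canon_fun Q (y n))" for n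
        unfolding w(2) using y(2)[of _ n]
        by (auto intro!: le_by_norm simp: norm_canon norm_minus_commute simp flip: canon_diff)
      have "canon_fun Q (y 0) \<in> I"
        unfolding I_def
      proof (intro CollectI conjI allI impI)
        show "canon_fun Q (y 0) \<in> cont_funs Q" using y(1) by (auto simp: cont_funs_eq)
        fix r :: real assume r: "0 < r"
        have "(\<lambda>n. (2 * e) / 2 ^ n) \<longlonglongrightarrow> 0" by (rule LIMSEQ_divide_realpow_zero) simp
        from eventually_happens'[OF sequentially_bot order_tendstoD(2)[OF this r]]
        obtain n where n: "(2 * e) / 2 ^ n < r" ..
        have "d n \<le> e / 2 ^ n" using e by (simp add: d_def field_simps)
        \<comment> \<open>The three errors: from y 0 to y n, from y n to the n-th chosen term, and
          from that term to late terms of the net.\<close>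
        then have *: "0 + e / 2 ^ n + d n \<le> r" using n by (simp add: field_simps)
        have "eventually (\<lambda>\<delta>. le_by P Q (d n) (x (g n)) (x \<delta>)) ?F" using g(1)[of n] by (simp add: good_def)
        then show "\<forall>\<^sub>F \<delta> in ?F. le_by P Q r (canon_fun Q (y 0)) (x \<delta>)"
          by eventually_elim (rule le_by_mono[OF le_by_trans[OF le_by_trans[OF y(3)[of 0 n] yw(1)]] *], simp)
      qed
      moreover have "le_by P Q e (x \<gamma>0) (canon_fun Q (y 0))" using yw(2)[of 0] g(2) by simp
      ultimately show ?case by blast
    qed
  qed
  then show ?thesis ..
qed

text \<open>Pairing I with all positive radii gives one net that is both Cauchy and dominating; this
  is what identifies the two kinds of limits.\<close>

lemma generates_net:
  assumes I: "generates I z"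
  obtains \<Gamma> :: "(('q \<Rightarrow> 'a bidual) \<times> real) set"
  where "directed_index \<Gamma> ball_order" "fst ` \<Gamma> \<subseteq> I" "cauchy_net (sup_dist P Q) \<Gamma> ball_order fst"
    "dominating_net (sup_dist P Q) \<Gamma> ball_order fst"
    "circ_limit (sup_dist P Q) (bounded_funs Q) \<Gamma> ball_order fst z"
proof -
  define \<Gamma> where "\<Gamma> = I \<times> {0::real<..}"
  have dirI: "\<exists>c\<in>I. le_by P Q r c1 c \<and> le_by P Q r c2 c" if "c1 \<in> I" "c2 \<in> I" "0 < r" for c1 c2 r
    using I that by (simp add: generates_def)
  have dir: "\<exists>c\<in>\<Gamma>. ball_order a c \<and> ball_order b c" if "a \<in> \<Gamma>" "b \<in> \<Gamma>" for a b
  proof -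
    from that obtain c1 e1 c2 e2 where ab: "a = (c1, e1)" "b = (c2, e2)" "c1 \<in> I" "c2 \<in> I" "0 < e1" "0 < e2"
      by (auto simp: \<Gamma>_def)
    define r where "r = min e1 e2 / 3"
    have r: "0 < r" "r + r < e1" "r + r < e2" using ab by (auto simp: r_def min_def)
    obtain c where c: "c \<in> I" "le_by P Q r c1 c" "le_by P Q r c2 c" using dirI[OF ab(3,4) r(1)] by blast
    have "ball_order a (c, r)" "ball_order b (c, r)"
      unfolding ball_order_def ab using r c exI[of _ r] by auto
    then show "\<exists>c\<in>\<Gamma>. ball_order a c \<and> ball_order b c" using c(1) r(1) by (auto simp: \<Gamma>_def)
  qed
  obtain c0 where c0: "c0 \<in> I" using I by (auto simp: generates_def)
  have small: "\<exists>a\<in>\<Gamma>. snd a \<le> e" if "0 < e" for e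
    using c0 that by (intro bexI[of _ "(c0, e)"]) (auto simp: \<Gamma>_def)
  have "\<Gamma> \<noteq> {}" using small[of 1] by auto
  note net = formal_ball_net[OF _ this dir small]
  have net: "directed_index \<Gamma> ball_order" "cauchy_net (sup_dist P Q) \<Gamma> ball_order fst"
    by (rule net; auto simp: \<Gamma>_def)+
  have ev: "eventually (\<lambda>a. le_by P Q r c (fst a)) (net_filter \<Gamma> ball_order)" if "c \<in> I" "0 < r" for c r
  proof -
    have "(c, r) \<in> \<Gamma>" using that by (simp add: \<Gamma>_def)
    from eventually_net_above[OF net(1) this] show ?thesis
      by eventually_elim (auto simp: \<Gamma>_def dest!: ball_orderD)
  qed
  have "dominating_net (sup_dist P Q) \<Gamma> ball_order fst"
    unfolding dominating_net_def using ev by (intro ballI sup_dist_tendsto) (auto simp: \<Gamma>_def)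
  moreover have "circ_limit (sup_dist P Q) (bounded_funs Q) \<Gamma> ball_order fst z"
    using I ev net by (intro generates_circ_limit[OF I]) (auto simp: \<Gamma>_def generates_def)
  ultimately show ?thesis using net by (intro that[of \<Gamma>]) (auto simp: \<Gamma>_def)
qed

lemma cauchy_limits_iff:
  "z \<in> cauchy_limits (sup_dist P Q) (bounded_funs Q) (cont_funs Q) \<longleftrightarrow> z \<in> bounded_funs Q \<and> (\<exists>I. generates I z)"
proof
  assume "z \<in> cauchy_limits (sup_dist P Q) (bounded_funs Q) (cont_funs Q)"
  then show "z \<in> bounded_funs Q \<and> (\<exists>I. generates I z)"
    unfolding cauchy_limits_def using cauchy_net_generates by blast
next
  assume z: "z \<in> bounded_funs Q \<and> (\<exists>I. generates I z)"
  then obtain I where I: "generates I z" by blast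
  obtain \<Gamma> :: "(('q \<Rightarrow> 'a bidual) \<times> real) set" where \<Gamma>: "directed_index \<Gamma> ball_order" "fst ` \<Gamma> \<subseteq> I"
    "cauchy_net (sup_dist P Q) \<Gamma> ball_order fst"
    "circ_limit (sup_dist P Q) (bounded_funs Q) \<Gamma> ball_order fst z" by (rule generates_net[OF I])
  have "fst ` \<Gamma> \<subseteq> cont_funs Q" using \<Gamma>(2) I by (auto simp: generates_def)
  then show "z \<in> cauchy_limits (sup_dist P Q) (bounded_funs Q) (cont_funs Q)"
    using \<Gamma> z by (intro cauchy_limits_any) auto
qed

lemma dominating_limits_iff:
  "z \<in> dominating_limits (sup_dist P Q) (bounded_funs Q) (cont_funs Q) \<longleftrightarrow> z \<in> bounded_funs Q \<and> (\<exists>I. generates I z)"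
proof
  assume "z \<in> dominating_limits (sup_dist P Q) (bounded_funs Q) (cont_funs Q)"
  then show "z \<in> bounded_funs Q \<and> (\<exists>I. generates I z)"
    unfolding dominating_limits_def using dominating_net_generates by blast
next
  assume z: "z \<in> bounded_funs Q \<and> (\<exists>I. generates I z)"
  then obtain I where I: "generates I z" by blast
  obtain \<Gamma> :: "(('q \<Rightarrow> 'a bidual) \<times> real) set" where \<Gamma>: "directed_index \<Gamma> ball_order" "fst ` \<Gamma> \<subseteq> I"
    "dominating_net (sup_dist P Q) \<Gamma> ball_order fst"
    "circ_limit (sup_dist P Q) (bounded_funs Q) \<Gamma> ball_order fst z" by (rule generates_net[OF I])
  have "fst ` \<Gamma> \<subseteq> cont_funs Q" using \<Gamma>(2) I by (auto simp: generates_def)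
  then show "z \<in> dominating_limits (sup_dist P Q) (bounded_funs Q) (cont_funs Q)"
    using \<Gamma> z by (intro dominating_limits_any) auto
qed

section \<open>Increasing nets and increasing sequences\<close>

lemma increasing_subset_cauchy_limits:
  "increasing_limits (sup_dist P Q) Z Y \<subseteq> cauchy_limits (sup_dist P Q) Z Y"
proof
  fix z assume "z \<in> increasing_limits (sup_dist P Q) Z Y"
  then obtain I :: "('q \<Rightarrow> 'a bidual) net_index set" and R x where x: "directed_index I R" "x ` I \<subseteq> Y"
    "increasing_net (sup_dist P Q) I R x" "circ_limit (sup_dist P Q) Z I R x z" "z \<in> Z"
    unfolding increasing_limits_def by blast
  from cauchy_limits_any[OF x(1,2) increasing_net_cauchy[OF x(1,3)] x(4,5)]
  show "z \<in> cauchy_limits (sup_dist P Q) Z Y" .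
qed

lemma increasing_seq_subset_cauchy_limits:
  "increasing_seq_limits (sup_dist P Q) Z Y \<subseteq> cauchy_limits (sup_dist P Q) Z Y"
proof
  fix z assume "z \<in> increasing_seq_limits (sup_dist P Q) Z Y"
  then obtain x :: "nat \<Rightarrow> _" where x: "range x \<subseteq> Y" "increasing_net (sup_dist P Q) UNIV (<) x"
    "circ_limit (sup_dist P Q) Z UNIV (<) x z" "z \<in> Z" by (auto simp: increasing_seq_limits_def)
  from cauchy_limits_any[OF directed_index_nat x(1) increasing_net_cauchy[OF directed_index_nat x(2)] x(3,4)]
  show "z \<in> cauchy_limits (sup_dist P Q) Z Y" .
qed

text \<open>A multiple of an upper bound of the unit ball absorbs the errors in a generating set.\<close>

lemma generates_increasing_limit:
  assumes bdd: "unit_ball_bounded P" and I: "generates I z" and z: "z \<in> bounded_funs Q"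
  shows "z \<in> increasing_limits (sup_dist P Q) (bounded_funs Q) (cont_funs Q)"
proof -
  obtain u where u: "\<And>y. norm y \<le> 1 \<Longrightarrow> y - u \<in> P"
    using bdd unfolding unit_ball_bounded_def cone_le_def by (metis mem_cball_0)
  have u1: "norm \<phi> \<le> - blinfun_apply \<phi> u" if \<phi>: "\<phi> \<in> dual_ball P" for \<phi>
  proof -
    have "blinfun_apply \<phi> u \<le> blinfun_apply \<phi> y" if "norm y \<le> 1" for y
      using dual_ball_nonneg[OF \<phi> u[OF that]] by (simp add: blinfun.diff_right)
    from norm_le_neg_bound[of 1, OF this] show ?thesis by simp
  qed
  \<comment> \<open>The element u lies below the unit ball, so adding r u moves c down at each
    \<phi> by at least r times the norm of \<phi>.\<close>
  define sh where "sh r c = restrict (\<lambda>q. c q + r *\<^sub>R canon u) (topspace Q)" for r c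
  have sh: "blinfun_apply (sh r c q) \<phi> = blinfun_apply (c q) \<phi> + r * blinfun_apply \<phi> u" if "q \<in> topspace Q" for r c q \<phi>
    using that by (simp add: sh_def blinfun.add_left blinfun.scaleR_left)
  have shC: "sh r c \<in> cont_funs Q" if "c \<in> I" for r c
  proof -
    obtain g where g: "contQ g" "c = canon_fun Q g" using I \<open>c \<in> I\<close> by (auto simp: generates_def cont_funs_eq)
    have "sh r c = canon_fun Q (\<lambda>q. g q + r *\<^sub>R u)"
      unfolding sh_def canon_fun_def g(2) by (auto simp: canon_add canon_scaleR)
    moreover have "contQ (\<lambda>q. g q + r *\<^sub>R u)" using g(1) by (intro continuous_intros) auto
    ultimately show ?thesis by (auto simp: cont_funs_eq)
  qed
  define J where "J = {(c, r). c \<in> I \<and> 0 < (r::real)}"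
  define y where "y = (\<lambda>(c, r). sh r c)"
  define R where "R a b \<longleftrightarrow> le_by P Q 0 (y a) (y b) \<and> snd b \<le> snd a" for a b
  \<comment> \<open>Of a shift by s \<ge> 2 r one r absorbs the error, and what is left is still a
    shift by at least r.\<close>
  have above: "\<exists>c\<in>I. \<forall>i\<in>{(c1, r1), (c2, r2)}. R i (c, r)"
    if c: "c1 \<in> I" "c2 \<in> I" "0 < r" "2 * r \<le> r1" "2 * r \<le> r2" for c1 c2 r r1 r2
  proof -
    obtain c where c': "c \<in> I" "le_by P Q r c1 c" "le_by P Q r c2 c" using I c unfolding generates_def by blast
    have "R (b, s) (c, r)" if b: "le_by P Q r b c" "2 * r \<le> s" for b s
      unfolding R_def y_def le_by_def prod.case
    proof (intro conjI ballI)
      fix q \<phi> assume q: "q \<in> topspace Q" "\<phi> \<in> dual_ball P"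
      \<comment> \<open>Evaluating at the normalised functional sharpens the error r to r times the
        norm of \<phi>. An error that does not shrink with \<phi> could not be absorbed by the
        shift.\<close>
      obtain \<psi> where \<psi>: "\<psi> \<in> dual_ball P" "\<phi> = norm \<phi> *\<^sub>R \<psi>"
        using dual_cone_scaled[of \<phi> P] q(2) by (auto simp: dual_ball_def)
      have "norm \<phi> * blinfun_apply (b q) \<psi> \<le> norm \<phi> * (blinfun_apply (c q) \<psi> + r)"
        using le_byD[OF b(1) q(1) \<psi>(1)] by (intro mult_left_mono) auto
      moreover have "blinfun_apply a \<phi> = norm \<phi> * blinfun_apply a \<psi>" for a :: "'a bidual"
        by (subst \<psi>(2)) (simp only: blinfun.scaleR_right real_scaleR_def)
      ultimately have "blinfun_apply (b q) \<phi> \<le> blinfun_apply (c q) \<phi> + r * norm \<phi>" by (simp add: algebra_simps)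
      moreover have "r * norm \<phi> \<le> r * - blinfun_apply \<phi> u" using u1[OF q(2)] c(3) by (intro mult_left_mono) auto
      moreover have "0 \<le> (s - 2 * r) * - blinfun_apply \<phi> u"
        using u1[OF q(2)] norm_ge_zero[of \<phi>] b(2) by (intro mult_nonneg_nonneg) linarith+
      ultimately show "blinfun_apply (sh s b q) \<phi> \<le> blinfun_apply (sh r c q) \<phi> + 0"
        unfolding sh[OF q(1)] by (simp add: algebra_simps)
    qed (use b(2) c(3) in simp)
    then show ?thesis using c' c(4,5) by blast
  qed
  have J: "directed_index J R"
    unfolding directed_index_def
  proof (intro conjI ballI)
    show "J \<noteq> {}" using I by (auto simp: J_def generates_def intro: exI[of _ 1])
    show "transp_on J R" unfolding R_def by (rule transp_onI) (use le_by_trans[of P Q 0 _ _ 0] in force)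
    fix a b assume "a \<in> J" "b \<in> J"
    then obtain c1 r1 c2 r2 where ab: "a = (c1, r1)" "b = (c2, r2)" "c1 \<in> I" "c2 \<in> I" "0 < r1" "0 < r2"
      by (auto simp: J_def)
    define r where "r = min r1 r2 / 2"
    have r: "0 < r" "2 * r \<le> r1" "2 * r \<le> r2" using ab by (auto simp: r_def)
    then obtain c where "c \<in> I" "R a (c, r)" "R b (c, r)"
      using above[OF ab(3,4) r] by (auto simp: ab)
    then show "\<exists>k\<in>J. R a k \<and> R b k" using r(1) by (intro bexI[of _ "(c, r)"]) (auto simp: J_def)
  qed
  have "circ_limit (sup_dist P Q) (bounded_funs Q) J R y z"
  proof (rule generates_circ_limit[OF I J])
    fix j assume "j \<in> J"
    then obtain c r where j: "j = (c, r)" "c \<in> I" "0 < r" by (auto simp: J_def)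
    show "le_by P Q 0 (y j) z" unfolding le_by_def
    proof (intro ballI)
      fix q \<phi> assume q: "q \<in> topspace Q" "\<phi> \<in> dual_ball P"
      have "le_by P Q 0 c z" using I j by (simp add: generates_def)
      moreover have "r * blinfun_apply \<phi> u \<le> 0"
        using j(3) u1[OF q(2)] norm_ge_zero[of \<phi>] by (intro mult_nonneg_nonpos) linarith+
      ultimately show "blinfun_apply (y j q) \<phi> \<le> blinfun_apply (z q) \<phi> + 0"
        using le_byD[OF _ q, of 0 c z] by (simp add: y_def j sh[OF q(1)])
    qed
  next
    fix c and e :: real assume c: "c \<in> I" "0 < e"
    define r where "r = e / (norm u + 1)"
    have r: "0 < r" "r * norm u \<le> e" using c(2) by (auto simp: r_def field_simps add_pos_nonneg)
    have le: "le_by P Q e c (sh r c)"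
      unfolding le_by_def
    proof (intro ballI)
      fix q \<phi> assume q: "q \<in> topspace Q" "\<phi> \<in> dual_ball P"
      have "- blinfun_apply \<phi> u \<le> norm u"
        using norm_blinfun[of \<phi> u] mult_right_mono[OF dual_ball_norm[OF q(2)], of "norm u"] by simp
      then have "r * - blinfun_apply \<phi> u \<le> r * norm u" using r(1) by (intro mult_left_mono) auto
      then show "blinfun_apply (c q) \<phi> \<le> blinfun_apply (sh r c q) \<phi> + e"
        unfolding sh[OF q(1)] using r(2) by simp
    qed
    have "(c, r) \<in> J" using c r by (simp add: J_def)
    from eventually_net_above[OF J this] show "\<forall>\<^sub>F j in net_filter J R. le_by P Q e c (y j)"
    proof eventually_elim
      case (elim j)
      then have "le_by P Q 0 (sh r c) (y j)" by (simp add: R_def y_def)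
      from le_by_trans[OF le this] show ?case by simp
    qed
  qed
  moreover have "increasing_net (sup_dist P Q) J R y"
    by (simp add: increasing_net_def sup_dist_zero_iff R_def)
  moreover have "y ` J \<subseteq> cont_funs Q" using shC by (auto simp: J_def y_def)
  ultimately show ?thesis using J z by (intro increasing_limits_any)
qed

text \<open>The sets of continuous functions that take, up to \<open>1 / n\<close>, prescribed values on the members of
  a finite cover by basic open sets show that every set of continuous functions is separable.\<close>

lemma continuous_separable:
  assumes sc: "second_countable Q" "second_countable (euclidean :: 'a topology)" and I: "I \<subseteq> cont_funs Q"
  obtains D where "countable D" "D \<subseteq> I" "\<And>c e. c \<in> I \<Longrightarrow> 0 < e \<Longrightarrow> \<exists>c'\<in>D. le_by P Q e c c'"
proof -
  obtain \<B> where \<B>: "countable \<B>" "\<And>V. V \<in> \<B> \<Longrightarrow> openin Q V"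
    "\<And>U q. openin Q U \<Longrightarrow> q \<in> U \<Longrightarrow> \<exists>V\<in>\<B>. q \<in> V \<and> V \<subseteq> U"
    using sc(1) unfolding second_countable_def by metis
  obtain \<A> :: "'a set set" where \<A>: "countable \<A>" "\<And>U x. open U \<Longrightarrow> x \<in> U \<Longrightarrow> \<exists>V\<in>\<A>. x \<in> V \<and> V \<subseteq> U"
    using sc(2) unfolding second_countable_def by (metis open_openin)
  define D0 :: "'a set" where "D0 = (\<lambda>V. SOME x. x \<in> V) ` \<A>"
  have D0: "countable D0" using \<A>(1) by (simp add: D0_def)
  have dense: "\<exists>y\<in>D0. norm (x - y) < e" if e: "0 < e" for x and e :: real
  proof -
    obtain V where V: "V \<in> \<A>" "x \<in> V" "V \<subseteq> ball x e" using \<A>(2)[OF open_ball, of x x e] e by auto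
    have "(SOME x. x \<in> V) \<in> V" using V(2) by (rule someI)
    then show ?thesis using V by (intro bexI[of _ "SOME x. x \<in> V"]) (auto simp: D0_def dist_norm)
  qed
  define W where "W = (\<lambda>(F, n). {c\<in>I. topspace Q \<subseteq> \<Union>(fst ` F) \<and>
    (\<forall>(V, y)\<in>F. \<forall>q\<in>V. norm (c q - canon y) < 1 / real (Suc n))})"
  define \<W> where "\<W> = W ` ({F. finite F \<and> F \<subseteq> \<B> \<times> D0} \<times> UNIV) - {{}}"
  have "countable \<W>" unfolding \<W>_def using \<B>(1) D0
    by (intro countable_Diff countable_image countable_SIGMA countable_Collect_finite_subset) auto
  \<comment> \<open>Two members of the same \<open>W (F, n)\<close> are within 2 / Suc n of each
    other, so one representative of each nonempty set suffices.\<close>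
  define D where "D = (\<lambda>w. SOME c. c \<in> w) ` \<W>"
  have some: "(SOME c. c \<in> w) \<in> w" if "w \<in> \<W>" for w using that by (auto simp: \<W>_def some_in_eq)
  show ?thesis
  proof (rule that[of D])
    show "countable D" using \<open>countable \<W>\<close> by (simp add: D_def)
    have "w \<subseteq> I" if "w \<in> \<W>" for w using that by (auto simp: \<W>_def W_def)
    then show "D \<subseteq> I" using some by (auto simp: D_def)
    fix c and e :: real assume c: "c \<in> I" and e: "0 < e"
    obtain g where g: "contQ g" "c = canon_fun Q g" using c I by (auto simp: cont_funs_eq)
    obtain n where n: "1 / real (Suc n) < e / 2" by (rule nat_approx_posE[of "e / 2"]) (use e in auto)
    have "\<exists>V y. V \<in> \<B> \<and> y \<in> D0 \<and> q \<in> V \<and> (\<forall>p\<in>V. norm (g p - y) < 1 / real (Suc n))" if q: "q \<in> topspace Q" for q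
    proof -
      obtain y where y: "y \<in> D0" "norm (g q - y) < 1 / real (Suc n)" using dense[of "1 / real (Suc n)" "g q"] by (auto simp del: of_nat_Suc)
      moreover obtain V where "V \<in> \<B>" "q \<in> V" "V \<subseteq> {p\<in>topspace Q. norm (g p - y) < 1 / real (Suc n)}"
        using \<B>(3)[OF openin_norm_less[OF g(1), of y "1 / real (Suc n)"], of q] q y by blast
      ultimately show ?thesis by blast
    qed
    then obtain V y where Vy: "\<And>q. q \<in> topspace Q \<Longrightarrow> V q \<in> \<B>" "\<And>q. q \<in> topspace Q \<Longrightarrow> y q \<in> D0"
      "\<And>q. q \<in> topspace Q \<Longrightarrow> q \<in> V q" "\<And>q p. q \<in> topspace Q \<Longrightarrow> p \<in> V q \<Longrightarrow> norm (g p - y q) < 1 / real (Suc n)"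
      by metis
    have "\<exists>\<F>. finite \<F> \<and> \<F> \<subseteq> V ` topspace Q \<and> topspace Q \<subseteq> \<Union>\<F>"
      using compact unfolding compact_space_def by (rule compactinD) (use Vy \<B>(2) in auto)
    then obtain G where G: "G \<subseteq> topspace Q" "finite G" "topspace Q \<subseteq> \<Union>(V ` G)" by (metis finite_subset_image)
    define F where "F = (\<lambda>q. (V q, y q)) ` G"
    have VQ: "V q \<subseteq> topspace Q" if "q \<in> G" for q using \<B>(2) Vy(1) G(1) that openin_subset by blast
    have "c \<in> W (F, n)"
    proof -
      have "topspace Q \<subseteq> \<Union>(fst ` F)" using G(3) by (auto simp: F_def image_image)
      moreover have "norm (c p - canon (y q)) < 1 / real (Suc n)" if "q \<in> G" "p \<in> V q" for p q
        using Vy(4)[of q p] that G(1) subsetD[OF VQ[OF that(1)] that(2)] norm_canon[of "g p - y q"] by (auto simp: g(2) canon_diff)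
      ultimately show ?thesis using c by (auto simp: W_def F_def)
    qed
    moreover have "finite F \<and> F \<subseteq> \<B> \<times> D0" using G(1,2) Vy by (auto simp: F_def)
    ultimately have w: "W (F, n) \<in> \<W>" by (auto simp: \<W>_def)
    define c' where "c' = (SOME c. c \<in> W (F, n))"
    have c': "c' \<in> W (F, n)" using some[OF w] by (simp add: c'_def)
    have "norm (c q - c' q) \<le> e" if q: "q \<in> topspace Q" for q
    proof -
      obtain V0 y0 where F0: "(V0, y0) \<in> F" "q \<in> V0" using c' q by (auto simp: W_def)
      have "norm (c q - canon y0) < 1 / real (Suc n)" "norm (c' q - canon y0) < 1 / real (Suc n)"
        using c' \<open>c \<in> W (F, n)\<close> F0 by (auto simp: W_def)
      then show ?thesis using n norm_triangle_ineq4[of "c q - canon y0" "c' q - canon y0"] by simp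
    qed
    then show "\<exists>c'\<in>D. le_by P Q e c c'"
      using w by (intro bexI[of _ c'] le_by_norm) (auto simp: D_def c'_def)
  qed
qed

text \<open>Directedness of I is applied along an enumeration of a countable dense subset: v n is in
  I, lies above the first n members of the enumeration up to d n, and is almost below v (Suc n).
  \<open>increasing_correction\<close> removes the last error.\<close>

lemma generates_increasing_seq_limit:
  assumes sc: "second_countable Q" "second_countable (euclidean :: 'a topology)"
    and I: "generates I z" and z: "z \<in> bounded_funs Q"
  shows "z \<in> increasing_seq_limits (sup_dist P Q) (bounded_funs Q) (cont_funs Q)"
proof -
  have IC: "I \<subseteq> cont_funs Q" and ne: "I \<noteq> {}" using I by (auto simp: generates_def)
  obtain D where D: "countable D" "D \<subseteq> I" "\<And>c e. c \<in> I \<Longrightarrow> 0 < e \<Longrightarrow> \<exists>c'\<in>D. le_by P Q e c c'"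
    using continuous_separable[OF sc IC] by metis
  have "D \<noteq> {}" using D(3)[of _ 1] ne by auto
  define a where "a = from_nat_into D"
  have a: "range a = D" using D(1) \<open>D \<noteq> {}\<close> by (simp add: a_def range_from_nat_into)
  have aI: "a n \<in> I" for n using a D(2) by blast
  define d :: "nat \<Rightarrow> real" where "d n = 1 / 2 ^ (n + 2)" for n
  have d: "0 < d n" "d n < 1 / 2 ^ Suc n" for n by (simp_all add: d_def field_simps)
  have dirI: "\<exists>c\<in>I. le_by P Q r c1 c \<and> le_by P Q r c2 c" if "c1 \<in> I" "c2 \<in> I" "0 < r" for c1 c2 r
    using I that by (simp add: generates_def)
  have up: "\<exists>c\<in>I. le_by P Q r c0 c \<and> (\<forall>k<m. le_by P Q r (a k) c)" if "c0 \<in> I" "0 < r" for c0 r and m :: nat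
    using that(2)
  proof (induction m arbitrary: r)
    case 0
    then show ?case using that(1) by (auto intro!: bexI[of _ c0] le_by_refl)
  next
    case (Suc m)
    then obtain c1 where c1: "c1 \<in> I" "le_by P Q (r/2) c0 c1" "\<forall>k<m. le_by P Q (r/2) (a k) c1" using Suc.IH[of "r/2"] by (meson half_gt_zero)
    obtain c where c: "c \<in> I" "le_by P Q (r/2) c1 c" "le_by P Q (r/2) (a m) c" using dirI[OF c1(1) aI, of "r/2" m] Suc.prems by auto
    have *: "le_by P Q r b c" if "le_by P Q (r/2) b c1" for b using le_by_trans[OF that c(2)] by simp
    have "le_by P Q r (a m) c" using c(3) by (rule le_by_mono) (use Suc.prems in simp)
    then show ?case using c(1) * c1 by (auto simp: less_Suc_eq intro!: bexI[of _ c])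
  qed
  have "\<exists>v. \<forall>n. (v n \<in> I \<and> (\<forall>k<n. le_by P Q (d n) (a k) (v n))) \<and> le_by P Q (d n) (v n) (v (Suc n))"
  proof (rule dependent_nat_choice)
    show "\<exists>v. v \<in> I \<and> (\<forall>k<0. le_by P Q (d 0) (a k) v)" using ne by auto
    fix c n assume "c \<in> I \<and> (\<forall>k<n. le_by P Q (d n) (a k) c)"
    then obtain c' where c': "c' \<in> I" "le_by P Q (d (Suc n)) c c'" "\<forall>k<Suc n. le_by P Q (d (Suc n)) (a k) c'"
      using up[of c "d (Suc n)" "Suc n"] d(1) by auto
    have "le_by P Q (d n) c c'" using c'(2) by (rule le_by_mono) (simp add: d_def field_simps)
    then show "\<exists>c'. (c' \<in> I \<and> (\<forall>k<Suc n. le_by P Q (d (Suc n)) (a k) c')) \<and> le_by P Q (d n) c c'" using c' by blast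
  qed
  then obtain v where v: "\<And>n. v n \<in> I" "\<And>n k. k < n \<Longrightarrow> le_by P Q (d n) (a k) (v n)"
    "\<And>n. le_by P Q (d n) (v n) (v (Suc n))" by blast
  have "\<exists>w. contQ w \<and> v n = canon_fun Q w" for n using v(1)[of n] IC by (auto simp: cont_funs_eq)
  then obtain w where w: "\<And>n. contQ (w n)" "\<And>n. v n = canon_fun Q (w n)" by metis
  have "pos_norm P (canon (w n q) - canon (w (Suc n) q)) < 1 / 2 ^ Suc n" if "q \<in> topspace Q" for n q
    using v(3)[of n] d(2)[of n] that by (force simp: le_by_iff w(2))
  note less = this
  obtain y where y: "\<And>n. contQ (y n)" "\<And>n q. q \<in> topspace Q \<Longrightarrow> norm (w n q - y n q) \<le> 1 / 2 ^ n"
    "\<And>m n. m \<le> n \<Longrightarrow> le_by P Q 0 (canon_fun Q (y m)) (canon_fun Q (y n))"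
    by (rule increasing_correction[of w 1]) (use w(1) less in auto)
  define x where "x n = canon_fun Q (y n)" for n
  have xv: "le_by P Q (1 / 2 ^ n) (x n) (v n)" "le_by P Q (1 / 2 ^ n) (v n) (x n)" for n
    unfolding w(2) x_def using y(2)[of _ n]
    by (auto intro!: le_by_norm simp: norm_canon norm_minus_commute simp flip: canon_diff)
  have small: "\<exists>N. \<forall>n\<ge>N. 1 / 2 ^ n < e" if "0 < e" for e :: real
  proof -
    have "(\<lambda>n. 1 / 2 ^ n :: real) \<longlonglongrightarrow> 0" by (rule LIMSEQ_divide_realpow_zero) simp
    from order_tendstoD(2)[OF this that] show ?thesis by (simp add: eventually_sequentially)
  qed
  have "circ_limit (sup_dist P Q) (bounded_funs Q) UNIV (<) x z"
  proof (rule generates_circ_limit[OF I directed_index_nat])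
    fix n
    show "le_by P Q 0 (x n) z"
    proof (rule le_by_limit)
      fix e :: real assume "0 < e"
      then obtain N where N: "\<And>m. m \<ge> N \<Longrightarrow> 1 / 2 ^ m < e" using small by blast
      \<comment> \<open>The comparison of x n with v n costs 1 / 2 ^ n; going through a later m
        makes this cost arbitrarily small.\<close>
      define m where "m = max n N"
      have "le_by P Q 0 (x n) (x m)" unfolding x_def by (rule y(3)) (simp add: m_def)
      moreover have "le_by P Q 0 (v m) z" using v(1)[of m] I by (simp add: generates_def)
      ultimately have "le_by P Q (0 + 1 / 2 ^ m + 0) (x n) z" using xv(1) by (intro le_by_trans)
      then show "le_by P Q (0 + e) (x n) z" using N[of m] by (elim le_by_mono) (simp add: m_def)
    qed
  next
    fix c and e :: real assume c: "c \<in> I" "0 < e"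
    obtain c' where c': "c' \<in> D" "le_by P Q (e / 3) c c'" using D(3)[OF c(1), of "e / 3"] c(2) by auto
    obtain k where k: "c' = a k" using c'(1) a by auto
    obtain N where N: "\<And>m. m \<ge> N \<Longrightarrow> 1 / 2 ^ m < e / 3" using small[of "e / 3"] c(2) by auto
    have "le_by P Q e c (x n)" if n: "n > max k N" for n
    proof -
      have "le_by P Q (e / 3 + d n + 1 / 2 ^ n) c (x n)"
        using c'(2) v(2)[of k n] xv(2)[of n] n unfolding k by (intro le_by_trans) auto
      moreover have "d n \<le> 1 / 2 ^ n" by (simp add: d_def field_simps)
      ultimately show ?thesis using N[of n] n by (elim le_by_mono) auto
    qed
    then show "\<forall>\<^sub>F n in net_filter UNIV (<). le_by P Q e c (x n)"
      unfolding eventually_net_filter[OF directed_index_nat] by blast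
  qed
  moreover have "increasing_net (sup_dist P Q) UNIV (<) x"
    using y(3) by (auto simp: increasing_net_def sup_dist_zero_iff x_def)
  moreover have "range x \<subseteq> cont_funs Q" using y(1) by (auto simp: x_def cont_funs_eq)
  ultimately show ?thesis using z unfolding increasing_seq_limits_def by blast
qed

end

section \<open>Generating dual cones\<close>

text \<open>The property is pulled back from a Hausdorff product along an injection. It makes weak*
  compact sets weak* closed, hence norm closed, as Baire's theorem requires.\<close>

lemma kc_space_strong_operator_topology:
  "kc_space (strong_operator_topology :: ('b::real_normed_vector \<Rightarrow>\<^sub>L real) topology)"
proof (rule kc_space_continuous_injective_map_preimage)
  show "kc_space (euclidean :: ('b \<Rightarrow> real) topology)"
    by (intro Hausdorff_imp_kc_space)
      (simp add: Hausdorff_space_product_topology flip: euclidean_product_topology)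
  show "continuous_map strong_operator_topology euclidean (blinfun_apply :: ('b \<Rightarrow>\<^sub>L real) \<Rightarrow> _)"
    using continuous_map_pullback[of euclidean euclidean "\<lambda>x. x" UNIV blinfun_apply]
    by (simp add: strong_operator_topology_def o_def)
  show "inj_on blinfun_apply (topspace strong_operator_topology)"
    by (auto intro!: inj_onI blinfun_eqI)
qed

text \<open>By Baire's theorem some multiple of the weak* compact set of differences of elements of the
  dual ball has interior points.\<close>

lemma dual_generated_bound:
  assumes gen: "dual_generated (P :: 'a::banach set)"
  obtains M where "0 < M"
    "\<And>(a :: 'a bidual) r. (\<And>\<phi>. \<phi> \<in> dual_ball P \<Longrightarrow> \<bar>blinfun_apply a \<phi>\<bar> \<le> r) \<Longrightarrow> norm a \<le> M * r"
proof -
  define D where "D n = (\<lambda>(\<phi>, \<psi>). real n *\<^sub>R (\<phi> - \<psi>)) ` (dual_ball P \<times> dual_ball P)" for n :: nat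
  have "compactin strong_operator_topology (dual_ball P)"
    using compact_weak_dual_ball[of P] unfolding weak_dual_ball_def
    by (metis compactin_subspace compactin_absolute strong_operator_topology_topspace subset_UNIV compact_space_def
        topspace_subtopology inf_top_left)
  then have "compactin (prod_topology strong_operator_topology strong_operator_topology) (dual_ball P \<times> dual_ball P)"
    by (simp add: compactin_Times)
  moreover have "continuous_map (prod_topology strong_operator_topology strong_operator_topology)
      strong_operator_topology (\<lambda>(\<phi>, \<psi>). real n *\<^sub>R (\<phi> - \<psi> :: 'a dual))" for n
  proof -
    have "continuous_map (prod_topology strong_operator_topology strong_operator_topology) euclideanreal
        (\<lambda>p. real n * (blinfun_apply (fst p) x - blinfun_apply (snd p) x))" for x :: 'a
      using strong_operator_topology_continuous_evaluation[of x]
      by (intro continuous_map_real_mult continuous_map_diff continuous_map_compose[unfolded o_def, OF continuous_map_fst]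
          continuous_map_compose[unfolded o_def, OF continuous_map_snd]) auto
    then show ?thesis unfolding continuous_on_strong_operator_topo_iff_coordinatewise
      by (simp add: split_beta blinfun.scaleR_left blinfun.diff_left)
  qed
  ultimately have "compactin strong_operator_topology (D n)" for n
    unfolding D_def by (intro image_compactin)
  note compactin_imp_closedin_gen[OF kc_space_strong_operator_topology this]
  from closedin_continuous_map_preimage[OF strong_operator_topology_weaker_than_euclidean this]
  have closed: "closed (D n)" for n by simp
  have star: "\<exists>\<psi>\<in>dual_ball P. \<phi> = real n *\<^sub>R \<psi>" if "\<phi> \<in> dual_cone P" "norm \<phi> \<le> real n" "0 < n" for \<phi> n
    using that by (intro bexI[of _ "(1 / real n) *\<^sub>R \<phi>"]) (auto simp: dual_ball_def dual_cone_def blinfun.scaleR_left)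
  have "\<exists>n. \<theta> \<in> D n" for \<theta>
  proof -
    obtain \<phi> \<psi> where \<theta>: "\<theta> = \<phi> - \<psi>" "\<phi> \<in> dual_cone P" "\<psi> \<in> dual_cone P"
      using gen unfolding dual_generated_def by blast
    obtain n where n: "max (max (norm \<phi>) (norm \<psi>)) 1 \<le> real n" using real_arch_simple by blast
    then obtain \<phi>' \<psi>' where "\<phi>' \<in> dual_ball P" "\<phi> = real n *\<^sub>R \<phi>'" "\<psi>' \<in> dual_ball P" "\<psi> = real n *\<^sub>R \<psi>'"
      using star[OF \<theta>(2), of n] star[OF \<theta>(3), of n] by auto
    then have "\<theta> \<in> D n" unfolding D_def \<theta>(1) by (intro image_eqI[of _ _ "(\<phi>', \<psi>')"]) (auto simp: algebra_simps)
    then show ?thesis ..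
  qed
  then have "\<Union>(range D) = UNIV" by blast
  then have "euclidean interior_of \<Union>(range D) \<noteq> {}" by simp
  then have "\<exists>n. euclidean interior_of D n \<noteq> {}"
    using Baire_category_alt[of "euclidean :: 'a dual topology" "range D"] closed completely_metrizable_space_euclidean
    by (metis closed_closedin countable_image countableI_type imageE)
  then obtain n \<theta> where "\<theta> \<in> interior (D n)" by auto
  then obtain e where e: "0 < e" "ball \<theta> e \<subseteq> D n" by (auto simp: mem_interior)
  \<comment> \<open>On \<open>D n\<close> the values of a are at most 2 n r in absolute value. The
    centre \<theta> cancels in the difference of the values at \<theta> + y and \<theta> - y, and y
    of norm e / 2 yields the factor 4 n / e. The summand 1 keeps M positive for n = 0.\<close>
  define M where "M = 4 * real n / e + 1"
  have bound: "norm a \<le> M * r" if r: "\<And>\<phi>. \<phi> \<in> dual_ball P \<Longrightarrow> \<bar>blinfun_apply a \<phi>\<bar> \<le> r" for a :: "'a bidual" and r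
  proof -
    have r0: "0 \<le> r" using r[OF dual_ball_zero] by simp
    have D: "\<bar>blinfun_apply a \<phi>\<bar> \<le> 2 * real n * r" if "\<phi> \<in> D n" for \<phi>
    proof -
      obtain \<psi>1 \<psi>2 where \<psi>: "\<psi>1 \<in> dual_ball P" "\<psi>2 \<in> dual_ball P" "\<phi> = real n *\<^sub>R (\<psi>1 - \<psi>2)"
        using \<open>\<phi> \<in> D n\<close> by (auto simp: D_def)
      have "\<bar>blinfun_apply a \<psi>1 - blinfun_apply a \<psi>2\<bar> \<le> 2 * r" using r[OF \<psi>(1)] r[OF \<psi>(2)] by linarith
      then have "real n * \<bar>blinfun_apply a \<psi>1 - blinfun_apply a \<psi>2\<bar> \<le> real n * (2 * r)"
        by (intro mult_left_mono) auto
      then show ?thesis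
        unfolding \<psi>(3) blinfun.scaleR_right blinfun.diff_right by (simp add: abs_mult mult.assoc mult.left_commute)
    qed
    have "norm a \<le> 4 * real n * r / e"
    proof (rule norm_blinfun_bound)
      show "0 \<le> 4 * real n * r / e" using e r0 by simp
      fix \<phi>
      show "norm (blinfun_apply a \<phi>) \<le> 4 * real n * r / e * norm \<phi>"
      proof (cases "\<phi> = 0")
        case False
        define y where "y = (e / (2 * norm \<phi>)) *\<^sub>R \<phi>"
        have y: "norm y < e" using e False by (simp add: y_def)
        have "\<bar>blinfun_apply a (\<theta> + y)\<bar> \<le> 2 * real n * r" "\<bar>blinfun_apply a (\<theta> - y)\<bar> \<le> 2 * real n * r"
          using e(2) y by (auto intro!: D simp: subset_iff dist_norm)
        then have "\<bar>blinfun_apply a y\<bar> \<le> 2 * real n * r" unfolding blinfun.add_right blinfun.diff_right by linarith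
        then show ?thesis using e False by (simp add: y_def blinfun.scaleR_right abs_mult field_simps)
      qed (simp add: blinfun.zero_right)
    qed
    also have "\<dots> \<le> M * r" using r0 by (simp add: M_def algebra_simps)
    finally show ?thesis .
  qed
  show ?thesis
  proof (rule that[OF _ bound])
    show "0 < M" using e by (simp add: M_def add_nonneg_pos)
  qed
qed

section \<open>The set S: completeness, finite elements and Cauchy limits\<close>

context preordered_functions
begin

lemma cont_subset_lsc: "cont_funs Q \<subseteq> lsc_funs P Q"
  using canon_fun_lsc by (auto simp: cont_funs_eq)

lemma lsc_subset_bounded: "lsc_funs P Q \<subseteq> bounded_funs Q"
  by (auto simp: lsc_funs_def)

lemma unit_part_iff: "f \<in> unit_part Q Y \<longleftrightarrow> f \<in> Y \<and> (\<forall>q\<in>topspace Q. norm (f q) \<le> 1)"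
  using sup_norm_le_iff[of 1 Q f] by (simp add: unit_part_def)

lemma cont_ball_subset: "cont_ball r \<subseteq> cont_funs Q"
  by (auto simp: cont_ball_def cont_funs_eq)

lemma cont_ball_unit: "cont_ball 1 = unit_part Q (cont_funs Q)"
  by (auto simp: cont_ball_def cont_funs_eq unit_part_iff norm_canon)

lemma le_by_antisym:
  assumes gen: "dual_generated P" and f: "f \<in> bounded_funs Q" "g \<in> bounded_funs Q"
    and le: "le_by P Q 0 f g" "le_by P Q 0 g f"
  shows "f = g"
proof (rule extensionalityI)
  fix q assume q: "q \<in> topspace Q"
  obtain M where M: "\<And>(a :: 'a bidual) r. (\<And>\<phi>. \<phi> \<in> dual_ball P \<Longrightarrow> \<bar>blinfun_apply a \<phi>\<bar> \<le> r) \<Longrightarrow> norm a \<le> M * r"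
    using dual_generated_bound[OF gen] by metis
  have "norm (f q - g q) \<le> M * 0"
  proof (rule M)
    fix \<phi> assume "\<phi> \<in> dual_ball P"
    then show "\<bar>blinfun_apply (f q - g q) \<phi>\<bar> \<le> 0"
      using le_byD[OF le(1) q] le_byD[OF le(2) q] by (simp add: blinfun.diff_left antisym)
  qed
  then show "f q = g q" by simp
qed (use f in \<open>auto simp: bounded_funs_def\<close>)

text \<open>On the dual ball a single term bounds the later ones from below and z bounds them from
  above. A generating dual cone turns this into a norm bound.\<close>

lemma cauchy_bounded:
  assumes gen: "dual_generated P" and F: "F \<noteq> bot" and x: "cauchy_along P Q F x"
    and xB: "eventually (\<lambda>\<delta>. x \<delta> \<in> bounded_funs Q) F"
    and z: "z \<in> bounded_funs Q" "eventually (\<lambda>\<delta>. le_by P Q e (x \<delta>) z) F"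
  obtains r where "eventually (\<lambda>\<delta>. \<forall>q\<in>topspace Q. norm (x \<delta> q) \<le> r) F"
proof -
  obtain M where M: "\<And>(a :: 'a bidual) r. (\<And>\<phi>. \<phi> \<in> dual_ball P \<Longrightarrow> \<bar>blinfun_apply a \<phi>\<bar> \<le> r) \<Longrightarrow> norm a \<le> M * r"
    using dual_generated_bound[OF gen] by metis
  have "eventually (\<lambda>\<gamma>. x \<gamma> \<in> bounded_funs Q \<and> eventually (\<lambda>\<delta>. le_by P Q 1 (x \<gamma>) (x \<delta>)) F) F"
    using x by (intro eventually_conj xB) (simp add: cauchy_along_def)
  then obtain \<gamma> where \<gamma>: "x \<gamma> \<in> bounded_funs Q" "eventually (\<lambda>\<delta>. le_by P Q 1 (x \<gamma>) (x \<delta>)) F"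
    using eventually_happens'[OF F] by blast
  obtain a where a: "0 < a" "\<And>q. q \<in> topspace Q \<Longrightarrow> norm (x \<gamma> q) \<le> a" using bounded_fun_bound[OF \<gamma>(1)] by metis
  obtain b where b: "0 < b" "\<And>q. q \<in> topspace Q \<Longrightarrow> norm (z q) \<le> b" using bounded_fun_bound[OF z(1)] by metis
  have "eventually (\<lambda>\<delta>. \<forall>q\<in>topspace Q. norm (x \<delta> q) \<le> M * (a + b + \<bar>e\<bar> + 1)) F"
    using \<gamma>(2) z(2)
  proof eventually_elim
    case (elim \<delta>)
    show ?case
    proof (intro ballI M)
      fix q \<phi> assume q: "q \<in> topspace Q" and \<phi>: "\<phi> \<in> dual_ball P"
      show "\<bar>blinfun_apply (x \<delta> q) \<phi>\<bar> \<le> a + b + \<bar>e\<bar> + 1"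
        using le_byD[OF elim(1) q \<phi>] le_byD[OF elim(2) q \<phi>] a(1) a(2)[OF q] b(1) b(2)[OF q]
          blinfun_le_norm[OF dual_ball_norm[OF \<phi>], of "x \<gamma> q"] blinfun_le_norm[OF dual_ball_norm[OF \<phi>], of "z q"]
        by linarith
    qed
  qed
  then show ?thesis by (rule that)
qed

lemma unit_lsc_subset_cauchy_limits:
  "unit_part Q (lsc_funs P Q) \<subseteq> cauchy_limits (sup_dist P Q) (bounded_funs Q) (unit_part Q (cont_funs Q))"
proof
  fix f assume "f \<in> unit_part Q (lsc_funs P Q)"
  then have f: "f \<in> lsc_funs P Q" "\<And>q. q \<in> topspace Q \<Longrightarrow> norm (f q) \<le> 1" by (auto simp: unit_part_iff)
  obtain \<Gamma> where \<Gamma>: "directed_index \<Gamma> ball_order" "fst ` \<Gamma> \<subseteq> cont_ball 1"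
    "cauchy_net (sup_dist P Q) \<Gamma> ball_order fst" "pointwise_limit P Q (net_filter \<Gamma> ball_order) fst f"
    using lsc_function_is_limit[OF f] by auto
  have "circ_limit (sup_dist P Q) (bounded_funs Q) \<Gamma> ball_order fst f"
    using \<Gamma>(4) by (intro circ_limit_pointwise) (simp add: pointwise_limit_def)
  then show "f \<in> cauchy_limits (sup_dist P Q) (bounded_funs Q) (unit_part Q (cont_funs Q))"
    using \<Gamma> f(1) lsc_subset_bounded by (intro cauchy_limits_any) (auto simp: cont_ball_unit)
qed

lemma lsc_subset_cauchy_limits:
  "lsc_funs P Q \<subseteq> cauchy_limits (sup_dist P Q) (bounded_funs Q) (cont_funs Q)"
proof
  fix f assume f: "f \<in> lsc_funs P Q"
  then obtain r where r: "0 < r" "\<And>q. q \<in> topspace Q \<Longrightarrow> norm (f q) \<le> r"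
    using bounded_fun_bound lsc_subset_bounded by (metis subsetD)
  obtain \<Gamma> where \<Gamma>: "directed_index \<Gamma> ball_order" "fst ` \<Gamma> \<subseteq> cont_ball r"
    "cauchy_net (sup_dist P Q) \<Gamma> ball_order fst" "pointwise_limit P Q (net_filter \<Gamma> ball_order) fst f"
    using lsc_function_is_limit[OF f r(2,1)] by auto
  have "circ_limit (sup_dist P Q) (bounded_funs Q) \<Gamma> ball_order fst f"
    using \<Gamma>(4) by (intro circ_limit_pointwise) (simp add: pointwise_limit_def)
  then show "f \<in> cauchy_limits (sup_dist P Q) (bounded_funs Q) (cont_funs Q)"
    using \<Gamma> f(1) lsc_subset_bounded cont_ball_subset[of r] by (intro cauchy_limits_any) auto
qed

lemma unit_lsc_complete: "d_complete (sup_dist P Q) (unit_part Q (lsc_funs P Q))"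
  unfolding d_complete_def
proof (intro allI impI)
  fix I :: "('q \<Rightarrow> 'a bidual) net_index set" and R x
  assume "directed_index I R \<and> x ` I \<subseteq> unit_part Q (lsc_funs P Q) \<and> cauchy_net (sup_dist P Q) I R x"
  then have I: "directed_index I R" and sub: "x ` I \<subseteq> unit_part Q (lsc_funs P Q)"
    and x: "cauchy_along P Q (net_filter I R) x" by (auto intro: cauchy_net_along)
  have "eventually (\<lambda>\<delta>. x \<delta> \<in> lsc_funs P Q) (net_filter I R)"
    "eventually (\<lambda>\<delta>. \<forall>q\<in>topspace Q. norm (x \<delta> q) \<le> 1) (net_filter I R)"
    using eventually_net_filterD[OF I] by (eventually_elim; use sub in \<open>force simp: unit_part_iff\<close>)+
  then obtain z where z: "z \<in> lsc_funs P Q" "\<And>q. q \<in> topspace Q \<Longrightarrow> norm (z q) \<le> 1"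
    "pointwise_limit P Q (net_filter I R) x z"
    by (rule lsc_funs_complete[OF net_filter_neq_bot[OF I] x]) blast
  have "circ_limit (sup_dist P Q) (unit_part Q (lsc_funs P Q)) I R x z"
    using z(3) by (intro circ_limit_pointwise) (simp add: pointwise_limit_def)
  then show "\<exists>z\<in>unit_part Q (lsc_funs P Q). circ_limit (sup_dist P Q) (unit_part Q (lsc_funs P Q)) I R x z"
    using z(1,2) by (auto simp: unit_part_iff)
qed

lemma unit_cont_subset_finite:
  "unit_part Q (cont_funs Q) \<subseteq> finite_elements (sup_dist P Q) (unit_part Q (lsc_funs P Q))"
proof
  fix y0 :: "'q \<Rightarrow> 'a bidual" assume y0: "y0 \<in> unit_part Q (cont_funs Q)"
  then obtain y where y: "contQ y" "y0 = canon_fun Q y" by (auto simp: cont_funs_eq unit_part_iff)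
  show "y0 \<in> finite_elements (sup_dist P Q) (unit_part Q (lsc_funs P Q))"
    unfolding finite_elements_def
  proof (intro CollectI conjI allI ballI impI)
    show "y0 \<in> unit_part Q (lsc_funs P Q)" using y0 cont_subset_lsc by (auto simp: unit_part_iff)
    fix I :: "('q \<Rightarrow> 'a bidual) net_index set" and R x z
    assume z: "z \<in> unit_part Q (lsc_funs P Q)"
    assume "directed_index I R \<and> x ` I \<subseteq> unit_part Q (lsc_funs P Q) \<and> cauchy_net (sup_dist P Q) I R x \<and>
      circ_limit (sup_dist P Q) (unit_part Q (lsc_funs P Q)) I R x z"
    then have I: "directed_index I R" and sub: "x ` I \<subseteq> unit_part Q (lsc_funs P Q)"
      and x: "cauchy_along P Q (net_filter I R) x" and lim: "circ_limit (sup_dist P Q) (unit_part Q (lsc_funs P Q)) I R x z"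
      by (auto intro: cauchy_net_along)
    have "eventually (\<lambda>\<delta>. \<forall>q\<in>topspace Q. norm (x \<delta> q) \<le> 1) (net_filter I R)"
      using eventually_net_filterD[OF I] by eventually_elim (use sub in \<open>force simp: unit_part_iff\<close>)
    then show "((\<lambda>\<delta>. sup_dist P Q y0 (x \<delta>)) \<longlongrightarrow> sup_dist P Q y0 z) (net_filter I R)"
      unfolding y(2) by (intro dist_tendsto_of_bounded[OF I x sub _ _ _ z lim y(1)]) (auto simp: unit_part_iff)
  qed
qed

lemma unit_lsc_algebraic: "d_algebraic (sup_dist P Q) (unit_part Q (lsc_funs P Q))"
proof (rule d_algebraic_any)
  fix f assume "f \<in> unit_part Q (lsc_funs P Q)"
  then have f: "f \<in> lsc_funs P Q" "\<And>q. q \<in> topspace Q \<Longrightarrow> norm (f q) \<le> 1" by (auto simp: unit_part_iff)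
  obtain \<Gamma> where \<Gamma>: "directed_index \<Gamma> ball_order" "fst ` \<Gamma> \<subseteq> cont_ball 1"
    "cauchy_net (sup_dist P Q) \<Gamma> ball_order fst" "pointwise_limit P Q (net_filter \<Gamma> ball_order) fst f"
    using lsc_function_is_limit[OF f] by auto
  have "circ_limit (sup_dist P Q) (unit_part Q (lsc_funs P Q)) \<Gamma> ball_order fst f"
    using \<Gamma>(4) by (intro circ_limit_pointwise) (simp add: pointwise_limit_def)
  moreover have "fst ` \<Gamma> \<subseteq> finite_elements (sup_dist P Q) (unit_part Q (lsc_funs P Q))"
    using \<Gamma>(2) unit_cont_subset_finite unfolding cont_ball_unit by blast
  ultimately show "\<exists>(I :: (('q \<Rightarrow> 'a bidual) \<times> real) set) R x. directed_index I R \<and>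
      x ` I \<subseteq> finite_elements (sup_dist P Q) (unit_part Q (lsc_funs P Q)) \<and> cauchy_net (sup_dist P Q) I R x \<and>
      circ_limit (sup_dist P Q) (unit_part Q (lsc_funs P Q)) I R x f"
    using \<Gamma> by blast
qed

text \<open>The given limit provides the norm bound that compactness needs. The pointwise limit then
  exists, lies in S and is another limit of the same net, hence equal to z.\<close>

lemma cauchy_limits_subset_lsc:
  assumes gen: "dual_generated P"
  shows "cauchy_limits (sup_dist P Q) (bounded_funs Q) (cont_funs Q) \<subseteq> lsc_funs P Q"
proof
  fix z assume "z \<in> cauchy_limits (sup_dist P Q) (bounded_funs Q) (cont_funs Q)"
  then obtain I :: "('q \<Rightarrow> 'a bidual) net_index set" and R x where I: "directed_index I R" "x ` I \<subseteq> cont_funs Q"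
    "cauchy_net (sup_dist P Q) I R x" "circ_limit (sup_dist P Q) (bounded_funs Q) I R x z" and z: "z \<in> bounded_funs Q"
    unfolding cauchy_limits_def by blast
  let ?F = "net_filter I R"
  note F = net_filter_neq_bot[OF I(1)]
  note x = cauchy_net_along[OF I(1,3)]
  have sub: "x ` I \<subseteq> bounded_funs Q" using I(2) cont_funs_bounded by blast
  have S: "eventually (\<lambda>\<delta>. x \<delta> \<in> lsc_funs P Q) ?F" and B: "eventually (\<lambda>\<delta>. x \<delta> \<in> bounded_funs Q) ?F"
    using eventually_net_filterD[OF I(1)] by (eventually_elim; use I(2) sub cont_subset_lsc in blast)+
  obtain r where "eventually (\<lambda>\<delta>. \<forall>q\<in>topspace Q. norm (x \<delta> q) \<le> r) ?F"
    by (rule cauchy_bounded[OF gen F x B z circ_limit_upper[OF I(1) x sub I(4) zero_less_one]])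
  then obtain z' where z': "z' \<in> lsc_funs P Q" "pointwise_limit P Q ?F x z'"
    by (rule lsc_funs_complete[OF F x S])
  have lim: "circ_limit (sup_dist P Q) (bounded_funs Q) I R x z'"
    using z'(2) by (intro circ_limit_pointwise) (simp add: pointwise_limit_def)
  have B': "z' \<in> bounded_funs Q" using z'(1) lsc_subset_bounded by blast
  have "z = z'"
    by (intro le_by_antisym[OF gen z B'] circ_limit_unique[OF I(1) x sub I(4) lim B'] circ_limit_unique[OF I(1) x sub lim I(4) z])
  then show "z \<in> lsc_funs P Q" using z'(1) by simp
qed

lemma cont_subset_finite:
  assumes gen: "dual_generated P"
  shows "cont_funs Q \<subseteq> finite_elements (sup_dist P Q) (lsc_funs P Q)"
proof
  fix y0 :: "'q \<Rightarrow> 'a bidual" assume y0: "y0 \<in> cont_funs Q"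
  then obtain y where y: "contQ y" "y0 = canon_fun Q y" by (auto simp: cont_funs_eq)
  show "y0 \<in> finite_elements (sup_dist P Q) (lsc_funs P Q)"
    unfolding finite_elements_def
  proof (intro CollectI conjI allI ballI impI)
    show "y0 \<in> lsc_funs P Q" using y0 cont_subset_lsc by blast
    fix I :: "('q \<Rightarrow> 'a bidual) net_index set" and R x z
    assume z: "z \<in> lsc_funs P Q"
    assume "directed_index I R \<and> x ` I \<subseteq> lsc_funs P Q \<and> cauchy_net (sup_dist P Q) I R x \<and>
      circ_limit (sup_dist P Q) (lsc_funs P Q) I R x z"
    then have I: "directed_index I R" and sub: "x ` I \<subseteq> lsc_funs P Q"
      and x: "cauchy_along P Q (net_filter I R) x" and lim: "circ_limit (sup_dist P Q) (lsc_funs P Q) I R x z"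
      by (auto intro: cauchy_net_along)
    have B: "eventually (\<lambda>\<delta>. x \<delta> \<in> bounded_funs Q) (net_filter I R)"
      using eventually_net_filterD[OF I] by eventually_elim (use sub lsc_subset_bounded in blast)
    have zB: "z \<in> bounded_funs Q" using z lsc_subset_bounded by blast
    obtain r where "eventually (\<lambda>\<delta>. \<forall>q\<in>topspace Q. norm (x \<delta> q) \<le> r) (net_filter I R)"
      by (rule cauchy_bounded[OF gen net_filter_neq_bot[OF I] x B zB circ_limit_upper[OF I x sub lim zero_less_one]])
    then show "((\<lambda>\<delta>. sup_dist P Q y0 (x \<delta>)) \<longlongrightarrow> sup_dist P Q y0 z) (net_filter I R)"
      unfolding y(2) by (intro dist_tendsto_of_bounded[OF I x sub _ _ _ z lim y(1)]) auto
  qed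
qed

lemma closed_range_canon: "closed (range (canon :: 'a \<Rightarrow> 'a bidual))"
proof -
  have "bounded_linear (canon :: 'a \<Rightarrow> 'a bidual)"
    by (rule bounded_linear_intro[of _ 1]) (simp_all add: canon_add canon_scaleR norm_canon)
  then have "complete (range (canon :: 'a \<Rightarrow> 'a bidual))"
    by (intro complete_isometric_image[of 1]) (auto simp: norm_canon complete_UNIV)
  then show ?thesis by (rule complete_imp_closed)
qed

text \<open>The range of \<open>canon\<close> is closed, so f takes its values in X, where it is a
  uniform limit of continuous functions.\<close>

lemma cont_funs_norm_closed:
  assumes f: "f \<in> extensional (topspace Q)"
    and near: "\<And>e. 0 < e \<Longrightarrow> \<exists>g. contQ g \<and> (\<forall>q\<in>topspace Q. norm (f q - canon (g q)) < e)"
  shows "f \<in> cont_funs Q"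
proof -
  have "f q \<in> range canon" if "q \<in> topspace Q" for q
  proof -
    have "f q \<in> closure (range canon)"
      unfolding closure_approachable using near that by (fastforce simp: dist_norm norm_minus_commute)
    then show ?thesis using closed_range_canon by simp
  qed
  then have "\<forall>q\<in>topspace Q. \<exists>x. f q = canon x" by auto
  then obtain g where g: "\<And>q. q \<in> topspace Q \<Longrightarrow> f q = canon (g q)" by metis
  have "contQ g"
  proof (rule continuous_uniform_limit)
    fix e :: real assume "0 < e"
    then show "\<exists>h. contQ h \<and> (\<forall>q\<in>topspace Q. norm (g q - h q) < e)"
      using near[of e] by (simp add: g norm_canon flip: canon_diff)
  qed
  moreover have "f = canon_fun Q g"
    using f g by (intro extensionalityI[of _ "topspace Q"]) (auto simp: canon_fun_def)
  ultimately show ?thesis by (auto simp: cont_funs_eq)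
qed

text \<open>Finiteness is applied to f and its own formal ball net: the distance from f to the net
  tends to the distance from f to f, which is 0. As the net is also below f up to small errors, it
  approximates f on the dual ball from both sides, hence in norm, and C is norm closed.\<close>

lemma finite_subset_cont:
  assumes gen: "dual_generated P"
  shows "finite_elements (sup_dist P Q) (lsc_funs P Q) \<subseteq> cont_funs Q"
proof
  fix f assume fin: "f \<in> finite_elements (sup_dist P Q) (lsc_funs P Q)"
  then have f: "f \<in> lsc_funs P Q" by (simp add: finite_elements_def)
  then obtain r where r: "0 < r" "\<And>q. q \<in> topspace Q \<Longrightarrow> norm (f q) \<le> r"
    using bounded_fun_bound lsc_subset_bounded by (metis subsetD)
  obtain M where M: "0 < M" "\<And>(a :: 'a bidual) r. (\<And>\<phi>. \<phi> \<in> dual_ball P \<Longrightarrow> \<bar>blinfun_apply a \<phi>\<bar> \<le> r) \<Longrightarrow> norm a \<le> M * r"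
    using dual_generated_bound[OF gen] by metis
  obtain \<Gamma> where \<Gamma>: "directed_index \<Gamma> ball_order" "fst ` \<Gamma> \<subseteq> cont_ball r"
    "cauchy_net (sup_dist P Q) \<Gamma> ball_order fst" "pointwise_limit P Q (net_filter \<Gamma> ball_order) fst f"
    using lsc_function_is_limit[OF f r(2,1)] by auto
  let ?F = "net_filter \<Gamma> ball_order"
  note F = net_filter_neq_bot[OF \<Gamma>(1)]
  have sub: "fst ` \<Gamma> \<subseteq> lsc_funs P Q" using \<Gamma>(2) cont_ball_subset cont_subset_lsc by blast
  have "circ_limit (sup_dist P Q) (lsc_funs P Q) \<Gamma> ball_order fst f"
    using \<Gamma>(4) by (intro circ_limit_pointwise) (simp add: pointwise_limit_def)
  from finite_elements_any[OF fin \<Gamma>(1) sub \<Gamma>(3) this f]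
  have "((\<lambda>a. sup_dist P Q f (fst a)) \<longlongrightarrow> 0) ?F"
    using le_by_refl[of 0 P Q f] by (simp flip: sup_dist_zero_iff)
  then have up: "eventually (\<lambda>a. sup_dist P Q f (fst a) < ennreal e) ?F" if "0 < e" for e
    using that by (intro order_tendstoD(2)[of _ 0]) auto
  show "f \<in> cont_funs Q"
  proof (rule cont_funs_norm_closed)
    show "f \<in> extensional (topspace Q)" using f lsc_subset_bounded by (auto simp: bounded_funs_def)
    fix e :: real assume e: "0 < e"
    define \<eta> where "\<eta> = e / (2 * M)"
    have \<eta>: "0 < \<eta>" "M * \<eta> < e" using e M(1) by (auto simp: \<eta>_def)
    have "eventually (\<lambda>a. a \<in> \<Gamma> \<and> sup_dist P Q f (fst a) < ennreal \<eta> \<and> le_by P Q \<eta> (fst a) f) ?F"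
      by (intro eventually_conj eventually_net_filterD \<Gamma>(1) up \<eta>
          pointwise_limit_upper[OF F cauchy_net_along[OF \<Gamma>(1,3)] \<Gamma>(4)])
    then obtain a where a: "a \<in> \<Gamma>" "sup_dist P Q f (fst a) < ennreal \<eta>" "le_by P Q \<eta> (fst a) f"
      using eventually_happens'[OF F] by blast
    obtain g where g: "contQ g" "fst a = canon_fun Q g" using \<Gamma>(2) a(1) by (auto simp: cont_ball_def)
    have le: "le_by P Q \<eta> f (fst a)" using a(2) by (metis sup_dist_lessD le_by_mono less_imp_le)
    have "norm (f q - canon (g q)) < e" if q: "q \<in> topspace Q" for q
    proof -
      have "norm (f q - canon (g q)) \<le> M * \<eta>"
      proof (rule M(2))
        fix \<phi> assume \<phi>: "\<phi> \<in> dual_ball P"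
        show "\<bar>blinfun_apply (f q - canon (g q)) \<phi>\<bar> \<le> \<eta>"
          using le_byD[OF a(3) q \<phi>] le_byD[OF le q \<phi>] q unfolding g(2) blinfun.diff_left by (simp add: abs_le_iff)
      qed
      then show ?thesis using \<eta>(2) by simp
    qed
    then show "\<exists>g. contQ g \<and> (\<forall>q\<in>topspace Q. norm (f q - canon (g q)) < e)" using g(1) by blast
  qed
qed

text \<open>A norm convergent sequence in S is Cauchy and bounded; its limit in S agrees with f on
  the dual ball and so equals f.\<close>

lemma lsc_funs_norm_closed:
  assumes gen: "dual_generated P" and f: "f \<in> bounded_funs Q"
    and near: "\<And>e. 0 < e \<Longrightarrow> \<exists>g\<in>lsc_funs P Q. \<forall>q\<in>topspace Q. norm (f q - g q) \<le> e"
  shows "f \<in> lsc_funs P Q"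
proof -
  have "\<exists>g\<in>lsc_funs P Q. \<forall>q\<in>topspace Q. norm (f q - g q) \<le> 1 / 2 ^ n" for n :: nat by (rule near) simp
  then obtain x where x: "\<And>n. x n \<in> lsc_funs P Q" "\<And>n q. q \<in> topspace Q \<Longrightarrow> norm (f q - x n q) \<le> 1 / 2 ^ n"
    by metis
  have small: "eventually (\<lambda>n. 1 / 2 ^ n < e) sequentially" if "0 < e" for e :: real
  proof -
    have "(\<lambda>n. 1 / 2 ^ n :: real) \<longlonglongrightarrow> 0" by (rule LIMSEQ_divide_realpow_zero) simp
    from order_tendstoD(2)[OF this that] show ?thesis .
  qed
  have le: "le_by P Q (1 / 2 ^ n) f (x n)" "le_by P Q (1 / 2 ^ n) (x n) f" for n
    using x(2) by (auto intro!: le_by_norm simp: norm_minus_commute)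
  have cauchy: "cauchy_along P Q sequentially x"
    unfolding cauchy_along_def
  proof (intro allI impI)
    fix e :: real assume "0 < e"
    then have ev: "eventually (\<lambda>n. 1 / 2 ^ n < e / 2) sequentially" by (intro small) simp
    then show "\<forall>\<^sub>F m in sequentially. \<forall>\<^sub>F n in sequentially. le_by P Q e (x m) (x n)"
    proof eventually_elim
      case (elim m)
      from ev show ?case
      proof eventually_elim
        case (elim n)
        then show ?case using \<open>1 / 2 ^ m < e / 2\<close> by (intro le_by_mono[OF le_by_trans[OF le(2,1)]]) simp
      qed
    qed
  qed
  obtain b where b: "\<And>q. q \<in> topspace Q \<Longrightarrow> norm (f q) \<le> b" using bounded_fun_bound[OF f] by metis
  have "norm (x n q) \<le> b + 1" if "q \<in> topspace Q" for n q
  proof -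
    have "norm (x n q) \<le> norm (f q) + norm (f q - x n q)" by (metis norm_triangle_sub norm_minus_commute)
    moreover have "1 / 2 ^ n \<le> (1 :: real)" by simp
    ultimately show ?thesis using b[OF that] x(2)[OF that, of n] by linarith
  qed
  note bound = this
  obtain z where z: "z \<in> lsc_funs P Q" "pointwise_limit P Q sequentially x z"
    by (rule lsc_funs_complete[OF sequentially_bot cauchy, of "b + 1"]) (use x(1) bound in auto)
  have zB: "z \<in> bounded_funs Q" using z(1) lsc_subset_bounded by blast
  have "blinfun_apply (z q) \<phi> = blinfun_apply (f q) \<phi>" if q: "q \<in> topspace Q" and \<phi>: "\<phi> \<in> dual_ball P" for q \<phi>
  proof (rule LIMSEQ_unique)
    show "(\<lambda>n. blinfun_apply (x n q) \<phi>) \<longlonglongrightarrow> blinfun_apply (z q) \<phi>"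
      using z(2) q \<phi> by (simp add: pointwise_limit_def)
    show "(\<lambda>n. blinfun_apply (x n q) \<phi>) \<longlonglongrightarrow> blinfun_apply (f q) \<phi>"
    proof (rule tendstoI)
      fix e :: real assume "0 < e"
      from small[OF this] show "\<forall>\<^sub>F n in sequentially. dist (blinfun_apply (x n q) \<phi>) (blinfun_apply (f q) \<phi>) < e"
      proof eventually_elim
        case (elim n)
        then show ?case using le_byD[OF le(1)[of n] q \<phi>] le_byD[OF le(2)[of n] q \<phi>] unfolding dist_real_def by linarith
      qed
    qed
  qed
  then have "z = f" by (intro le_by_antisym[OF gen zB f]) (simp_all add: le_by_def)
  then show ?thesis using z(1) by simp
qed

section \<open>Directed unit balls\<close>

text \<open>A common upper bound taken at one point remains one nearby only up to \<eta>, so gluing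
  gives an approximate upper bound w. The errors that remain are bounded by the continuous functions
  b1 and b2, to which the step can be applied again.\<close>

lemma directed_ball_step:
  assumes dir: "\<And>a b. norm a < \<rho> \<Longrightarrow> norm b < \<rho> \<Longrightarrow> \<exists>c. norm c < \<rho> \<and> cone_le P a c \<and> cone_le P b c"
    and v: "contQ v1" "contQ v2" "\<And>q. q \<in> topspace Q \<Longrightarrow> norm (v1 q) < \<rho>" "\<And>q. q \<in> topspace Q \<Longrightarrow> norm (v2 q) < \<rho>"
    and \<eta>: "0 < \<eta>"
  obtains w b1 b2 where "contQ w" "contQ b1" "contQ b2" "\<And>q. q \<in> topspace Q \<Longrightarrow> norm (w q) < \<rho>"
    "\<And>q. q \<in> topspace Q \<Longrightarrow> norm (b1 q) < \<eta>" "\<And>q. q \<in> topspace Q \<Longrightarrow> norm (b2 q) < \<eta>"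
    "\<And>q \<phi>. q \<in> topspace Q \<Longrightarrow> \<phi> \<in> dual_ball P \<Longrightarrow> blinfun_apply \<phi> (v1 q) \<le> blinfun_apply \<phi> (w q) + blinfun_apply \<phi> (b1 q)"
    "\<And>q \<phi>. q \<in> topspace Q \<Longrightarrow> \<phi> \<in> dual_ball P \<Longrightarrow> blinfun_apply \<phi> (v2 q) \<le> blinfun_apply \<phi> (w q) + blinfun_apply \<phi> (b2 q)"
proof -
  define A where "A q = ball 0 \<rho> \<inter> {w. canon w \<in> {y. pos_norm P (canon (v1 q) - y) < \<eta>}}
    \<inter> {w. canon w \<in> {y. pos_norm P (canon (v2 q) - y) < \<eta>}}" for q
  have "\<exists>w. contQ w \<and> (\<forall>q\<in>topspace Q. w q \<in> A q)"
  proof (rule continuous_selection[OF compact hausdorff, of A])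
    show "convex (A q)" for q unfolding A_def
      by (intro convex_Int convex_ball convex_canon_vimage convex_pos_norm_less')
    fix q assume q: "q \<in> topspace Q"
    obtain w where w: "norm w < \<rho>" "cone_le P (v1 q) w" "cone_le P (v2 q) w" using dir[OF v(3,4)] q by blast
    have neg: "pos_norm P (canon y - canon w) < \<eta>" if "cone_le P y w" for y
    proof -
      have "pos_norm P (canon y - canon w) \<le> 0"
        using that dual_ball_nonneg[of _ P "w - y"]
        by (auto simp: cone_le_def pos_norm_le_iff blinfun.diff_left blinfun.diff_right)
      then show ?thesis using \<eta> by simp
    qed
    define U where "U = {p\<in>topspace Q. pos_norm P (canon (v1 p) - canon w) < \<eta>} \<inter>
      {p\<in>topspace Q. pos_norm P (canon (v2 p) - canon w) < \<eta>}"
    have "openin Q U" unfolding U_def by (intro openin_Int openin_pos_norm_less v)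
    moreover have "q \<in> U" using q neg w by (auto simp: U_def)
    moreover have "\<forall>p\<in>U. w \<in> A p" using w(1) by (auto simp: U_def A_def)
    ultimately show "\<exists>s U. contQ s \<and> openin Q U \<and> q \<in> U \<and> (\<forall>p\<in>U. s p \<in> A p)"
      by (intro exI[of _ "\<lambda>_. w"] exI[of _ U]) auto
  qed blast
  then obtain w where w: "contQ w" "\<And>q. q \<in> topspace Q \<Longrightarrow> w q \<in> A q" by blast
  have bound: "\<exists>b. contQ b \<and> (\<forall>q\<in>topspace Q. norm (b q) < \<eta> \<and>
      (\<forall>\<phi>\<in>dual_ball P. blinfun_apply \<phi> (v q) \<le> blinfun_apply \<phi> (w q) + blinfun_apply \<phi> (b q)))"
    if "contQ v" "\<And>q. q \<in> topspace Q \<Longrightarrow> pos_norm P (canon (v q) - canon (w q)) < \<eta>" for v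
  proof -
    have "contQ (\<lambda>q. v q - w q)" using that(1) w(1) by (intro continuous_intros)
    moreover have "pos_norm P (canon (v q - w q)) < \<eta>" if "q \<in> topspace Q" for q
      using \<open>\<And>q. q \<in> topspace Q \<Longrightarrow> pos_norm P (canon (v q) - canon (w q)) < \<eta>\<close>[OF that] by (simp add: canon_diff)
    ultimately show ?thesis
    proof (rule continuous_upper_bound)
      fix b assume "contQ b" "\<And>q. q \<in> topspace Q \<Longrightarrow> norm (b q) < \<eta>"
        "\<And>q \<phi>. q \<in> topspace Q \<Longrightarrow> \<phi> \<in> dual_ball P \<Longrightarrow> blinfun_apply \<phi> (v q - w q) \<le> blinfun_apply \<phi> (b q)"
      then show ?thesis by (intro exI[of _ b]) (auto simp: blinfun.diff_right algebra_simps)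
    qed
  qed
  obtain b1 where "contQ b1" "\<forall>q\<in>topspace Q. norm (b1 q) < \<eta> \<and>
      (\<forall>\<phi>\<in>dual_ball P. blinfun_apply \<phi> (v1 q) \<le> blinfun_apply \<phi> (w q) + blinfun_apply \<phi> (b1 q))"
    using bound[OF v(1)] w(2) by (auto simp: A_def)
  moreover obtain b2 where "contQ b2" "\<forall>q\<in>topspace Q. norm (b2 q) < \<eta> \<and>
      (\<forall>\<phi>\<in>dual_ball P. blinfun_apply \<phi> (v2 q) \<le> blinfun_apply \<phi> (w q) + blinfun_apply \<phi> (b2 q))"
    using bound[OF v(2)] w(2) by (auto simp: A_def)
  moreover have "norm (w q) < \<rho>" if "q \<in> topspace Q" for q using w(2)[OF that] by (simp add: A_def)
  ultimately show ?thesis using w(1) by (intro that[of w b1 b2]) auto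
qed

lemma open_ball_directed_scaled:
  assumes "open_ball_directed P" "0 < \<rho>" "norm a < \<rho>" "norm b < \<rho>"
  shows "\<exists>c. norm c < \<rho> \<and> cone_le P a c \<and> cone_le P b c"
proof -
  have P: "\<And>r x. 0 \<le> r \<Longrightarrow> x \<in> P \<Longrightarrow> r *\<^sub>R x \<in> P" using cone by (auto simp: preordered_banach_def convex_cone_iff)
  have "(1 / \<rho>) *\<^sub>R a \<in> ball 0 1" "(1 / \<rho>) *\<^sub>R b \<in> ball 0 1" using assms by (auto simp: field_simps)
  then obtain c where c: "norm c < 1" "c - (1 / \<rho>) *\<^sub>R a \<in> P" "c - (1 / \<rho>) *\<^sub>R b \<in> P"
    using assms(1) unfolding open_ball_directed_def cone_le_def by (metis mem_ball_0)
  have "\<rho> *\<^sub>R c - a \<in> P" "\<rho> *\<^sub>R c - b \<in> P"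
    using P[OF _ c(2), of \<rho>] P[OF _ c(3), of \<rho>] assms(2) by (auto simp: algebra_simps)
  then show ?thesis using c(1) assms(2) by (intro exI[of _ "\<rho> *\<^sub>R c"]) (auto simp: cone_le_def)
qed

text \<open>The error left by each approximate common upper bound is itself approximately bounded in the
  next step, and the bounds obtained in this way are summed up.\<close>

lemma continuous_ball_directed:
  assumes dir: "open_ball_directed P" and r: "0 < r"
    and v: "contQ v1" "contQ v2" "\<And>q. q \<in> topspace Q \<Longrightarrow> norm (v1 q) < r" "\<And>q. q \<in> topspace Q \<Longrightarrow> norm (v2 q) < r"
  obtains w where "contQ w" "\<And>q. q \<in> topspace Q \<Longrightarrow> norm (w q) < r"
    "\<And>q \<phi>. q \<in> topspace Q \<Longrightarrow> \<phi> \<in> dual_ball P \<Longrightarrow> blinfun_apply \<phi> (v1 q) \<le> blinfun_apply \<phi> (w q)"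
    "\<And>q \<phi>. q \<in> topspace Q \<Longrightarrow> \<phi> \<in> dual_ball P \<Longrightarrow> blinfun_apply \<phi> (v2 q) \<le> blinfun_apply \<phi> (w q)"
proof -
  obtain s1 where s1: "0 < s1" "s1 < r" "\<And>q. q \<in> topspace Q \<Longrightarrow> norm (v1 q) < s1"
    using continuous_attains_less[OF v(1,3) r] by metis
  obtain s2 where s2: "0 < s2" "s2 < r" "\<And>q. q \<in> topspace Q \<Longrightarrow> norm (v2 q) < s2"
    using continuous_attains_less[OF v(2,4) r] by metis
  \<comment> \<open>Compactness puts both functions below some \<rho> < r, which leaves r - \<rho>
    for the later corrections.\<close>
  define \<rho> where "\<rho> = max s1 s2"
  have \<rho>: "0 < \<rho>" "\<rho> < r" "\<And>q. q \<in> topspace Q \<Longrightarrow> norm (v1 q) < \<rho>" "\<And>q. q \<in> topspace Q \<Longrightarrow> norm (v2 q) < \<rho>"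
    using s1 s2 by (fastforce simp: \<rho>_def)+
  \<comment> \<open>The tolerances add up to \<rho> + (r - \<rho>) / 2 < r. The first one is \<rho>,
    since it bounds v1 and v2 themselves.\<close>
  define \<eta> where "\<eta> n = (if n = 0 then \<rho> else (r - \<rho>) / 2 ^ Suc n)" for n
  have \<eta>: "0 < \<eta> n" for n using \<rho> by (simp add: \<eta>_def)
  define bounded where "bounded n b \<longleftrightarrow> contQ b \<and> (\<forall>q\<in>topspace Q. norm (b q) < \<eta> n)" for n b
  define below where "below b w b' \<longleftrightarrow> (\<forall>q\<in>topspace Q. \<forall>\<phi>\<in>dual_ball P.
    blinfun_apply \<phi> (b q) \<le> blinfun_apply \<phi> (w q) + blinfun_apply \<phi> (b' q))" for b w b' :: "'q \<Rightarrow> 'a"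
  have step: "\<exists>w b1' b2'. bounded n w \<and> bounded (Suc n) b1' \<and> bounded (Suc n) b2' \<and> below b1 w b1' \<and> below b2 w b2'"
    if "bounded n b1" "bounded n b2" for n b1 b2
  proof -
    have b: "contQ b1" "contQ b2" "\<And>q. q \<in> topspace Q \<Longrightarrow> norm (b1 q) < \<eta> n" "\<And>q. q \<in> topspace Q \<Longrightarrow> norm (b2 q) < \<eta> n"
      using that by (auto simp: bounded_def)
    show ?thesis
    proof (rule directed_ball_step[OF open_ball_directed_scaled[OF dir \<eta>[of n]] b \<eta>[of "Suc n"]])
      fix w b1' b2' assume w: "contQ w" "contQ b1'" "contQ b2'" "\<And>q. q \<in> topspace Q \<Longrightarrow> norm (w q) < \<eta> n"
      "\<And>q. q \<in> topspace Q \<Longrightarrow> norm (b1' q) < \<eta> (Suc n)" "\<And>q. q \<in> topspace Q \<Longrightarrow> norm (b2' q) < \<eta> (Suc n)"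
      "\<And>q \<phi>. q \<in> topspace Q \<Longrightarrow> \<phi> \<in> dual_ball P \<Longrightarrow> blinfun_apply \<phi> (b1 q) \<le> blinfun_apply \<phi> (w q) + blinfun_apply \<phi> (b1' q)"
      "\<And>q \<phi>. q \<in> topspace Q \<Longrightarrow> \<phi> \<in> dual_ball P \<Longrightarrow> blinfun_apply \<phi> (b2 q) \<le> blinfun_apply \<phi> (w q) + blinfun_apply \<phi> (b2' q)"
      have "bounded n w" "bounded (Suc n) b1'" "bounded (Suc n) b2'" using w by (auto simp: bounded_def)
      moreover have "below b1 w b1'" "below b2 w b2'" using w(7,8) by (auto simp: below_def)
      ultimately show ?thesis by blast
    qed
  qed
  have v01: "bounded 0 v1" "bounded 0 v2" using \<rho> v by (auto simp: bounded_def \<eta>_def)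
  \<comment> \<open>A state holds an approximate bound and the two remaining errors, which are the
    functions to be bounded in the next step. The clause for n = 0 ties the first state to v1 and
    v2.\<close>
  define ok where "ok n x \<longleftrightarrow> bounded n (fst x) \<and> bounded (Suc n) (fst (snd x)) \<and> bounded (Suc n) (snd (snd x)) \<and>
    (n = 0 \<longrightarrow> below v1 (fst x) (fst (snd x)) \<and> below v2 (fst x) (snd (snd x)))" for n x
  define succ where "succ x y \<longleftrightarrow> below (fst (snd x)) (fst y) (fst (snd y)) \<and> below (snd (snd x)) (fst y) (snd (snd y))"
    for x y :: "('q \<Rightarrow> 'a) \<times> ('q \<Rightarrow> 'a) \<times> ('q \<Rightarrow> 'a)"
  have "\<exists>g. \<forall>n. ok n (g n) \<and> succ (g n) (g (Suc n))"
  proof (rule dependent_nat_choice)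
    show "\<exists>x. ok 0 x" using step[OF v01] by (auto simp: ok_def)
    fix x n assume "ok n x"
    then have "bounded (Suc n) (fst (snd x))" "bounded (Suc n) (snd (snd x))" by (auto simp: ok_def)
    from step[OF this] show "\<exists>y. ok (Suc n) y \<and> succ x y" by (auto simp: ok_def succ_def)
  qed
  then obtain g where g: "\<And>n. ok n (g n)" "\<And>n. succ (g n) (g (Suc n))" by blast
  define w where "w n = fst (g n)" for n
  define b1 where "b1 n = fst (snd (g n))" for n
  define b2 where "b2 n = snd (snd (g n))" for n
  note defs = w_def b1_def b2_def
  have w: "bounded n (w n)" "bounded (Suc n) (b1 n)" "bounded (Suc n) (b2 n)" for n
    using g(1)[of n] by (auto simp: ok_def defs)
  have b0: "below v1 (w 0) (b1 0)" "below v2 (w 0) (b2 0)" using g(1)[of 0] by (auto simp: ok_def defs)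
  have bs: "below (b1 n) (w (Suc n)) (b1 (Suc n))" "below (b2 n) (w (Suc n)) (b2 (Suc n))" for n
    using g(2)[of n] by (auto simp: succ_def defs)
  have "(\<lambda>n. \<eta> (Suc n)) sums ((r - \<rho>) / 2)"
  proof -
    have "(\<lambda>k. ((r - \<rho>) / 2) * (1/2) ^ Suc k) sums (((r - \<rho>) / 2) * 1)"
      by (intro sums_mult power_half_series)
    then show ?thesis by (simp add: \<eta>_def power_add field_simps)
  qed
  then have "\<eta> sums ((r - \<rho>) / 2 + \<eta> 0)" unfolding sums_Suc_iff .
  then have \<eta>_sums: "\<eta> sums ((r - \<rho>) / 2 + \<rho>)" by (simp add: \<eta>_def)
  have wn: "norm (w n q) \<le> \<eta> n" if "q \<in> topspace Q" for n q using w(1)[of n] that by (auto simp: bounded_def less_imp_le)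
  have summ: "summable (\<lambda>n. w n q)" if "q \<in> topspace Q" for q
    using sums_summable[OF \<eta>_sums] wn[OF that] by (rule summable_comparison_test'[of _ 0])
  have \<eta>0: "\<eta> \<longlonglongrightarrow> 0" by (rule summable_LIMSEQ_zero[OF sums_summable[OF \<eta>_sums]])
  have le: "blinfun_apply \<phi> (v q) \<le> blinfun_apply \<phi> (\<Sum>n. w n q)"
    if v: "below v (w 0) (b 0)" and b: "\<And>n. below (b n) (w (Suc n)) (b (Suc n))" "\<And>n. bounded (Suc n) (b n)"
      and q: "q \<in> topspace Q" and \<phi>: "\<phi> \<in> dual_ball P" for v b q \<phi>
  proof (rule LIMSEQ_le_const)
    have "(\<lambda>n. \<Sum>k<Suc n. w k q) \<longlonglongrightarrow> (\<Sum>n. w n q)" using summable_LIMSEQ[OF summ[OF q]] by (rule LIMSEQ_Suc)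
    then have "(\<lambda>n. blinfun_apply \<phi> (\<Sum>k<Suc n. w k q) + \<eta> (Suc n)) \<longlonglongrightarrow> blinfun_apply \<phi> (\<Sum>n. w n q) + 0"
      by (intro tendsto_add blinfun.tendsto tendsto_const LIMSEQ_Suc[OF \<eta>0])
    then show "(\<lambda>n. blinfun_apply \<phi> (\<Sum>k<Suc n. w k q) + \<eta> (Suc n)) \<longlonglongrightarrow> blinfun_apply \<phi> (\<Sum>n. w n q)"
      unfolding add_0_right .
    \<comment> \<open>Telescoping: after the partial sum up to n the only deficit is
      \<open>b n\<close>, which tends to 0 in norm.\<close>
    have "blinfun_apply \<phi> (v q) \<le> blinfun_apply \<phi> (\<Sum>k<Suc n. w k q) + blinfun_apply \<phi> (b n q)" for n
    proof (induction n)
      case 0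
      then show ?case using v q \<phi> by (simp add: below_def)
    next
      case (Suc n)
      have "blinfun_apply \<phi> (b n q) \<le> blinfun_apply \<phi> (w (Suc n) q) + blinfun_apply \<phi> (b (Suc n) q)"
        using b(1)[of n] q \<phi> by (simp add: below_def)
      then show ?case using Suc by (simp add: blinfun.add_right)
    qed
    moreover have "blinfun_apply \<phi> (b n q) \<le> \<eta> (Suc n)" for n
    proof -
      have "blinfun_apply \<phi> (b n q) \<le> norm (b n q)"
        using norm_blinfun[of \<phi> "b n q"] mult_right_mono[OF dual_ball_norm[OF \<phi>], of "norm (b n q)"] by simp
      then show ?thesis using b(2)[of n] q by (auto simp: bounded_def intro: order_trans less_imp_le)
    qed
    ultimately show "\<exists>N. \<forall>n\<ge>N. blinfun_apply \<phi> (v q) \<le> blinfun_apply \<phi> (\<Sum>k<Suc n. w k q) + \<eta> (Suc n)"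
      by (meson add_left_mono order_trans)
  qed
  show ?thesis
  proof (rule that[of "\<lambda>q. \<Sum>n. w n q"])
    show "contQ (\<lambda>q. \<Sum>n. w n q)"
      using w(1) sums_summable[OF \<eta>_sums] wn by (intro continuous_suminf) (auto simp: bounded_def)
    show "norm (\<Sum>n. w n q) < r" if "q \<in> topspace Q" for q
    proof -
      have "norm (\<Sum>n. w n q) \<le> (\<Sum>n. \<eta> n)" using wn[OF that] sums_summable[OF \<eta>_sums] by (rule norm_suminf_le)
      also have "\<dots> < r" using sums_unique[OF \<eta>_sums] \<rho>(2) by (simp add: field_simps)
      finally show ?thesis .
    qed
  qed (use le b0 bs w in blast)+
qed

text \<open>The functions at distance less than e from I are directed in the exact order: two of
  them exceed a common c' in I by functions with upper bounds of norm less than e, and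
  \<open>continuous_ball_directed\<close> gives these bounds a common one, which is added to c'.
  This set contains I, so its limit is above f; it stays within e of I, so its limit is below f up
  to e.\<close>

lemma lsc_near_increasing_limit:
  assumes gen: "dual_generated P" and dir: "open_ball_directed P" and f: "f \<in> lsc_funs P Q" and e: "0 < e"
  obtains g where "g \<in> increasing_limits (sup_dist P Q) (bounded_funs Q) (cont_funs Q)"
    "le_by P Q 0 f g" "le_by P Q e g f"
proof -
  have fB: "f \<in> bounded_funs Q" using f lsc_subset_bounded by blast
  obtain I where I: "generates I f" using f lsc_subset_cauchy_limits cauchy_limits_iff by blast
  have IC: "I \<subseteq> cont_funs Q" and If: "\<And>c. c \<in> I \<Longrightarrow> le_by P Q 0 c f"
    and dirI: "\<And>c1 c2 r. c1 \<in> I \<Longrightarrow> c2 \<in> I \<Longrightarrow> 0 < r \<Longrightarrow> \<exists>c\<in>I. le_by P Q r c1 c \<and> le_by P Q r c2 c"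
    and ne: "I \<noteq> {}" using I by (auto simp: generates_def)
  define J where "J = {c\<in>cont_funs Q. \<exists>c'\<in>I. \<exists>s\<ge>0. s < e \<and> le_by P Q s c c'}"
  have IJ: "I \<subseteq> J" using IC e by (auto simp: J_def intro!: bexI exI[of _ 0] le_by_refl)
  have Jf: "le_by P Q e c f" if c: "c \<in> J" for c
  proof -
    obtain c' s where "c' \<in> I" "s < e" "le_by P Q s c c'" using c by (auto simp: J_def)
    then have "le_by P Q (s + 0) c f" using If by (intro le_by_trans)
    then show ?thesis by (rule le_by_mono) (use \<open>s < e\<close> in simp)
  qed
  have J: "directed_index J (le_by P Q 0)"
    unfolding directed_index_def
  proof (intro conjI ballI)
    show "J \<noteq> {}" using IJ ne by blast
    show "transp_on J (le_by P Q 0)" by (rule transp_onI) (use le_by_trans[of P Q 0 _ _ 0] in force)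
    fix a b assume "a \<in> J" "b \<in> J"
    then obtain a' s b' t where ab: "a' \<in> I" "0 \<le> s" "s < e" "le_by P Q s a a'" "b' \<in> I" "0 \<le> t" "t < e" "le_by P Q t b b'"
      and C: "a \<in> cont_funs Q" "b \<in> cont_funs Q" by (auto simp: J_def)
    \<comment> \<open>A third of the slack: one part pays for the passage to a common c', one makes
      the estimate strict, and one keeps the new function at distance less than e from I.\<close>
    define \<eta> where "\<eta> = (e - max s t) / 3"
    have \<eta>: "0 < \<eta>" "s + \<eta> < e - \<eta>" "t + \<eta> < e - \<eta>" using ab by (auto simp: \<eta>_def max_def field_simps)
    obtain c' where c': "c' \<in> I" "le_by P Q \<eta> a' c'" "le_by P Q \<eta> b' c'" using dirI[OF ab(1,5) \<eta>(1)] by blast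
    obtain a0 b0 c0 where abc: "contQ a0" "a = canon_fun Q a0" "contQ b0" "b = canon_fun Q b0" "contQ c0" "c' = canon_fun Q c0"
      using C c'(1) IC by (auto simp: cont_funs_eq)
    have upper: "\<exists>v. contQ v \<and> (\<forall>q\<in>topspace Q. norm (v q) < e - \<eta>) \<and>
        (\<forall>q\<in>topspace Q. \<forall>\<phi>\<in>dual_ball P. blinfun_apply \<phi> (x q - c0 q) \<le> blinfun_apply \<phi> (v q))"
      if x: "contQ x" "le_by P Q s' (canon_fun Q x) c'" "s' < e - \<eta>" for x s'
    proof -
      have "contQ (\<lambda>q. x q - c0 q)" using x(1) abc(5) by (intro continuous_intros)
      moreover have "pos_norm P (canon (x q - c0 q)) < e - \<eta>" if "q \<in> topspace Q" for q
        using x(2,3) that by (force simp: le_by_iff abc(6) canon_diff)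
      ultimately show ?thesis
      proof (rule continuous_upper_bound)
        fix v assume "contQ v" "\<And>q. q \<in> topspace Q \<Longrightarrow> norm (v q) < e - \<eta>"
          "\<And>q \<phi>. q \<in> topspace Q \<Longrightarrow> \<phi> \<in> dual_ball P \<Longrightarrow> blinfun_apply \<phi> (x q - c0 q) \<le> blinfun_apply \<phi> (v q)"
        then show ?thesis by (intro exI[of _ v]) auto
      qed
    qed
    obtain v1 where v1: "contQ v1" "\<And>q. q \<in> topspace Q \<Longrightarrow> norm (v1 q) < e - \<eta>"
      "\<And>q \<phi>. q \<in> topspace Q \<Longrightarrow> \<phi> \<in> dual_ball P \<Longrightarrow> blinfun_apply \<phi> (a0 q - c0 q) \<le> blinfun_apply \<phi> (v1 q)"
      using upper[OF abc(1) le_by_trans[OF ab(4) c'(2), unfolded abc(2)] \<eta>(2)] by blast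
    obtain v2 where v2: "contQ v2" "\<And>q. q \<in> topspace Q \<Longrightarrow> norm (v2 q) < e - \<eta>"
      "\<And>q \<phi>. q \<in> topspace Q \<Longrightarrow> \<phi> \<in> dual_ball P \<Longrightarrow> blinfun_apply \<phi> (b0 q - c0 q) \<le> blinfun_apply \<phi> (v2 q)"
      using upper[OF abc(3) le_by_trans[OF ab(8) c'(3), unfolded abc(4)] \<eta>(3)] by blast
    have pos: "0 < e - \<eta>" using \<eta> ab by linarith
    obtain w where w: "contQ w" "\<And>q. q \<in> topspace Q \<Longrightarrow> norm (w q) < e - \<eta>"
      "\<And>q \<phi>. q \<in> topspace Q \<Longrightarrow> \<phi> \<in> dual_ball P \<Longrightarrow> blinfun_apply \<phi> (v1 q) \<le> blinfun_apply \<phi> (w q)"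
      "\<And>q \<phi>. q \<in> topspace Q \<Longrightarrow> \<phi> \<in> dual_ball P \<Longrightarrow> blinfun_apply \<phi> (v2 q) \<le> blinfun_apply \<phi> (w q)"
      using continuous_ball_directed[OF dir pos v1(1) v2(1) v1(2) v2(2)] by metis
    define c where "c = canon_fun Q (\<lambda>q. c0 q + w q)"
    have "c \<in> cont_funs Q" using abc(5) w(1) by (auto simp: c_def cont_funs_eq intro!: continuous_intros)
    moreover have "le_by P Q (e - \<eta>) c c'"
      using w(2) by (intro le_by_norm) (auto simp: c_def abc(6) canon_add norm_canon less_imp_le)
    ultimately have "c \<in> J" using c'(1) pos \<eta>(1) by (auto simp: J_def intro!: bexI[of _ c'] exI[of _ "e - \<eta>"])
    moreover have "le_by P Q 0 a c"
      unfolding le_by_def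
    proof (intro ballI)
      fix q \<phi> assume q: "q \<in> topspace Q" "\<phi> \<in> dual_ball P"
      show "blinfun_apply (a q) \<phi> \<le> blinfun_apply (c q) \<phi> + 0"
        using v1(3)[OF q] w(3)[OF q] q(1) by (simp add: abc(2) c_def blinfun.add_right blinfun.diff_right)
    qed
    moreover have "le_by P Q 0 b c"
      unfolding le_by_def
    proof (intro ballI)
      fix q \<phi> assume q: "q \<in> topspace Q" "\<phi> \<in> dual_ball P"
      show "blinfun_apply (b q) \<phi> \<le> blinfun_apply (c q) \<phi> + 0"
        using v2(3)[OF q] w(4)[OF q] q(1) by (simp add: abc(4) c_def blinfun.add_right blinfun.diff_right)
    qed
    ultimately show "\<exists>c\<in>J. le_by P Q 0 a c \<and> le_by P Q 0 b c" by blast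
  qed
  let ?F = "net_filter J (le_by P Q 0)"
  note F = net_filter_neq_bot[OF J]
  have JC: "J \<subseteq> cont_funs Q" by (auto simp: J_def)
  have inc: "increasing_net (sup_dist P Q) J (le_by P Q 0) (\<lambda>c. c)"
    by (simp add: increasing_net_def sup_dist_zero_iff)
  note x = cauchy_net_along[OF J increasing_net_cauchy[OF J inc]]
  have S: "eventually (\<lambda>c. c \<in> lsc_funs P Q) ?F" and B: "eventually (\<lambda>c. c \<in> bounded_funs Q) ?F"
    and up: "eventually (\<lambda>c. le_by P Q e c f) ?F"
    using eventually_net_filterD[OF J]
    by (eventually_elim; use JC cont_subset_lsc lsc_subset_bounded Jf in blast)+
  obtain r where "eventually (\<lambda>c. \<forall>q\<in>topspace Q. norm (c q) \<le> r) ?F"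
    by (rule cauchy_bounded[OF gen F x B fB up])
  then obtain g where g: "g \<in> lsc_funs P Q" "pointwise_limit P Q ?F (\<lambda>c. c) g"
    by (rule lsc_funs_complete[OF F x S])
  have lim: "circ_limit (sup_dist P Q) (bounded_funs Q) J (le_by P Q 0) (\<lambda>c. c) g"
    using g(2) by (intro circ_limit_pointwise) (simp add: pointwise_limit_def)
  have gB: "g \<in> bounded_funs Q" using g(1) lsc_subset_bounded by blast
  show ?thesis
  proof (rule that)
    show "g \<in> increasing_limits (sup_dist P Q) (bounded_funs Q) (cont_funs Q)"
      using increasing_limits_any[OF J _ inc lim gB] JC by simp
    show "le_by P Q e g f" using e by (intro circ_limit_lower_at[OF J lim fB up]) simp
    have Jg: "le_by P Q 0 c g" if c: "c \<in> J" for c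
    proof (rule circ_limit_upper_at[OF J lim])
      show "c \<in> bounded_funs Q" using c JC cont_funs_bounded by blast
      show "\<forall>\<^sub>F c' in ?F. le_by P Q 0 c c'" using eventually_net_above[OF J c] by (rule eventually_mono) simp
    qed simp
    have "sup_dist P Q f g \<le> (SUP c\<in>I. sup_dist P Q c g)" using I gB by (simp add: generates_def)
    also have "\<dots> \<le> 0" using Jg IJ by (intro SUP_least) (auto simp: sup_dist_zero_iff)
    finally show "le_by P Q 0 f g" by (simp flip: sup_dist_zero_iff)
  qed
qed

text \<open>Enclosing g between f and f plus a small error on the dual ball gives norm closeness
  because the dual cone generates. Conversely, increasing limits are Cauchy limits, hence in S,
  which is norm closed.\<close>

lemma lsc_eq_norm_closure:
  assumes gen: "dual_generated P" and dir: "open_ball_directed P"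
  shows "lsc_funs P Q = norm_closure Q (increasing_limits (sup_dist P Q) (bounded_funs Q) (cont_funs Q))"
proof (intro subset_antisym subsetI)
  fix f assume f: "f \<in> lsc_funs P Q"
  obtain M where M: "0 < M" "\<And>(a :: 'a bidual) r. (\<And>\<phi>. \<phi> \<in> dual_ball P \<Longrightarrow> \<bar>blinfun_apply a \<phi>\<bar> \<le> r) \<Longrightarrow> norm a \<le> M * r"
    using dual_generated_bound[OF gen] by metis
  show "f \<in> norm_closure Q (increasing_limits (sup_dist P Q) (bounded_funs Q) (cont_funs Q))"
    unfolding norm_closure_def
  proof (intro CollectI conjI allI impI)
    show "f \<in> bounded_funs Q" using f lsc_subset_bounded by blast
    fix e :: real assume e: "0 < e"
    have "0 < e / (2 * M)" using e M by simp
    then obtain g where g: "g \<in> increasing_limits (sup_dist P Q) (bounded_funs Q) (cont_funs Q)"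
      "le_by P Q 0 f g" "le_by P Q (e / (2 * M)) g f" using lsc_near_increasing_limit[OF gen dir f] by metis
    have "norm (f q - g q) \<le> e / 2" if q: "q \<in> topspace Q" for q
    proof -
      have "norm (f q - g q) \<le> M * (e / (2 * M))"
      proof (rule M(2))
        fix \<phi> assume \<phi>: "\<phi> \<in> dual_ball P"
        show "\<bar>blinfun_apply (f q - g q) \<phi>\<bar> \<le> e / (2 * M)"
          using le_byD[OF g(2) q \<phi>] le_byD[OF g(3) q \<phi>] \<open>0 < e / (2 * M)\<close> unfolding blinfun.diff_left by linarith
      qed
      then show ?thesis using M(1) by simp
    qed
    then have "sup_norm Q (\<lambda>p. f p - g p) \<le> ennreal (e / 2)" using e by (subst sup_norm_le_iff) auto
    also have "\<dots> < ennreal e" using e by (simp add: ennreal_less_iff)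
    finally show "\<exists>g\<in>increasing_limits (sup_dist P Q) (bounded_funs Q) (cont_funs Q). sup_norm Q (\<lambda>p. f p - g p) < ennreal e"
      using g(1) by blast
  qed
next
  fix f assume f: "f \<in> norm_closure Q (increasing_limits (sup_dist P Q) (bounded_funs Q) (cont_funs Q))"
  show "f \<in> lsc_funs P Q"
  proof (rule lsc_funs_norm_closed[OF gen])
    show "f \<in> bounded_funs Q" using f by (simp add: norm_closure_def)
    fix e :: real assume e: "0 < e"
    obtain g where g: "g \<in> increasing_limits (sup_dist P Q) (bounded_funs Q) (cont_funs Q)"
      "sup_norm Q (\<lambda>p. f p - g p) < ennreal e" using f e by (auto simp: norm_closure_def)
    have "g \<in> lsc_funs P Q"
      using g(1) increasing_subset_cauchy_limits cauchy_limits_subset_lsc[OF gen] by blast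
    moreover have "\<forall>q\<in>topspace Q. norm (f q - g q) \<le> e"
      using less_imp_le[OF g(2)] e by (simp add: sup_norm_le_iff)
    ultimately show "\<exists>g\<in>lsc_funs P Q. \<forall>q\<in>topspace Q. norm (f q - g q) \<le> e" by blast
  qed
qed

end

theorem theorem5:
  fixes P :: "'a::banach set" and Q :: "'q topology"
  defines "d \<equiv> sup_dist P Q"
    and "B \<equiv> (bounded_funs Q :: ('q \<Rightarrow> 'a bidual) set)"
    and "C \<equiv> cont_funs Q"
    and "S \<equiv> lsc_funs P Q"
    and "C1 \<equiv> unit_part Q (cont_funs Q)"
    and "S1 \<equiv> unit_part Q (lsc_funs P Q)"
  assumes "preordered_banach P"
    and "compact_space Q" and "Hausdorff_space Q"
  shows "S1 \<subseteq> cauchy_limits d B C1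
    \<and> d_complete d S1 \<and> d_algebraic d S1 \<and> C1 \<subseteq> finite_elements d S1
    \<and> cauchy_limits d B C = dominating_limits d B C
    \<and> (second_countable Q \<and> second_countable (euclidean :: 'a topology) \<longrightarrow>
         cauchy_limits d B C = increasing_seq_limits d B C)
    \<and> (unit_ball_bounded P \<longrightarrow> cauchy_limits d B C = increasing_limits d B C)
    \<and> (dual_generated P \<longrightarrow>
         cauchy_limits d B C = S \<and> finite_elements d S = C
         \<and> (open_ball_directed P \<longrightarrow>
              cauchy_limits d B C = norm_closure Q (increasing_limits d B C)))"
proof -
  interpret preordered_functions P Q by unfold_locales (fact assms)+
  have cd: "cauchy_limits d B C = dominating_limits d B C"
    unfolding d_def B_def C_def using cauchy_limits_iff dominating_limits_iff by blast
  have seq: "cauchy_limits d B C = increasing_seq_limits d B C"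
    if "second_countable Q" "second_countable (euclidean :: 'a topology)"
    unfolding d_def B_def C_def
  proof (intro subset_antisym increasing_seq_subset_cauchy_limits subsetI)
    fix z assume "z \<in> cauchy_limits (sup_dist P Q) (bounded_funs Q) (cont_funs Q)"
    then show "z \<in> increasing_seq_limits (sup_dist P Q) (bounded_funs Q) (cont_funs Q)"
      using generates_increasing_seq_limit[OF that] unfolding cauchy_limits_iff by blast
  qed
  have inc: "cauchy_limits d B C = increasing_limits d B C" if "unit_ball_bounded P"
    unfolding d_def B_def C_def
  proof (intro subset_antisym increasing_subset_cauchy_limits subsetI)
    fix z assume "z \<in> cauchy_limits (sup_dist P Q) (bounded_funs Q) (cont_funs Q)"
    then show "z \<in> increasing_limits (sup_dist P Q) (bounded_funs Q) (cont_funs Q)"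
      using generates_increasing_limit[OF that] unfolding cauchy_limits_iff by blast
  qed
  have lsc: "cauchy_limits d B C = S" if "dual_generated P"
    unfolding d_def B_def C_def S_def using cauchy_limits_subset_lsc[OF that] lsc_subset_cauchy_limits by blast
  have fin: "finite_elements d S = C" if "dual_generated P"
    unfolding d_def C_def S_def using finite_subset_cont[OF that] cont_subset_finite[OF that] by blast
  have clos: "cauchy_limits d B C = norm_closure Q (increasing_limits d B C)"
    if "dual_generated P" "open_ball_directed P"
    unfolding lsc[OF that(1)] unfolding d_def B_def C_def S_def by (rule lsc_eq_norm_closure[OF that])
  show ?thesis
    using cd seq inc lsc fin clos unit_lsc_subset_cauchy_limits unit_lsc_complete unit_lsc_algebraic unit_cont_subset_finite
    unfolding d_def B_def C1_def S1_def by blast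
qed

end
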